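(* Suppose $E:\mathcal{P}_{2,\omega_0}(\mathbb{R}^d)\to\mathbb{R}\cup\{+\infty\}$ is proper, coercive, lower semicontinuous and $\lambda$-convex along generalized geodesics for some $\lambda\in\mathbb{R}$. For $\mu\in\overline{D(E)}$ and $t\ge0$, the sequence $J^n_{t/n}\mu$ converges in $W_2$ as $n\to\infty$; the convergence is uniform in $t$ on compact subsets of $[0,+\infty)$, and the limit $\mu(t)$ is the gradient flow of $E$ with initial datum $\mu$. When $\mu\in D(|\partial E|)$ and $n>2\lambda^-t$, $$W_2(J^n_{t/n}\mu,\mu(t))\le\sqrt3\,\frac{t}{\sqrt n}\,e^{3\lambda^-t}|\partial E|(\mu).$$
   Context: Fix a probability measure $\omega_0$ on $\mathbb{R}^d$. $\Gamma(\mu,\nu)$ couplings, $W_2(\mu,\nu)=\inf_{\boldsymbol\mu\in\Gamma(\mu,\nu)}(\int|x_1-x_2|^2d\boldsymbol\mu)^{1/2}$, $\Gamma_0$ optimal couplings; $\mathcal{P}_{2,\omega_0}(\mathbb{R}^d)=\{\mu:W_2(\mu,\omega_0)<\infty\}$ with metric $W_2$; $\pi^i,\pi^{i,j}$ projections, $\#$ push-forward. A transport plan from $\mu_0$ to $\mu_1$ with base $\omega$ is $\boldsymbol\omega\in\mathcal{P}((\mathbb{R}^d)^3)$ with $\pi^{1,2}\#\boldsymbol\omega\in\Gamma_0(\omega,\mu_0)$, $\pi^{1,3}\#\boldsymbol\omega\in\Gamma_0(\omega,\mu_1)$; the generalized geodesic is $\mu_\alpha=((1-\alpha)\pi^2+\alpha\pi^3)\#\boldsymbol\omega$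 and $W_{2,\boldsymbol\omega}(\mu_0,\mu_1)=(\int|x_2-x_3|^2d\boldsymbol\omega)^{1/2}$. $D(E)=\{E<\infty\}$; proper: $D(E)\ne\emptyset$; coercive: $\exists\tau_0>0,u_0$ with $\inf_v\{\frac1{2\tau_0}W_2^2(u_0,v)+E(v)\}>-\infty$; lower semicontinuous w.r.t. $W_2$; $\lambda$-convex along generalized geodesics: for all $\mu_0,\mu_1,\omega$ there is a generalized geodesic (induced by some $\boldsymbol\omega$) with $E(\mu_\alpha)\le(1-\alpha)E(\mu_0)+\alpha E(\mu_1)-\alpha(1-\alpha)\frac\lambda2W^2_{2,\boldsymbol\omega}(\mu_0,\mu_1)$. $\lambda^-=\max\{0,-\lambda\}$. $\overline{D(E)}$ is the $W_2$-closure. $J_\tau\mu=\operatorname{argmin}_\nu\{\frac1{2\tau}W_2^2(\mu,\nu)+E(\nu)\}$ (well defined for $\mu\in\overline{D(E)}$, $0<\tau<1/\lambda^-$); $J^n_\tau$ is its $n$-fold iterate. Metric slope: $|\partial E|(\mu)=\limsup_{\nu\to\mu}(E(\mu)-E(\nu))^+/W_2(\mu,\nu)$ for $\mu\in D(E)$; $D(|\partial E|)=\{\mu\in D(E):|\partial E|(\mu)<\infty\}$. Gradient flow: a curve $\mu:(0,\infty)\to\mathcal{P}_{2,\omega_0}$ which is locally absolutely continuous (for each bounded interval $I$ there is $m\in L^1(I)$ with $W_2(\mu(s),\mu(t))\le\int_s^tm$ for $s\le t$ in $I$) is the gradient flow of $E$ with initial datum $\mu\in\overline{D(E)}$ if $\mu(t)\to\mu$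 as $t\to0$ and $\frac12\frac{d}{dt}W_2^2(\mu(t),\omega)+\frac\lambda2W_2^2(\mu(t),\omega)\le E(\omega)-E(\mu(t))$ for all $\omega\in D(E)$ and a.e. $t>0$.
   Formalization: Local absolute continuity of the gradient flow is required on compact intervals [a,b] with a > 0 rather than on every bounded interval, since for initial data outside D(E) the curve can have infinite length near t = 0. *)

theory Defs
  imports "HOL-Probability.Probability"
begin

text \<open>R^d is modelled by an arbitrary Euclidean space type 'a; probability measures on R^d
are measures M with prob_space M and sets M = sets borel.\<close>

definition couplings :: "'a::euclidean_space measure \<Rightarrow> 'a measure \<Rightarrow> ('a \<times> 'a) measure set" where
  "couplings \<mu> \<nu> = {\<gamma>. prob_space \<gamma> \<and> sets \<gamma> = sets borel \<and>
      distr \<gamma> borel fst = \<mu> \<and> distr \<gamma> borel snd = \<nu>}"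

definition tcost :: "('a::euclidean_space \<times> 'a) measure \<Rightarrow> ennreal" where
  "tcost \<gamma> = (\<integral>\<^sup>+ p. ennreal ((dist (fst p) (snd p))\<^sup>2) \<partial>\<gamma>)"

definition W2cost :: "'a::euclidean_space measure \<Rightarrow> 'a measure \<Rightarrow> ennreal" where
  "W2cost \<mu> \<nu> = (INF \<gamma>\<in>couplings \<mu> \<nu>. tcost \<gamma>)"

definition W2 :: "'a::euclidean_space measure \<Rightarrow> 'a measure \<Rightarrow> real" where
  "W2 \<mu> \<nu> = sqrt (enn2real (W2cost \<mu> \<nu>))"

definition opt_couplings :: "'a::euclidean_space measure \<Rightarrow> 'a measure \<Rightarrow> ('a \<times> 'a) measure set" where
  "opt_couplings \<mu> \<nu> = {\<gamma>\<in>couplings \<mu> \<nu>. tcost \<gamma> = W2cost \<mu> \<nu>}"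

definition P2 :: "'a::euclidean_space measure \<Rightarrow> 'a measure set" where
  "P2 \<omega>0 = {\<mu>. prob_space \<mu> \<and> sets \<mu> = sets borel \<and> W2cost \<mu> \<omega>0 < \<infinity>}"

definition transport_plans ::
  "'a::euclidean_space measure \<Rightarrow> 'a measure \<Rightarrow> 'a measure \<Rightarrow> ('a \<times> 'a \<times> 'a) measure set" where
  "transport_plans \<omega> \<mu>0 \<mu>1 = {w. prob_space w \<and> sets w = sets borel \<and>
      distr w borel (\<lambda>(x, y, z). (x, y)) \<in> opt_couplings \<omega> \<mu>0 \<and>
      distr w borel (\<lambda>(x, y, z). (x, z)) \<in> opt_couplings \<omega> \<mu>1}"

definition gen_geod :: "('a::euclidean_space \<times> 'a \<times> 'a) measure \<Rightarrow> real \<Rightarrow> 'a measure" where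
  "gen_geod w \<alpha> = distr w borel (\<lambda>(x, y, z). (1 - \<alpha>) *\<^sub>R y + \<alpha> *\<^sub>R z)"

definition W2plan :: "('a::euclidean_space \<times> 'a \<times> 'a) measure \<Rightarrow> real" where
  "W2plan w = sqrt (enn2real (\<integral>\<^sup>+ p. ennreal ((dist (fst (snd p)) (snd (snd p)))\<^sup>2) \<partial>w))"

definition domE :: "'a::euclidean_space measure \<Rightarrow> ('a measure \<Rightarrow> ereal) \<Rightarrow> 'a measure set" where
  "domE \<omega>0 E = {\<mu>\<in>P2 \<omega>0. E \<mu> < \<infinity>}"

definition proper_fun :: "'a::euclidean_space measure \<Rightarrow> ('a measure \<Rightarrow> ereal) \<Rightarrow> bool" where
  "proper_fun \<omega>0 E \<longleftrightarrow> domE \<omega>0 E \<noteq> {}"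

definition coercive :: "'a::euclidean_space measure \<Rightarrow> ('a measure \<Rightarrow> ereal) \<Rightarrow> bool" where
  "coercive \<omega>0 E \<longleftrightarrow> (\<exists>\<tau>0>0. \<exists>u0\<in>P2 \<omega>0.
      (INF v\<in>P2 \<omega>0. ereal ((W2 u0 v)\<^sup>2 / (2 * \<tau>0)) + E v) > -\<infinity>)"

definition lsc_W2 :: "'a::euclidean_space measure \<Rightarrow> ('a measure \<Rightarrow> ereal) \<Rightarrow> bool" where
  "lsc_W2 \<omega>0 E \<longleftrightarrow> (\<forall>\<mu>\<in>P2 \<omega>0. \<forall>s. (\<forall>n. s n \<in> P2 \<omega>0) \<and> (\<lambda>n. W2 (s n) \<mu>) \<longlonglongrightarrow> 0
      \<longrightarrow> E \<mu> \<le> liminf (\<lambda>n. E (s n)))"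

definition convex_gen_geod ::
  "'a::euclidean_space measure \<Rightarrow> ('a measure \<Rightarrow> ereal) \<Rightarrow> real \<Rightarrow> bool" where
  "convex_gen_geod \<omega>0 E lam \<longleftrightarrow> (\<forall>\<mu>0\<in>P2 \<omega>0. \<forall>\<mu>1\<in>P2 \<omega>0. \<forall>\<omega>\<in>P2 \<omega>0.
      \<exists>w\<in>transport_plans \<omega> \<mu>0 \<mu>1. \<forall>\<alpha>\<in>{0..1}.
        E (gen_geod w \<alpha>) \<le> ereal (1 - \<alpha>) * E \<mu>0 + ereal \<alpha> * E \<mu>1
                              - ereal (\<alpha> * (1 - \<alpha>) * (lam / 2) * (W2plan w)\<^sup>2))"

definition neg_part :: "real \<Rightarrow> real" where
  "neg_part lam = max 0 (- lam)"

definition domE_closure :: "'a::euclidean_space measure \<Rightarrow> ('a measure \<Rightarrow> ereal) \<Rightarrow> 'a measure set" where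
  "domE_closure \<omega>0 E = {\<mu>\<in>P2 \<omega>0. \<forall>\<epsilon>>0. \<exists>\<nu>\<in>domE \<omega>0 E. W2 \<mu> \<nu> < \<epsilon>}"

text \<open>J_tau mu = argmin_nu (W2(mu,nu)^2/(2 tau) + E nu) for tau > 0; convention J_0 = identity
(so that J^n_{t/n} mu = mu for t = 0).\<close>
definition Jres :: "'a::euclidean_space measure \<Rightarrow> ('a measure \<Rightarrow> ereal) \<Rightarrow> real \<Rightarrow> 'a measure \<Rightarrow> 'a measure" where
  "Jres \<omega>0 E \<tau> \<mu> = (if 0 < \<tau> then
      (SOME \<nu>. \<nu> \<in> P2 \<omega>0 \<and> (\<forall>\<nu>'\<in>P2 \<omega>0.
         ereal ((W2 \<mu> \<nu>)\<^sup>2 / (2 * \<tau>)) + E \<nu> \<le> ereal ((W2 \<mu> \<nu>')\<^sup>2 / (2 * \<tau>)) + E \<nu>'))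
    else \<mu>)"

definition slope :: "'a::euclidean_space measure \<Rightarrow> ('a measure \<Rightarrow> ereal) \<Rightarrow> 'a measure \<Rightarrow> ereal" where
  "slope \<omega>0 E \<mu> = (INF r\<in>{0::real<..}. max 0
      (SUP \<nu>\<in>{\<nu>\<in>P2 \<omega>0. 0 < W2 \<mu> \<nu> \<and> W2 \<mu> \<nu> < r}. max 0 (E \<mu> - E \<nu>) / ereal (W2 \<mu> \<nu>)))"

definition dom_slope :: "'a::euclidean_space measure \<Rightarrow> ('a measure \<Rightarrow> ereal) \<Rightarrow> 'a measure set" where
  "dom_slope \<omega>0 E = {\<mu>\<in>domE \<omega>0 E. slope \<omega>0 E \<mu> < \<infinity>}"

definition loc_abs_cont :: "(real \<Rightarrow> 'a::euclidean_space measure) \<Rightarrow> bool" where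
  "loc_abs_cont u \<longleftrightarrow> (\<forall>a b. 0 < a \<and> a \<le> b \<longrightarrow> (\<exists>m. m integrable_on {a..b} \<and>
      (\<forall>s t. a \<le> s \<and> s \<le> t \<and> t \<le> b \<longrightarrow> W2 (u s) (u t) \<le> integral {s..t} m)))"

definition gradient_flow ::
  "'a::euclidean_space measure \<Rightarrow> ('a measure \<Rightarrow> ereal) \<Rightarrow> real \<Rightarrow> (real \<Rightarrow> 'a measure) \<Rightarrow> 'a measure \<Rightarrow> bool" where
  "gradient_flow \<omega>0 E lam u \<mu> \<longleftrightarrow>
     (\<forall>t>0. u t \<in> P2 \<omega>0) \<and> loc_abs_cont u \<and>
     ((\<lambda>t. W2 (u t) \<mu>) \<longlongrightarrow> 0) (at_right 0) \<and>
     (\<forall>\<omega>\<in>domE \<omega>0 E. AE t in lborel. t > 0 \<longrightarrow>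
        (\<exists>D. ((\<lambda>s. (W2 (u s) \<omega>)\<^sup>2) has_real_derivative D) (at t) \<and>
             ereal (D / 2 + lam / 2 * (W2 (u t) \<omega>)\<^sup>2) \<le> E \<omega> - E (u t)))"

end

theory Submission
  imports Defs
begin

text \<open>
  Testing the minimality of \<open>J\<^sub>\<tau> x\<close> along the generalized geodesic with base \<open>x\<close> gives the discrete
  evolution variational inequality
  \<open>(1 + \<lambda> \<tau>) d(J\<^sub>\<tau> x, y)\<^sup>2 - d(x, y)\<^sup>2 \<le> 2 \<tau> (E y - E (J\<^sub>\<tau> x)) - d(x, J\<^sub>\<tau> x)\<^sup>2\<close>.
  Applied to the iterates for two step sizes \<open>\<tau>\<close> and \<open>h\<close>, each tested with the other and weighted by the
  opposite step size, the energies cancel, and the squared distance of the \<open>i\<close>-th from the \<open>j\<close>-th iterate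
  obeys a Crandall--Liggett recursion dominated by a multiple of \<open>(i \<tau> - j h)\<^sup>2 + \<tau> h (i + j)\<close>. For
  initial data of finite slope this gives convergence with the stated rate; an almost-contraction
  property of \<open>J\<^sub>\<tau>\<close> extends the convergence to the closure of the domain. Away from time \<open>0\<close> consecutive
  iterates are at distance \<open>O(\<tau>)\<close>, so the limit curve is locally Lipschitz, its squared distance to a
  fixed point is differentiable almost everywhere, and the discrete inequality passes to the limit.

  Optimal plans with a common base, hence the triangle inequality, come from the convexity hypothesis.
  Completeness of the Wasserstein space is obtained by realizing a chain of couplings, up to small
  errors, by random variables on an infinite product space.
\<close>

section \<open>Elementary estimates\<close>

text \<open>In general the squared Wasserstein distance from a fixed measure is not sufficiently
  convex along ordinary geodesics. Along a generalized geodesic based at that very measure, half of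
  it is 1-convex with respect to the plan distance. With base \<open>x\<close>, penalty and energy
  are therefore convex in one and the same distance, with total modulus
  \<open>1 / \<tau> + \<lambda>\<close>; this makes minimizing sequences Cauchy. It does not make
  the resolvent a contraction: comparisons between different orbits rest on energies that cancel or
  telescope. The range \<open>2 * \<kappa> * \<tau> < 1\<close>, with \<kappa> the negative part of
  \<lambda>, comes from coercivity. Convexity bounds the quadratic decay of the energy by any
  coefficient above \<open>\<kappa> / 2\<close>, and recentring this bound at \<open>x\<close> costs
  a factor 2. For \<open>\<tau> = t / n\<close> the range reads \<open>n > 2 * \<kappa> * t\<close>.
  Initial points in the closure of the domain come without an energy bound. Their orbits are
  controlled through nearby points of finite slope, and regularity in time is obtained only away
  from 0.\<close>

lemma le_of_le_add_scaled:
  fixes a b c :: real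
  assumes "\<And>\<alpha>. 0 < \<alpha> \<Longrightarrow> \<alpha> < 1 \<Longrightarrow> a \<le> b + \<alpha> * c"
  shows "a \<le> b"
proof -
  have "((\<lambda>\<alpha>. b + \<alpha> * c) \<longlongrightarrow> b + 0 * c) (at_right (0::real))"
    by (intro tendsto_intros)
  moreover have "eventually (\<lambda>\<alpha>. a \<le> b + \<alpha> * c) (at_right (0::real))"
    unfolding eventually_at_right_field using assms by (intro exI[of _ 1]) simp
  ultimately show ?thesis
    using tendsto_lowerbound[of "\<lambda>\<alpha>. b + \<alpha> * c" "b + 0 * c"] by simp
qed

lemma neg_part_bounds: "0 \<le> neg_part lam" "- lam \<le> neg_part lam" "- neg_part lam \<le> lam"
  by (auto simp: neg_part_def)

text \<open>For \<open>y \<le> 1 / 2\<close> the product \<open>(1 + 2 * y) * (1 - y)\<close> is at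
  least 1. A product of \<open>n\<close> one-step factors thus becomes an exponential of elapsed
  time; the doubled exponent is the price of uniformity in the step size.\<close>

lemma inverse_one_minus_power_le_exp:
  fixes y :: real
  assumes "0 \<le> y" "y \<le> 1 / 2"
  shows "1 / (1 - y) ^ n \<le> exp (2 * (real n * y))"
proof -
  have "1 \<le> (1 + 2 * y) * (1 - y)"
    using mult_nonneg_nonneg[of y "1 - 2 * y"] assms by (simp add: algebra_simps)
  then have "1 / (1 - y) \<le> 1 + 2 * y"
    using assms by (simp add: field_simps)
  also have "\<dots> \<le> exp (2 * y)"
    by (rule exp_ge_add_one_self)
  finally have "(1 / (1 - y)) ^ n \<le> exp (2 * y) ^ n"
    using assms by (intro power_mono) auto
  then show ?thesis
    using exp_of_nat_mult[of n "2 * y"] by (simp add: power_divide mult_ac)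
qed

lemma sum_descending: "(\<Sum>j<n. real (n - j)) = real n * real (Suc n) / 2"
  by (induction n) (simp_all add: sum.lessThan_Suc_shift field_simps del: sum.lessThan_Suc)

lemma floor_multiple:
  fixes s \<tau> :: real
  assumes "0 < \<tau>" "0 \<le> s"
  shows "real (nat \<lfloor>s / \<tau>\<rfloor>) * \<tau> \<le> s" "s < real (nat \<lfloor>s / \<tau>\<rfloor>) * \<tau> + \<tau>"
proof -
  have "0 \<le> s / \<tau>" using assms by simp
  then have r: "real (nat \<lfloor>s / \<tau>\<rfloor>) = of_int \<lfloor>s / \<tau>\<rfloor>" by simp
  have "of_int \<lfloor>s / \<tau>\<rfloor> \<le> s / \<tau>" "s / \<tau> < of_int \<lfloor>s / \<tau>\<rfloor> + 1" by linarith+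
  then have "of_int \<lfloor>s / \<tau>\<rfloor> * \<tau> \<le> s" "s < (of_int \<lfloor>s / \<tau>\<rfloor> + 1) * \<tau>"
    by (simp_all only: pos_le_divide_eq[OF assms(1)] pos_divide_less_eq[OF assms(1)])
  then show "real (nat \<lfloor>s / \<tau>\<rfloor>) * \<tau> \<le> s" "s < real (nat \<lfloor>s / \<tau>\<rfloor>) * \<tau> + \<tau>"
    unfolding r by (simp_all add: distrib_right)
qed

text \<open>The derivative exists, so it is also the limit of left difference quotients. Increments
  ending at \<open>t\<close> suffice, and the error \<open>C * (t - s)\<close> of the quotient
  vanishes in the limit.\<close>

lemma left_difference_quotient_bound:
  fixes f :: "real \<Rightarrow> real"
  assumes der: "(f has_real_derivative D) (at t)" and a: "a < t"
    and le: "\<And>s. a \<le> s \<Longrightarrow> s < t \<Longrightarrow> f t - f s \<le> (t - s) * (Q + C * (t - s))"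
  shows "D \<le> Q"
proof -
  have "((\<lambda>s. (f s - f t) / (s - t)) \<longlongrightarrow> D) (at_left t)"
    using der unfolding has_field_derivative_iff by (rule tendsto_mono[rotated]) (simp add: at_le)
  moreover have "((\<lambda>s. Q + C * (t - s)) \<longlongrightarrow> Q + C * (t - t)) (at_left t)"
    by (intro tendsto_intros)
  moreover have "eventually (\<lambda>s. (f s - f t) / (s - t) \<le> Q + C * (t - s)) (at_left t)"
    unfolding eventually_at_left_field
  proof (intro exI[of _ a] conjI allI impI a)
    fix s assume s: "a < s" "s < t"
    have "f t - f s \<le> (Q + C * (t - s)) * (t - s)" using le[of s] s by (simp add: mult.commute)
    then have "(f t - f s) / (t - s) \<le> Q + C * (t - s)" using s by (simp add: divide_le_eq)
    moreover have "(f s - f t) / (s - t) = (f t - f s) / (t - s)"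
      using minus_divide_divide[of "f t - f s" "t - s"] by simp
    ultimately show "(f s - f t) / (s - t) \<le> Q + C * (t - s)" by simp
  qed
  ultimately have "D \<le> Q + C * (t - t)"
    by (intro tendsto_le[OF trivial_limit_at_left_real])
  then show ?thesis by simp
qed

section \<open>Functionals convex along generalized geodesics\<close>

text \<open>Points at distance zero may differ; \<open>e_le_of_d_zero\<close> deals with such pairs.
  Nonnegativity is asked of all arguments because \<open>W2\<close>, as a square root of a
  nonnegative number, has it everywhere.\<close>

locale pseudometric_on =
  fixes X :: "'b set" and d :: "'b \<Rightarrow> 'b \<Rightarrow> real"
  assumes d_nonneg: "0 \<le> d x y"
    and d_refl: "x \<in> X \<Longrightarrow> d x x = 0"
    and d_sym: "x \<in> X \<Longrightarrow> y \<in> X \<Longrightarrow> d x y = d y x"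
    and d_tri: "x \<in> X \<Longrightarrow> y \<in> X \<Longrightarrow> z \<in> X \<Longrightarrow> d x z \<le> d x y + d y z"
begin

lemma abs_d_diff_le:
  assumes "x \<in> X" "y \<in> X" "z \<in> X"
  shows "\<bar>d x z - d y z\<bar> \<le> d x y"
  using d_tri[OF assms] d_tri[OF assms(2,1,3)] d_sym[OF assms(1,2)] by linarith

lemma tendsto_d:
  assumes "\<And>n. s n \<in> X" "x \<in> X" "y \<in> X" "(\<lambda>n. d (s n) x) \<longlonglongrightarrow> 0"
  shows "(\<lambda>n. d (s n) y) \<longlonglongrightarrow> d x y"
proof (rule LIM_zero_cancel, rule tendsto_rabs_zero_cancel, rule tendsto_sandwich[OF _ _ tendsto_const assms(4)])
  show "\<forall>\<^sub>F n in sequentially. \<bar>d (s n) y - d x y\<bar> \<le> d (s n) x"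
    using abs_d_diff_le assms by (intro always_eventually) blast
qed simp

lemma d_sq_le:
  assumes "x \<in> X" "y \<in> X" "z \<in> X"
  shows "(d x z)\<^sup>2 \<le> 2 * (d x y)\<^sup>2 + 2 * (d y z)\<^sup>2"
proof -
  have "(d x z)\<^sup>2 \<le> (d x y + d y z)\<^sup>2"
    using d_tri[OF assms] d_nonneg by (intro power_mono) auto
  also have "\<dots> \<le> 2 * (d x y)\<^sup>2 + 2 * (d y z)\<^sup>2"
    using zero_le_power2[of "d x y - d y z"] by (simp add: power2_eq_square algebra_simps)
  finally show ?thesis .
qed

end

text \<open>\<open>D\<close> and \<open>e\<close> represent the domain and the finite values of an
  extended-valued functional, and lower semicontinuity appears as closedness of sublevels. In
  \<open>gen_convex\<close>, \<open>W\<close> models the distance measured by a plan with base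
  \<open>w\<close>: it may exceed \<open>d x y\<close>, is the same for all \<alpha>, and enters
  both the energy inequality and the one for the squared distance from \<open>w\<close>.\<close>

locale gen_convex_functional = pseudometric_on X d
  for X :: "'b set" and d :: "'b \<Rightarrow> 'b \<Rightarrow> real" +
  fixes D :: "'b set" and e :: "'b \<Rightarrow> real" and lam :: real
  assumes D_sub: "D \<subseteq> X" and D_nonempty: "D \<noteq> {}"
    and complete: "\<And>s. (\<And>n. s n \<in> X) \<Longrightarrow>
      (\<And>\<epsilon>. 0 < \<epsilon> \<Longrightarrow> \<exists>N. \<forall>m\<ge>N. \<forall>n\<ge>N. d (s m) (s n) < \<epsilon>) \<Longrightarrow>
      \<exists>x\<in>X. (\<lambda>n. d (s n) x) \<longlonglongrightarrow> 0"
    and sublevel_closed: "\<And>s x c. (\<And>n. s n \<in> D) \<Longrightarrow> (\<And>n. e (s n) \<le> c) \<Longrightarrow> x \<in> X \<Longrightarrow>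
      (\<lambda>n. d (s n) x) \<longlonglongrightarrow> 0 \<Longrightarrow> x \<in> D \<and> e x \<le> c"
    and coercive_on: "\<exists>u\<in>X. \<exists>b\<ge>0. \<exists>C. \<forall>v\<in>D. - C - b * (d u v)\<^sup>2 \<le> e v"
    and gen_convex: "\<And>w x y. w \<in> X \<Longrightarrow> x \<in> D \<Longrightarrow> y \<in> D \<Longrightarrow>
      \<exists>W\<ge>d x y. \<forall>\<alpha>\<in>{0..1}. \<exists>z\<in>D.
        e z \<le> (1 - \<alpha>) * e x + \<alpha> * e y - \<alpha> * (1 - \<alpha>) * (lam / 2) * W\<^sup>2 \<and>
        (d w z)\<^sup>2 \<le> (1 - \<alpha>) * (d w x)\<^sup>2 + \<alpha> * (d w y)\<^sup>2 - \<alpha> * (1 - \<alpha>) * W\<^sup>2"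
begin

abbreviation \<kappa> :: real where "\<kappa> \<equiv> neg_part lam"

lemma DX: "x \<in> D \<Longrightarrow> x \<in> X"
  using D_sub by blast

text \<open>\<open>sublevel_closed\<close> speaks of one constant. A tail of the sequence lies in
  the sublevel of \<open>c0 + \<epsilon>\<close> for each positive \<epsilon>, which handles
  convergent bounds.\<close>

lemma lsc_tendsto:
  assumes s: "\<And>n. s n \<in> D" and c: "c \<longlonglongrightarrow> c0" and le: "\<And>n. e (s n) \<le> c n"
    and x: "x \<in> X" "(\<lambda>n. d (s n) x) \<longlonglongrightarrow> 0"
  shows "x \<in> D \<and> e x \<le> c0"
proof -
  have *: "x \<in> D \<and> e x \<le> c0 + \<epsilon>" if "0 < \<epsilon>" for \<epsilon>
  proof -
    have "eventually (\<lambda>n. c n < c0 + \<epsilon>) sequentially"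
      using order_tendstoD(2)[OF c, of "c0 + \<epsilon>"] that by simp
    then obtain N where N: "\<And>n. n \<ge> N \<Longrightarrow> c n < c0 + \<epsilon>"
      by (auto simp: eventually_sequentially)
    have "e (s (n + N)) \<le> c0 + \<epsilon>" for n
      using N[of "n + N"] le[of "n + N"] by auto
    with s x(1) LIMSEQ_ignore_initial_segment[OF x(2), of N] show ?thesis
      by (intro sublevel_closed[of "\<lambda>n. s (n + N)" "c0 + \<epsilon>" x])
  qed
  have "e x \<le> c0"
  proof (rule field_le_epsilon)
    show "e x \<le> c0 + \<epsilon>" if "0 < \<epsilon>" for \<epsilon>
      using *[OF that] by simp
  qed
  then show ?thesis using *[of 1] by simp
qed

text \<open>The constant sequence \<open>y\<close> converges to each point at distance zero from it,
  so lower semicontinuity makes the energy blind to the choice between such points.\<close>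

lemma e_le_of_d_zero:
  assumes "x \<in> D" "y \<in> D" "d x y = 0"
  shows "e x \<le> e y"
proof -
  have "(\<lambda>_::nat. d y x) \<longlonglongrightarrow> 0"
    using assms DX d_sym[of y x] by simp
  then show ?thesis
    using sublevel_closed[of "\<lambda>_. y" "e y" x] assms(1,2) DX by blast
qed

text \<open>The base is the endpoint \<open>x\<close> itself. Then \<open>d x x = 0\<close>, and
  nonnegativity of \<open>(d x z)^2\<close> as the parameter tends to 0 forces
  \<open>W = d x y\<close>. The plan distance disappears, and the intermediate point has distance at
  most \<open>\<alpha> * d x y\<close> from \<open>x\<close>, as on a genuine geodesic.\<close>

lemma geodesic_convex:
  assumes x: "x \<in> D" and y: "y \<in> D" and a: "0 \<le> \<alpha>" "\<alpha> \<le> 1"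
  obtains z where "z \<in> D" "e z \<le> (1 - \<alpha>) * e x + \<alpha> * e y + \<alpha> * (1 - \<alpha>) * (\<kappa> / 2) * (d x y)\<^sup>2"
    "d x z \<le> \<alpha> * d x y"
proof -
  obtain W where W: "W \<ge> d x y" and conv: "\<forall>\<alpha>\<in>{0..1}. \<exists>z\<in>D.
        e z \<le> (1 - \<alpha>) * e x + \<alpha> * e y - \<alpha> * (1 - \<alpha>) * (lam / 2) * W\<^sup>2 \<and>
        (d x z)\<^sup>2 \<le> (1 - \<alpha>) * (d x x)\<^sup>2 + \<alpha> * (d x y)\<^sup>2 - \<alpha> * (1 - \<alpha>) * W\<^sup>2"
    using gen_convex[OF DX[OF x] x y] by blast
  have "W\<^sup>2 \<le> (d x y)\<^sup>2"
  proof (rule le_of_le_add_scaled)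
    fix b :: real assume b: "0 < b" "b < 1"
    then have "b \<in> {0..1}" by simp
    then obtain z where "(d x z)\<^sup>2 \<le> (1 - b) * (d x x)\<^sup>2 + b * (d x y)\<^sup>2 - b * (1 - b) * W\<^sup>2"
      using conv by blast
    then have "(d x z)\<^sup>2 \<le> b * ((d x y)\<^sup>2 - (1 - b) * W\<^sup>2)"
      using d_refl[OF DX[OF x]] by (simp add: algebra_simps)
    then have "0 \<le> b * ((d x y)\<^sup>2 - (1 - b) * W\<^sup>2)"
      using zero_le_power2[of "d x z"] by linarith
    then have "0 \<le> (d x y)\<^sup>2 - (1 - b) * W\<^sup>2"
      using b by (simp add: zero_le_mult_iff)
    then show "W\<^sup>2 \<le> (d x y)\<^sup>2 + b * W\<^sup>2"
      by (simp add: algebra_simps)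
  qed
  then have Weq: "W\<^sup>2 = (d x y)\<^sup>2"
    using power_mono[OF W d_nonneg, of 2] by simp
  have "\<alpha> \<in> {0..1}" using a by simp
  then obtain z where z: "z \<in> D" "e z \<le> (1 - \<alpha>) * e x + \<alpha> * e y - \<alpha> * (1 - \<alpha>) * (lam / 2) * W\<^sup>2"
     "(d x z)\<^sup>2 \<le> (1 - \<alpha>) * (d x x)\<^sup>2 + \<alpha> * (d x y)\<^sup>2 - \<alpha> * (1 - \<alpha>) * W\<^sup>2"
    using conv by blast
  have "\<alpha> * (1 - \<alpha>) * (- lam / 2) * (d x y)\<^sup>2 \<le> \<alpha> * (1 - \<alpha>) * (\<kappa> / 2) * (d x y)\<^sup>2"
    using a neg_part_bounds(2)[of lam] by (intro mult_right_mono mult_left_mono) auto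
  then have "e z \<le> (1 - \<alpha>) * e x + \<alpha> * e y + \<alpha> * (1 - \<alpha>) * (\<kappa> / 2) * (d x y)\<^sup>2"
    using z(2) unfolding Weq by simp
  moreover have "(d x z)\<^sup>2 \<le> (\<alpha> * d x y)\<^sup>2"
    using z(3) d_refl[OF DX[OF x]] unfolding Weq by (simp add: algebra_simps power2_eq_square)
  then have "d x z \<le> \<alpha> * d x y"
    using mult_nonneg_nonneg[OF a(1) d_nonneg] by (rule power2_le_imp_le)
  ultimately show ?thesis by (rule that[OF z(1)])
qed

text \<open>Coercivity gives a quadratic lower bound with some coefficient \<open>b\<close>,
  possibly large. At fraction \<alpha> of the way from \<open>v\<close> to \<open>y\<close> that
  bound loses only order \<open>\<alpha>^2\<close>, whereas convexity involves \<open>e y\<close>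
  with weight \<alpha>. Division by \<alpha> leaves the coefficient
  \<open>2 * b * \<alpha> + \<kappa> / 2\<close>, which a small \<alpha> brings below any
  \<open>c > \<kappa> / 2\<close>.\<close>

lemma quadratic_lower_bound:
  assumes v: "v \<in> D" and c: "\<kappa> / 2 < c"
  shows "\<exists>C. \<forall>z\<in>D. - C - c * (d v z)\<^sup>2 \<le> e z"
proof -
  obtain u b C0 where u: "u \<in> X" and b: "b \<ge> 0" and C0: "\<And>z. z \<in> D \<Longrightarrow> - C0 - b * (d u z)\<^sup>2 \<le> e z"
    using coercive_on by blast
  define C1 where "C1 = C0 + 2 * b * (d u v)\<^sup>2"
  have C1: "- C1 - 2 * b * (d v z)\<^sup>2 \<le> e z" if "z \<in> D" for z
    using C0[OF that] mult_left_mono[OF d_sq_le[OF u DX[OF v] DX[OF that]] b]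
    by (simp add: C1_def algebra_simps)
  \<comment> \<open>Chosen so that \<open>2 * b * \<alpha> \<le> c - \<kappa> / 2\<close>; the
    summand 1 keeps the denominator positive if \<open>b = 0\<close>.\<close>
  define \<alpha> where "\<alpha> = min 1 ((c - \<kappa> / 2) / (2 * b + 1))"
  have a: "0 < \<alpha>" "\<alpha> \<le> 1"
    using b c by (auto simp: \<alpha>_def)
  have "2 * b * \<alpha> \<le> 2 * b * ((c - \<kappa> / 2) / (2 * b + 1))"
    using b by (intro mult_left_mono) (auto simp: \<alpha>_def)
  also have "\<dots> \<le> c - \<kappa> / 2"
    using b c by (simp add: divide_simps)
  finally have ab: "2 * b * \<alpha> + \<kappa> / 2 \<le> c" by simp
  have "- ((C1 + \<bar>e v\<bar>) / \<alpha>) - c * (d v y)\<^sup>2 \<le> e y" if y: "y \<in> D" for y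
  proof -
    obtain z where z: "z \<in> D"
      "e z \<le> (1 - \<alpha>) * e v + \<alpha> * e y + \<alpha> * (1 - \<alpha>) * (\<kappa> / 2) * (d v y)\<^sup>2" "d v z \<le> \<alpha> * d v y"
      using geodesic_convex[OF v y, of \<alpha>] a by auto
    have "(d v z)\<^sup>2 \<le> (\<alpha> * d v y)\<^sup>2"
      using z(3) d_nonneg by (intro power_mono) auto
    then have 1: "2 * b * (d v z)\<^sup>2 \<le> 2 * b * (\<alpha>\<^sup>2 * (d v y)\<^sup>2)"
      using b by (intro mult_left_mono) (auto simp: power_mult_distrib)
    have 2: "(1 - \<alpha>) * e v \<le> \<bar>e v\<bar>"
    proof -
      have "(1 - \<alpha>) * e v \<le> \<bar>(1 - \<alpha>) * e v\<bar>" by simp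
      also have "\<dots> \<le> 1 * \<bar>e v\<bar>"
        unfolding abs_mult using a by (intro mult_right_mono) auto
      finally show ?thesis by simp
    qed
    have 3: "\<alpha> * (1 - \<alpha>) * (\<kappa> / 2) * (d v y)\<^sup>2 \<le> \<alpha> * 1 * (\<kappa> / 2) * (d v y)\<^sup>2"
      using a neg_part_bounds(1)[of lam] by (intro mult_right_mono mult_left_mono) auto
    have 4: "\<alpha> * (d v y)\<^sup>2 * (2 * b * \<alpha> + \<kappa> / 2) \<le> \<alpha> * (d v y)\<^sup>2 * c"
      using ab a by (intro mult_left_mono) auto
    have "- (C1 + \<bar>e v\<bar>) \<le> \<alpha> * (e y + c * (d v y)\<^sup>2)"
      using C1[OF z(1)] z(2) 1 2 3 4
      by (simp add: algebra_simps power2_eq_square add_divide_distrib diff_divide_distrib)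
    then have "- (C1 + \<bar>e v\<bar>) / \<alpha> \<le> e y + c * (d v y)\<^sup>2"
      using a by (simp add: divide_le_eq mult.commute)
    then show ?thesis unfolding minus_divide_left by linarith
  qed
  then show ?thesis by blast
qed

section \<open>Minimizers of the penalized energy\<close>

definition is_min :: "real \<Rightarrow> 'b \<Rightarrow> 'b \<Rightarrow> bool" where
  "is_min \<tau> x z \<longleftrightarrow> z \<in> D \<and> (\<forall>y\<in>D. (d x z)\<^sup>2 / (2 * \<tau>) + e z \<le> (d x y)\<^sup>2 / (2 * \<tau>) + e y)"

text \<open>With base \<open>x\<close> the convexity of the penalty and that of the energy add up in
  the same \<open>W\<close>. As \<open>1 / \<tau> + lam\<close> is nonnegative and
  \<open>W \<ge> d y z\<close>, the plan distance can then be replaced by the metric one.\<close>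

lemma penalized_convex:
  assumes "x \<in> X" "y \<in> D" "z \<in> D" "0 < \<tau>" "\<kappa> * \<tau> < 1" "0 \<le> \<alpha>" "\<alpha> \<le> 1"
  obtains v where "v \<in> D" "(d x v)\<^sup>2 / (2 * \<tau>) + e v \<le> (1 - \<alpha>) * ((d x y)\<^sup>2 / (2 * \<tau>) + e y)
     + \<alpha> * ((d x z)\<^sup>2 / (2 * \<tau>) + e z) - \<alpha> * (1 - \<alpha>) * ((1 / \<tau> + lam) / 2) * (d y z)\<^sup>2"
proof -
  obtain W where W: "W \<ge> d y z" and conv: "\<forall>\<alpha>\<in>{0..1}. \<exists>v\<in>D.
        e v \<le> (1 - \<alpha>) * e y + \<alpha> * e z - \<alpha> * (1 - \<alpha>) * (lam / 2) * W\<^sup>2 \<and>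
        (d x v)\<^sup>2 \<le> (1 - \<alpha>) * (d x y)\<^sup>2 + \<alpha> * (d x z)\<^sup>2 - \<alpha> * (1 - \<alpha>) * W\<^sup>2"
    using gen_convex[OF assms(1,2,3)] by blast
  have "\<alpha> \<in> {0..1}" using assms(6,7) by simp
  then obtain v where v: "v \<in> D"
    and ev: "e v \<le> (1 - \<alpha>) * e y + \<alpha> * e z - \<alpha> * (1 - \<alpha>) * (lam / 2) * W\<^sup>2"
    and dv: "(d x v)\<^sup>2 \<le> (1 - \<alpha>) * (d x y)\<^sup>2 + \<alpha> * (d x z)\<^sup>2 - \<alpha> * (1 - \<alpha>) * W\<^sup>2"
    using conv by blast
  have "(d x v)\<^sup>2 / (2 * \<tau>) \<le> ((1 - \<alpha>) * (d x y)\<^sup>2 + \<alpha> * (d x z)\<^sup>2 - \<alpha> * (1 - \<alpha>) * W\<^sup>2) / (2 * \<tau>)"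
    using dv assms(4) by (intro divide_right_mono) auto
  then have "(d x v)\<^sup>2 / (2 * \<tau>) + e v \<le> (1 - \<alpha>) * ((d x y)\<^sup>2 / (2 * \<tau>) + e y)
     + \<alpha> * ((d x z)\<^sup>2 / (2 * \<tau>) + e z) - \<alpha> * (1 - \<alpha>) * ((1 / \<tau> + lam) / 2) * W\<^sup>2"
    using ev by (simp add: algebra_simps add_divide_distrib diff_divide_distrib)
  moreover have "0 \<le> 1 / \<tau> + lam"
  proof -
    have "\<kappa> \<le> 1 / \<tau>" using assms(4,5) by (simp add: field_simps)
    then show ?thesis using neg_part_bounds(3)[of lam] by simp
  qed
  then have "\<alpha> * (1 - \<alpha>) * ((1 / \<tau> + lam) / 2) * (d y z)\<^sup>2 \<le> \<alpha> * (1 - \<alpha>) * ((1 / \<tau> + lam) / 2) * W\<^sup>2"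
    using W d_nonneg assms(6,7) by (intro mult_left_mono power_mono mult_nonneg_nonneg) auto
  ultimately show ?thesis using that[OF v] by linarith
qed

text \<open>Uniform convexity replaces compactness: the midpoint of two almost minimizers would
  undercut the infimum unless they are close, so a minimizing sequence is Cauchy. The condition
  \<open>2 * \<kappa> * \<tau> < 1\<close> allows the decay coefficient
  \<open>1 / (4 * \<tau>)\<close> around \<open>v\<close>; recentring at \<open>x\<close> doubles it
  to \<open>1 / (2 * \<tau>)\<close>, exactly what the penalty absorbs.\<close>

lemma exists_min:
  assumes x: "x \<in> X" and t: "0 < \<tau>" "2 * \<kappa> * \<tau> < 1"
  shows "\<exists>z. is_min \<tau> x z"
proof -
  define \<Phi> where "\<Phi> y = (d x y)\<^sup>2 / (2 * \<tau>) + e y" for y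
  obtain v where v: "v \<in> D" using D_nonempty by blast
  have kt: "\<kappa> / 2 < 1 / (4 * \<tau>)" using t by (simp add: field_simps)
  have kt1: "\<kappa> * \<tau> < 1"
    using t neg_part_bounds(1)[of lam] mult_nonneg_nonneg[of \<kappa> \<tau>] by linarith
  obtain C where C: "\<And>z. z \<in> D \<Longrightarrow> - C - 1 / (4 * \<tau>) * (d v z)\<^sup>2 \<le> e z"
    using quadratic_lower_bound[OF v kt] by blast
  have lb: "- C - (d v x)\<^sup>2 / (2 * \<tau>) \<le> \<Phi> z" if z: "z \<in> D" for z
  proof -
    have "1 / (4 * \<tau>) * (d v z)\<^sup>2 \<le> 1 / (4 * \<tau>) * (2 * (d v x)\<^sup>2 + 2 * (d x z)\<^sup>2)"
      using t d_sq_le[OF DX[OF v] x DX[OF z]] by (intro mult_left_mono) auto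
    also have "\<dots> = (d v x)\<^sup>2 / (2 * \<tau>) + (d x z)\<^sup>2 / (2 * \<tau>)"
      using t by (simp add: field_simps)
    finally show ?thesis using C[OF z] by (simp add: \<Phi>_def)
  qed
  define I where "I = Inf (\<Phi> ` D)"
  have bdd: "bdd_below (\<Phi> ` D)"
    using lb by (intro bdd_belowI2) auto
  have I_le: "I \<le> \<Phi> z" if "z \<in> D" for z
    unfolding I_def using bdd that by (intro cINF_lower) auto
  have "\<exists>z\<in>D. \<Phi> z < I + 1 / real (Suc n)" for n
    using cINF_less_iff[OF D_nonempty bdd, of "I + 1 / real (Suc n)"] unfolding I_def by simp
  then obtain s where sD: "\<And>n. s n \<in> D" and s: "\<And>n. \<Phi> (s n) < I + 1 / real (Suc n)"
    by metis
  \<comment> \<open>The modulus \<open>(1 / \<tau> + lam) / 2\<close> times the factor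
    \<open>\<alpha> * (1 - \<alpha>) = 1 / 4\<close> at the midpoint.\<close>
  define c where "c = (1 / \<tau> + lam) / 8"
  have c: "0 < c"
  proof -
    have "\<kappa> < 1 / \<tau>" using t kt1 by (simp add: field_simps)
    then show ?thesis using neg_part_bounds(3)[of lam] by (simp add: c_def)
  qed
  have cauchy: "c * (d (s m) (s n))\<^sup>2 \<le> 1 / real (Suc N)" if "m \<ge> N" "n \<ge> N" for m n N
  proof -
    obtain v where "v \<in> D" "\<Phi> v \<le> (1 - 1/2) * \<Phi> (s m) + 1/2 * \<Phi> (s n)
        - 1/2 * (1 - 1/2) * ((1 / \<tau> + lam) / 2) * (d (s m) (s n))\<^sup>2"
      using penalized_convex[OF x sD sD t(1) kt1, of "1/2" m n] unfolding \<Phi>_def by auto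
    moreover have "1/2 * (1 - 1/2) * ((1 / \<tau> + lam) / 2) = c"
      by (simp add: c_def)
    moreover have "1 / real (Suc m) \<le> 1 / real (Suc N)" "1 / real (Suc n) \<le> 1 / real (Suc N)"
      using that by (auto intro!: divide_left_mono)
    moreover have "I \<le> \<Phi> v" using I_le \<open>v \<in> D\<close> by blast
    ultimately show ?thesis
      using s[of m] s[of n] by (simp del: of_nat_Suc)
  qed
  have "\<exists>z\<in>X. (\<lambda>n. d (s n) z) \<longlonglongrightarrow> 0"
  proof (rule complete)
    show "s n \<in> X" for n using sD DX by blast
    fix \<epsilon> :: real assume e: "0 < \<epsilon>"
    then obtain N where N: "1 / real (Suc N) < c * \<epsilon>\<^sup>2"
      using reals_Archimedean[of "c * \<epsilon>\<^sup>2"] c by (auto simp: inverse_eq_divide)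
    have "d (s m) (s n) < \<epsilon>" if "m \<ge> N" "n \<ge> N" for m n
    proof -
      have "c * (d (s m) (s n))\<^sup>2 < c * \<epsilon>\<^sup>2" using cauchy[OF that] N by linarith
      then have "(d (s m) (s n))\<^sup>2 < \<epsilon>\<^sup>2" using c by simp
      then show ?thesis using e by (rule power2_less_imp_less[OF _ less_imp_le])
    qed
    then show "\<exists>N. \<forall>m\<ge>N. \<forall>n\<ge>N. d (s m) (s n) < \<epsilon>" by blast
  qed
  then obtain z where z: "z \<in> X" and lim: "(\<lambda>n. d (s n) z) \<longlonglongrightarrow> 0" by blast
  have "(\<lambda>n. d (s n) x) \<longlonglongrightarrow> d z x"
    using tendsto_d[OF _ z x lim] sD DX by blast
  then have "(\<lambda>n. d x (s n)) \<longlonglongrightarrow> d x z"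
    using d_sym[OF x] sD DX z by simp
  moreover have "(\<lambda>n. 1 / real (Suc n)) \<longlonglongrightarrow> 0"
    using LIMSEQ_inverse_real_of_nat by (simp add: inverse_eq_divide)
  ultimately have "(\<lambda>n. I + 1 / real (Suc n) - (d x (s n))\<^sup>2 / (2 * \<tau>)) \<longlonglongrightarrow> I + 0 - (d x z)\<^sup>2 / (2 * \<tau>)"
    using t by (intro tendsto_intros) auto
  moreover have "e (s n) \<le> I + 1 / real (Suc n) - (d x (s n))\<^sup>2 / (2 * \<tau>)" for n
    using s[of n] unfolding \<Phi>_def by linarith
  ultimately have "z \<in> D" "e z \<le> I + 0 - (d x z)\<^sup>2 / (2 * \<tau>)"
    using lsc_tendsto[OF sD _ _ z lim, of "\<lambda>n. I + 1 / real (Suc n) - (d x (s n))\<^sup>2 / (2 * \<tau>)"] by simp_all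
  moreover have "(d x z)\<^sup>2 / (2 * \<tau>) + e z \<le> (d x y)\<^sup>2 / (2 * \<tau>) + e y" if "y \<in> D" for y
    using I_le[OF that] calculation(2) unfolding \<Phi>_def by linarith
  ultimately show ?thesis
    unfolding is_min_def by blast
qed

text \<open>Minimality against the point at fraction \<alpha> from \<open>z\<close> to
  \<open>y\<close>, divided by \<alpha> as \<alpha> tends to 0, retains the full convexity defect
  \<open>c\<close>. After multiplication by \<open>2 * \<tau>\<close> its modulus becomes
  \<open>1 + lam * \<tau>\<close>.\<close>

lemma min_evi:
  assumes x: "x \<in> X" and t: "0 < \<tau>" "\<kappa> * \<tau> < 1" and z: "is_min \<tau> x z" and y: "y \<in> D"
  shows "(1 + lam * \<tau>) * (d z y)\<^sup>2 \<le> (d x y)\<^sup>2 + 2 * \<tau> * (e y - e z) - (d x z)\<^sup>2"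
proof -
  define \<Phi> where "\<Phi> y = (d x y)\<^sup>2 / (2 * \<tau>) + e y" for y
  have zD: "z \<in> D" and zmin: "\<And>v. v \<in> D \<Longrightarrow> \<Phi> z \<le> \<Phi> v"
    using z by (auto simp: is_min_def \<Phi>_def)
  define c where "c = (1 / \<tau> + lam) / 2 * (d z y)\<^sup>2"
  have "\<Phi> z \<le> \<Phi> y - c"
  proof (rule le_of_le_add_scaled)
    fix \<alpha> :: real assume a: "0 < \<alpha>" "\<alpha> < 1"
    obtain v where "v \<in> D" "\<Phi> v \<le> (1 - \<alpha>) * \<Phi> z + \<alpha> * \<Phi> y - \<alpha> * (1 - \<alpha>) * ((1 / \<tau> + lam) / 2) * (d z y)\<^sup>2"
      using penalized_convex[OF x zD y t, of \<alpha>] a unfolding \<Phi>_def by auto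
    then have "\<Phi> z \<le> (1 - \<alpha>) * \<Phi> z + \<alpha> * \<Phi> y - \<alpha> * (1 - \<alpha>) * c"
      using zmin[of v] by (simp add: c_def mult.assoc)
    then have "0 \<le> \<alpha> * (\<Phi> y - c + \<alpha> * c - \<Phi> z)"
      by (simp add: algebra_simps)
    then show "\<Phi> z \<le> \<Phi> y - c + \<alpha> * c"
      using a by (simp add: zero_le_mult_iff)
  qed
  then have "2 * \<tau> * \<Phi> z \<le> 2 * \<tau> * (\<Phi> y - c)"
    using t by (intro mult_left_mono) auto
  then show ?thesis
    using t by (simp add: \<Phi>_def c_def algebra_simps add_divide_distrib)
qed

text \<open>By convexity the local metric slope is equivalent to this global bound.\<close>

definition slope_le :: "real \<Rightarrow> 'b \<Rightarrow> bool" where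
  "slope_le S x \<longleftrightarrow> 0 \<le> S \<and> x \<in> D \<and> (\<forall>z\<in>D. e x - e z \<le> S * d x z + \<kappa> / 2 * (d x z)\<^sup>2)"

text \<open>A distant \<open>z\<close> is pulled along a geodesic into the ball where the local
  bound holds. Both the energy difference and the distance shrink by \<alpha>, up to the convexity
  defect that produces \<open>\<kappa> / 2 * (d x z)^2\<close>; division by \<alpha> gives the bound
  at \<open>z\<close>.\<close>

lemma slope_le_of_local:
  assumes S: "0 \<le> S" and x: "x \<in> D"
    and loc: "\<And>S'. S < S' \<Longrightarrow> \<exists>r>0. \<forall>z\<in>D. 0 < d x z \<longrightarrow> d x z < r \<longrightarrow> e x - e z \<le> S' * d x z"
  shows "slope_le S x"
  unfolding slope_le_def
proof (intro conjI ballI S x)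
  fix z assume z: "z \<in> D"
  show "e x - e z \<le> S * d x z + \<kappa> / 2 * (d x z)\<^sup>2"
  proof (cases "d x z = 0")
    case True
    then show ?thesis using e_le_of_d_zero[OF x z] by simp
  next
    case False
    then have pos: "0 < d x z" using d_nonneg[of x z] by linarith
    have "e x - e z - \<kappa> / 2 * (d x z)\<^sup>2 \<le> S' * d x z" if S': "S < S'" for S'
    proof -
      obtain r where r: "r > 0" "\<And>z. z \<in> D \<Longrightarrow> 0 < d x z \<Longrightarrow> d x z < r \<Longrightarrow> e x - e z \<le> S' * d x z"
        using loc[OF S'] by blast
      \<comment> \<open>The factor 2 makes \<open>\<alpha> * d x z\<close> strictly smaller than
        \<open>r\<close>.\<close>
      define \<alpha> where "\<alpha> = min 1 (r / (2 * d x z))"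
      have a: "0 < \<alpha>" "\<alpha> \<le> 1" "\<alpha> * d x z < r"
      proof -
        show "0 < \<alpha>" "\<alpha> \<le> 1" using r pos by (auto simp: \<alpha>_def)
        have "\<alpha> * d x z \<le> r / (2 * d x z) * d x z"
          using pos by (intro mult_right_mono) (auto simp: \<alpha>_def)
        then show "\<alpha> * d x z < r" using r pos by simp
      qed
      obtain v where v: "v \<in> D" "e v \<le> (1 - \<alpha>) * e x + \<alpha> * e z + \<alpha> * (1 - \<alpha>) * (\<kappa> / 2) * (d x z)\<^sup>2"
        "d x v \<le> \<alpha> * d x z"
        using geodesic_convex[OF x z, of \<alpha>] a by auto
      have "\<alpha> * (1 - \<alpha>) * (\<kappa> / 2) * (d x z)\<^sup>2 \<le> \<alpha> * 1 * (\<kappa> / 2) * (d x z)\<^sup>2"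
        using a neg_part_bounds(1)[of lam] by (intro mult_right_mono mult_left_mono) auto
      then have "e v \<le> (1 - \<alpha>) * e x + \<alpha> * e z + \<alpha> * 1 * (\<kappa> / 2) * (d x z)\<^sup>2"
        using v(2) by linarith
      then have ge: "\<alpha> * (e x - e z - \<kappa> / 2 * (d x z)\<^sup>2) \<le> e x - e v"
        by (simp add: algebra_simps)
      have "e x - e v \<le> S' * d x v"
      proof (cases "d x v = 0")
        case True
        then show ?thesis using e_le_of_d_zero[OF x v(1)] by simp
      next
        case False
        then show ?thesis using r(2)[OF v(1)] d_nonneg[of x v] v(3) a(3) by linarith
      qed
      also have "\<dots> \<le> S' * (\<alpha> * d x z)"
        using v(3) S S' by (intro mult_left_mono) auto
      finally have "\<alpha> * (e x - e z - \<kappa> / 2 * (d x z)\<^sup>2) \<le> \<alpha> * (S' * d x z)"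
        using ge by (simp add: mult_ac)
      then show ?thesis using a by simp
    qed
    then have "e x - e z - \<kappa> / 2 * (d x z)\<^sup>2 \<le> (S + \<alpha>) * d x z" if "0 < \<alpha>" for \<alpha>
      using that by simp
    then have "e x - e z - \<kappa> / 2 * (d x z)\<^sup>2 \<le> S * d x z + \<alpha> * d x z" if "0 < \<alpha>" for \<alpha>
      using that by (simp only: distrib_right)
    then have "e x - e z - \<kappa> / 2 * (d x z)\<^sup>2 \<le> S * d x z"
      by (rule le_of_le_add_scaled)
    then show ?thesis by simp
  qed
qed

end

section \<open>Minimizing movements\<close>

text \<open>\<open>J\<close> is an arbitrary selection of minimizers and is left unspecified for
  positive steps outside the range where minimizers were shown to exist. \<open>J 0\<close> covers
  the case \<open>t = 0\<close> of \<open>t / n\<close>.\<close>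

locale minimizing_movement = gen_convex_functional X d D e lam
  for X :: "'b set" and d :: "'b \<Rightarrow> 'b \<Rightarrow> real" and D :: "'b set" and e :: "'b \<Rightarrow> real" and lam :: real +
  fixes J :: "real \<Rightarrow> 'b \<Rightarrow> 'b"
  assumes J_min: "0 < \<tau> \<Longrightarrow> 2 * \<kappa> * \<tau> < 1 \<Longrightarrow> x \<in> X \<Longrightarrow> is_min \<tau> x (J \<tau> x)"
    and J_zero: "J 0 x = x"
begin

section \<open>One-step estimates and propagation of the slope\<close>

definition step_ok :: "real \<Rightarrow> bool" where
  "step_ok \<tau> \<longleftrightarrow> 0 < \<tau> \<and> 2 * \<kappa> * \<tau> < 1"

abbreviation it :: "real \<Rightarrow> nat \<Rightarrow> 'b \<Rightarrow> 'b" where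
  "it \<tau> i x \<equiv> (J \<tau> ^^ i) x"

lemma \<kappa>_nonneg: "0 \<le> \<kappa>"
  by (rule neg_part_bounds)

lemma step_okD:
  assumes "step_ok \<tau>"
  shows "0 < \<tau>" "0 \<le> \<kappa> * \<tau>" "\<kappa> * \<tau> < 1 / 2" "0 < 1 - \<kappa> * \<tau>" "1 - \<kappa> * \<tau> \<le> 1"
  using assms mult_nonneg_nonneg[OF \<kappa>_nonneg, of \<tau>] by (auto simp: step_ok_def)

lemma J_D: "step_ok \<tau> \<Longrightarrow> x \<in> X \<Longrightarrow> J \<tau> x \<in> D"
  using J_min[of \<tau> x] by (auto simp: step_ok_def is_min_def)

lemma J_X: "step_ok \<tau> \<Longrightarrow> x \<in> X \<Longrightarrow> J \<tau> x \<in> X"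
  using J_D DX by blast

lemma it_X: "step_ok \<tau> \<Longrightarrow> x \<in> X \<Longrightarrow> it \<tau> i x \<in> X"
  by (induction i) (auto intro: J_X)

lemma it_D: "step_ok \<tau> \<Longrightarrow> x \<in> X \<Longrightarrow> it \<tau> (Suc i) x \<in> D"
  by (simp add: J_D it_X)

lemma it_D': "step_ok \<tau> \<Longrightarrow> x \<in> D \<Longrightarrow> it \<tau> i x \<in> D"
  by (induction i) (auto intro: J_D DX)

lemma J_evi:
  assumes "step_ok \<tau>" "x \<in> X" "y \<in> D"
  shows "(1 + lam * \<tau>) * (d (J \<tau> x) y)\<^sup>2 \<le> (d x y)\<^sup>2 + 2 * \<tau> * (e y - e (J \<tau> x)) - (d x (J \<tau> x))\<^sup>2"
  using min_evi[of x \<tau> "J \<tau> x" y] J_min[of \<tau> x] assms step_okD[OF assms(1)]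
  by (auto simp: step_ok_def)

lemma J_evi_neg:
  assumes "step_ok \<tau>" "x \<in> X" "y \<in> D"
  shows "(1 - \<kappa> * \<tau>) * (d (J \<tau> x) y)\<^sup>2 \<le> (d x y)\<^sup>2 + 2 * \<tau> * (e y - e (J \<tau> x)) - (d x (J \<tau> x))\<^sup>2"
proof -
  have "(1 - \<kappa> * \<tau>) * (d (J \<tau> x) y)\<^sup>2 \<le> (1 + lam * \<tau>) * (d (J \<tau> x) y)\<^sup>2"
    using mult_right_mono[OF neg_part_bounds(3)[of lam], of \<tau>] step_okD(1)[OF assms(1)]
    by (intro mult_right_mono) auto
  then show ?thesis using J_evi[OF assms] by linarith
qed

lemma e_J_le:
  assumes "step_ok \<tau>" "x \<in> D"
  shows "(d x (J \<tau> x))\<^sup>2 \<le> 2 * \<tau> * (e x - e (J \<tau> x))" "e (J \<tau> x) \<le> e x"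
proof -
  have "0 \<le> (1 - \<kappa> * \<tau>) * (d (J \<tau> x) x)\<^sup>2"
    using step_okD[OF assms(1)] by simp
  then show 1: "(d x (J \<tau> x))\<^sup>2 \<le> 2 * \<tau> * (e x - e (J \<tau> x))"
    using J_evi_neg[OF assms(1) DX[OF assms(2)] assms(2)] d_refl[OF DX[OF assms(2)]] by simp
  then have "0 \<le> 2 * \<tau> * (e x - e (J \<tau> x))"
    using zero_le_power2[of "d x (J \<tau> x)"] by linarith
  then show "e (J \<tau> x) \<le> e x"
    using step_okD(1)[OF assms(1)] by (simp add: zero_le_mult_iff)
qed

lemma e_it_antimono:
  assumes "step_ok \<tau>" "it \<tau> i x \<in> D" "i \<le> j"
  shows "it \<tau> j x \<in> D \<and> e (it \<tau> j x) \<le> e (it \<tau> i x)"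
  using assms(3)
proof (induction rule: dec_induct)
  case (step n)
  then show ?case
    using e_J_le(2)[OF assms(1), of "it \<tau> n x"] J_D[OF assms(1) DX, of "it \<tau> n x"] by simp
qed (use assms in simp)

lemma slope_le_mono: "slope_le S x \<Longrightarrow> S \<le> S' \<Longrightarrow> slope_le S' x"
  using mult_right_mono[of S S' "d x _"] d_nonneg unfolding slope_le_def by (smt (verit, best))

text \<open>In the discrete inequality tested with \<open>z\<close>, the triangle inequality bounds
  \<open>(d x z)^2\<close> by \<open>(a + b)^2\<close>; the square of
  \<open>a = d x (J \<tau> x)\<close> cancels and the cross term is the slope bound. One step
  therefore sends every point of \<open>X\<close> to a point of finite slope.\<close>

lemma slope_le_J:
  assumes "step_ok \<tau>" "x \<in> X"
  shows "slope_le (d x (J \<tau> x) / \<tau>) (J \<tau> x)"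
  unfolding slope_le_def
proof (intro conjI ballI)
  note t = step_okD[OF assms(1)]
  show "0 \<le> d x (J \<tau> x) / \<tau>" using d_nonneg t by simp
  show JD: "J \<tau> x \<in> D" by (rule J_D[OF assms])
  fix z assume z: "z \<in> D"
  define a b where "a = d x (J \<tau> x)" and "b = d (J \<tau> x) z"
  have "(d x z)\<^sup>2 \<le> (a + b)\<^sup>2"
    unfolding a_def b_def using d_tri[OF assms(2) DX[OF JD] DX[OF z]] d_nonneg by (intro power_mono) auto
  then have "2 * \<tau> * (e (J \<tau> x) - e z) \<le> 2 * a * b + \<kappa> * \<tau> * b\<^sup>2"
    using J_evi_neg[OF assms z] unfolding a_def[symmetric] b_def[symmetric]
    by (simp add: algebra_simps power2_eq_square)
  also have "\<dots> = 2 * \<tau> * (a / \<tau> * b + \<kappa> / 2 * b\<^sup>2)"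
    using t by (simp add: field_simps)
  finally show "e (J \<tau> x) - e z \<le> d x (J \<tau> x) / \<tau> * d (J \<tau> x) z + \<kappa> / 2 * (d (J \<tau> x) z)\<^sup>2"
    using t by (simp add: a_def b_def)
qed

text \<open>The discrete inequality is tested with \<open>x\<close> itself. Its term
  \<open>- (d x (J \<tau> x))^2\<close> and the quadratic part of the slope bound combine to
  \<open>2 * (1 - \<kappa> * \<tau>)\<close> times the squared step, against
  \<open>2 * \<tau> * S\<close> times the step. \<open>slope_le_J\<close> then turns the step length
  into a slope.\<close>

lemma slope_le_step:
  assumes "step_ok \<tau>" "slope_le S x"
  shows "d x (J \<tau> x) \<le> \<tau> * S / (1 - \<kappa> * \<tau>)" "slope_le (S / (1 - \<kappa> * \<tau>)) (J \<tau> x)"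
proof -
  note t = step_okD[OF assms(1)]
  have x: "x \<in> D" "x \<in> X" and S: "0 \<le> S" using assms(2) DX by (auto simp: slope_le_def)
  have JD: "J \<tau> x \<in> D" by (rule J_D[OF assms(1) x(2)])
  define a where "a = d x (J \<tau> x)"
  have "e x - e (J \<tau> x) \<le> S * a + \<kappa> / 2 * a\<^sup>2"
    using assms(2) JD by (auto simp: slope_le_def a_def)
  then have "2 * \<tau> * (e x - e (J \<tau> x)) \<le> 2 * \<tau> * (S * a + \<kappa> / 2 * a\<^sup>2)"
    using t by (intro mult_left_mono) auto
  moreover have "(1 - \<kappa> * \<tau>) * a\<^sup>2 \<le> 2 * \<tau> * (e x - e (J \<tau> x)) - a\<^sup>2"
    using J_evi_neg[OF assms(1) x(2,1)] d_refl[OF x(2)] d_sym[OF x(2) DX[OF JD]] by (simp add: a_def)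
  ultimately have "2 * (a * ((1 - \<kappa> * \<tau>) * a)) \<le> 2 * (a * (\<tau> * S))"
    by (simp add: algebra_simps power2_eq_square)
  then have *: "a * ((1 - \<kappa> * \<tau>) * a) \<le> a * (\<tau> * S)" by simp
  have "(1 - \<kappa> * \<tau>) * a \<le> \<tau> * S"
  proof (cases "a = 0")
    case True
    then show ?thesis using t S by simp
  next
    case False
    then have "0 < a" using d_nonneg[of x "J \<tau> x"] by (simp add: a_def)
    then show ?thesis using * by simp
  qed
  then show le: "d x (J \<tau> x) \<le> \<tau> * S / (1 - \<kappa> * \<tau>)"
    using t by (simp add: a_def field_simps)
  have "d x (J \<tau> x) / \<tau> \<le> S / (1 - \<kappa> * \<tau>)"
    using le t by (simp add: field_simps)
  then show "slope_le (S / (1 - \<kappa> * \<tau>)) (J \<tau> x)"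
    using slope_le_mono[OF slope_le_J[OF assms(1) x(2)]] by blast
qed

lemma slope_le_it:
  assumes "step_ok \<tau>" "slope_le S x"
  shows "slope_le (S / (1 - \<kappa> * \<tau>) ^ i) (it \<tau> i x)"
proof (induction i)
  case (Suc i)
  then show ?case using slope_le_step(2)[OF assms(1) Suc] by (simp add: mult.commute)
qed (use assms in simp)

lemma dist_it:
  assumes "step_ok \<tau>" "slope_le S x"
  shows "d x (it \<tau> i x) \<le> real i * \<tau> * S / (1 - \<kappa> * \<tau>) ^ i"
proof (induction i)
  case 0
  then show ?case using assms d_refl DX by (auto simp: slope_le_def)
next
  case (Suc i)
  note t = step_okD[OF assms(1)]
  have x: "x \<in> X" and S: "0 \<le> S" using assms(2) DX by (auto simp: slope_le_def)
  let ?q = "1 - \<kappa> * \<tau>"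
  have q: "1 / ?q ^ i \<le> 1 / ?q ^ Suc i"
    using t by (intro divide_left_mono power_decreasing) auto
  have "d (it \<tau> i x) (it \<tau> (Suc i) x) \<le> \<tau> * S / ?q ^ Suc i"
    using slope_le_step(1)[OF assms(1) slope_le_it[OF assms, of i]] by (simp add: mult.commute)
  moreover have "real i * \<tau> * S * (1 / ?q ^ i) \<le> real i * \<tau> * S * (1 / ?q ^ Suc i)"
    using q t S by (intro mult_left_mono) auto
  moreover have "d x (it \<tau> (Suc i) x) \<le> d x (it \<tau> i x) + d (it \<tau> i x) (it \<tau> (Suc i) x)"
    by (intro d_tri it_X assms x)
  moreover have "real (Suc i) * \<tau> * S / ?q ^ Suc i = real i * \<tau> * S * (1 / ?q ^ Suc i) + \<tau> * S / ?q ^ Suc i"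
    by (simp add: algebra_simps add_divide_distrib)
  moreover have "real i * \<tau> * S / ?q ^ i = real i * \<tau> * S * (1 / ?q ^ i)" by simp
  ultimately show ?case using Suc by linarith
qed

lemma inverse_power_le_exp:
  assumes "step_ok \<tau>" "real i * \<tau> \<le> T"
  shows "1 / (1 - \<kappa> * \<tau>) ^ i \<le> exp (2 * \<kappa> * T)"
proof -
  have "1 / (1 - \<kappa> * \<tau>) ^ i \<le> exp (2 * (real i * (\<kappa> * \<tau>)))"
    using step_okD[OF assms(1)] by (intro inverse_one_minus_power_le_exp) auto
  also have "\<dots> \<le> exp (2 * \<kappa> * T)"
    using mult_left_mono[OF assms(2) \<kappa>_nonneg] by (simp add: mult_ac)
  finally show ?thesis .
qed

lemma dist_it_exp:
  assumes "step_ok \<tau>" "slope_le S x" "real i * \<tau> \<le> T"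
  shows "d x (it \<tau> i x) \<le> real i * \<tau> * S * exp (2 * \<kappa> * T)"
proof -
  have "0 \<le> S" using assms(2) by (simp add: slope_le_def)
  then have "real i * \<tau> * S * (1 / (1 - \<kappa> * \<tau>) ^ i) \<le> real i * \<tau> * S * exp (2 * \<kappa> * T)"
    using step_okD[OF assms(1)] by (intro mult_left_mono inverse_power_le_exp assms) auto
  then show ?thesis using dist_it[OF assms(1,2), of i] by simp
qed

text \<open>Testing the inequality for each iterate with the other one, weighted by the opposite step
  size, makes the energies cancel.\<close>

lemma sq_dist_recursion:
  assumes "step_ok \<tau>" "step_ok h" "x \<in> X" "y \<in> X"
  shows "(h + \<tau> - 2 * \<kappa> * h * \<tau>) * (d (J \<tau> x) (J h y))\<^sup>2 \<le> h * (d x (J h y))\<^sup>2 + \<tau> * (d (J \<tau> x) y)\<^sup>2"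
proof -
  note t = step_okD[OF assms(1)] and h = step_okD[OF assms(2)]
  have JD: "J \<tau> x \<in> D" "J h y \<in> D" using assms by (auto intro: J_D)
  have "(1 - \<kappa> * \<tau>) * (d (J \<tau> x) (J h y))\<^sup>2 \<le> (d x (J h y))\<^sup>2 + 2 * \<tau> * (e (J h y) - e (J \<tau> x))"
    using J_evi_neg[OF assms(1,3) JD(2)] zero_le_power2[of "d x (J \<tau> x)"] by linarith
  then have 1: "h * ((1 - \<kappa> * \<tau>) * (d (J \<tau> x) (J h y))\<^sup>2) \<le> h * ((d x (J h y))\<^sup>2 + 2 * \<tau> * (e (J h y) - e (J \<tau> x)))"
    using h by (intro mult_left_mono) auto
  have "(1 - \<kappa> * h) * (d (J \<tau> x) (J h y))\<^sup>2 \<le> (d (J \<tau> x) y)\<^sup>2 + 2 * h * (e (J \<tau> x) - e (J h y))"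
    using J_evi_neg[OF assms(2,4) JD(1)] zero_le_power2[of "d y (J h y)"]
    unfolding d_sym[OF DX[OF JD(1)] DX[OF JD(2)]] d_sym[OF DX[OF JD(1)] assms(4)] by linarith
  then have 2: "\<tau> * ((1 - \<kappa> * h) * (d (J \<tau> x) (J h y))\<^sup>2) \<le> \<tau> * ((d (J \<tau> x) y)\<^sup>2 + 2 * h * (e (J \<tau> x) - e (J h y)))"
    using t by (intro mult_left_mono) auto
  show ?thesis using 1 2 by (simp add: algebra_simps)
qed

text \<open>The right-hand side solves the recursion exactly: for the walk that lowers \<open>i\<close> with probability
  \<open>h / (h + \<tau>)\<close> and \<open>j\<close> with probability \<open>\<tau> / (h + \<tau>)\<close>, the quantity \<open>i \<tau> - j h\<close> is a martingale
  with one-step variance \<open>\<tau> h\<close>.\<close>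

lemma sq_dist_iterates:
  assumes "step_ok \<tau>" "step_ok h" "slope_le S x" "real i * \<tau> \<le> T" "real j * h \<le> T"
  defines "p \<equiv> 1 - 2 * \<kappa> * h * \<tau> / (h + \<tau>)"
  shows "0 < p \<and> (d (it \<tau> i x) (it h j x))\<^sup>2 \<le>
    S\<^sup>2 * exp (4 * \<kappa> * T) / p ^ (i + j) * ((real i * \<tau> - real j * h)\<^sup>2 + \<tau> * h * real (i + j))"
proof -
  note t = step_okD[OF assms(1)] and h = step_okD[OF assms(2)]
  have x: "x \<in> X" and S: "0 \<le> S" using assms(3) DX by (auto simp: slope_le_def)
  have hp: "(h + \<tau>) * p = h + \<tau> - 2 * \<kappa> * h * \<tau>"
    using t h by (simp add: p_def field_simps)
  have "2 * \<kappa> * \<tau> * h < 1 * h"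
    using assms(1) h by (intro mult_strict_right_mono) (auto simp: step_ok_def)
  then have "0 < (h + \<tau>) * p"
    unfolding hp using t by (simp add: mult_ac)
  then have p: "0 < p" using t h by (simp add: zero_less_mult_iff)
  have p1: "p \<le> 1" using t h \<kappa>_nonneg by (simp add: p_def)
  define A where "A = S\<^sup>2 * exp (4 * \<kappa> * T)"
  have A: "0 \<le> A" by (simp add: A_def)
  define B where "B i j = (real i * \<tau> - real j * h)\<^sup>2 + \<tau> * h * real (i + j)" for i j
  have B0: "0 \<le> B i j" for i j using t h by (simp add: B_def)
  have Brec: "h * B i (Suc j) + \<tau> * B (Suc i) j = (h + \<tau>) * B (Suc i) (Suc j)" for i j
    by (simp add: B_def algebra_simps power2_eq_square)
  \<comment> \<open>The boundary values \<open>i = 0\<close> or \<open>j = 0\<close>, the only place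
    where the slope of \<open>x\<close> enters. The factor \<open>exp (4 * \<kappa> * T)\<close> is
    the square of the one in \<open>dist_it_exp\<close>.\<close>
  have base: "(d x (it \<sigma> k x))\<^sup>2 \<le> A / p ^ k * b"
    if \<sigma>: "step_ok \<sigma>" "real k * \<sigma> \<le> T" and b: "(real k * \<sigma>)\<^sup>2 \<le> b" for \<sigma> k b
  proof -
    have "(d x (it \<sigma> k x))\<^sup>2 \<le> (real k * \<sigma> * S * exp (2 * \<kappa> * T))\<^sup>2"
      using dist_it_exp[OF \<sigma>(1) assms(3) \<sigma>(2)] d_nonneg by (intro power_mono) auto
    also have "\<dots> = A * (real k * \<sigma>)\<^sup>2"
      by (simp add: A_def power_mult_distrib exp_double[symmetric] mult_ac)
    also have "\<dots> \<le> A * b"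
      using A b by (intro mult_left_mono) auto
    also have "A * b \<le> A / p ^ k * b"
    proof (rule mult_right_mono)
      have "A / 1 \<le> A / p ^ k"
        using A p p1 by (intro divide_left_mono) (auto intro: power_le_one)
      then show "A \<le> A / p ^ k" by simp
      show "0 \<le> b" using b zero_le_power2[of "real k * \<sigma>"] by linarith
    qed
    finally show ?thesis .
  qed
  have "(d (it \<tau> i x) (it h j x))\<^sup>2 \<le> A / p ^ (i + j) * B i j"
    using assms(4,5)
  proof (induction i arbitrary: j)
    case 0
    have "(d x (it h j x))\<^sup>2 \<le> A / p ^ j * B 0 j"
      using 0 t h assms(2) by (intro base) (auto simp: B_def)
    then show ?case by simp
  next
    case (Suc i)
    have it: "real i * \<tau> \<le> T"
      using Suc.prems(1) t by (simp add: algebra_simps)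
    show ?case using Suc.prems(2)
    proof (induction j)
      case 0
      have "(d x (it \<tau> (Suc i) x))\<^sup>2 \<le> A / p ^ Suc i * B (Suc i) 0"
        using Suc.prems(1) t h assms(1) by (intro base) (auto simp: B_def)
      then show ?case
        using d_sym[OF x it_X[OF assms(1) x, of "Suc i"]] by simp
    next
      case (Suc j)
      have jh: "real j * h \<le> T" using Suc.prems h by (simp add: algebra_simps)
      have a1: "(d (it \<tau> i x) (it h (Suc j) x))\<^sup>2 \<le> A / p ^ (i + j + 1) * B i (Suc j)"
        using Suc.prems Suc.prems(1) \<open>\<And>j. real i * \<tau> \<le> T \<Longrightarrow> real j * h \<le> T \<Longrightarrow>
          (d (it \<tau> i x) (it h j x))\<^sup>2 \<le> A / p ^ (i + j) * B i j\<close>[OF it, of "Suc j"] by simp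
      have a2: "(d (it \<tau> (Suc i) x) (it h j x))\<^sup>2 \<le> A / p ^ (i + j + 1) * B (Suc i) j"
        using Suc.IH[OF jh] by simp
      \<comment> \<open>Both predecessors have the same index sum \<open>i + j + 1\<close>, so the
        factor \<open>p\<close> of the recursion is absorbed by one more power of \<open>p\<close>
        in the denominator.\<close>
      have "(h + \<tau>) * p * (d (it \<tau> (Suc i) x) (it h (Suc j) x))\<^sup>2
          \<le> h * (d (it \<tau> i x) (it h (Suc j) x))\<^sup>2 + \<tau> * (d (it \<tau> (Suc i) x) (it h j x))\<^sup>2"
        unfolding hp using sq_dist_recursion[OF assms(1,2) it_X[OF assms(1) x] it_X[OF assms(2) x], of i j] by simp
      also have "\<dots> \<le> h * (A / p ^ (i + j + 1) * B i (Suc j)) + \<tau> * (A / p ^ (i + j + 1) * B (Suc i) j)"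
        using a1 a2 t h by (intro add_mono mult_left_mono) auto
      also have "\<dots> = A / p ^ (i + j + 1) * (h * B i (Suc j) + \<tau> * B (Suc i) j)"
        by (simp only: distrib_left mult_ac)
      also have "\<dots> = (h + \<tau>) * p * (A / p ^ (Suc i + Suc j) * B (Suc i) (Suc j))"
        unfolding Brec using p by (simp add: field_simps)
      finally show ?case
        using t h p by (simp only: mult_le_cancel_left_pos[OF mult_pos_pos[OF add_pos_pos[OF h(1) t(1)] p]])
    qed
  qed
  then show ?thesis using p by (simp add: A_def B_def)
qed


section \<open>Small steps: uniform exponentials and stability in the initial point\<close>

lemma small_step_ok: "0 < \<tau> \<Longrightarrow> 6 * \<kappa> * \<tau> \<le> 1 \<Longrightarrow> step_ok \<tau>"
  by (simp add: step_ok_def)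

text \<open>The number 6 comes from \<open>3 * \<kappa> * \<tau> \<le> 1 / 2\<close>, which makes
  the factor \<open>1 - 3 * \<kappa> * \<tau>\<close> of the almost-contraction eligible for the
  exponential bound. The summand 1 in the denominator covers \<open>\<kappa> = 0\<close>.\<close>

lemma small_step:
  assumes "0 < \<tau>" "\<tau> \<le> 1 / (6 * \<kappa> + 1)"
  shows "6 * \<kappa> * \<tau> \<le> 1" "step_ok \<tau>"
proof -
  have "6 * \<kappa> * \<tau> \<le> 6 * \<kappa> * (1 / (6 * \<kappa> + 1))"
    using assms \<kappa>_nonneg by (intro mult_left_mono) auto
  also have "\<dots> \<le> 1"
    using \<kappa>_nonneg by (simp add: divide_simps)
  finally show "6 * \<kappa> * \<tau> \<le> 1" .
  then show "step_ok \<tau>" using small_step_ok assms by blast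
qed

lemma small_bound_pos: "0 < 1 / (6 * \<kappa> + 1)"
  using \<kappa>_nonneg by (simp add: add_nonneg_pos)

text \<open>The exponent contains \<open>(i * \<tau> * h + j * h * \<tau>) / (h + \<tau>)\<close>, a
  weighted mean of the two elapsed times, hence at most \<open>T\<close>.\<close>

lemma inverse_power_pair_le_exp:
  assumes "0 < \<tau>" "6 * \<kappa> * \<tau> \<le> 1" "0 < h" "real i * \<tau> \<le> T" "real j * h \<le> T"
  shows "1 / (1 - 2 * \<kappa> * h * \<tau> / (h + \<tau>)) ^ (i + j) \<le> exp (4 * \<kappa> * T)"
proof -
  define y where "y = 2 * \<kappa> * h * \<tau> / (h + \<tau>)"
  have y0: "0 \<le> y" using assms \<kappa>_nonneg by (simp add: y_def)
  have "y \<le> 1 / 2"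
  proof -
    have "2 * \<kappa> * \<tau> * h \<le> (1 / 2) * h"
      using assms by (intro mult_right_mono) auto
    also have "\<dots> \<le> 1 / 2 * (h + \<tau>)" using assms by simp
    finally show ?thesis using assms by (simp add: y_def divide_le_eq mult_ac)
  qed
  then have "1 / (1 - y) ^ (i + j) \<le> exp (2 * (real (i + j) * y))"
    using y0 by (intro inverse_one_minus_power_le_exp)
  also have "\<dots> \<le> exp (4 * \<kappa> * T)"
  proof -
    have "real i * \<tau> * h + real j * h * \<tau> \<le> T * h + T * \<tau>"
      using assms by (intro add_mono mult_right_mono) auto
    then have "2 * \<kappa> * (real i * \<tau> * h + real j * h * \<tau>) \<le> 2 * \<kappa> * (T * h + T * \<tau>)"
      using \<kappa>_nonneg by (intro mult_left_mono) auto
    then have "real (i + j) * y \<le> 2 * \<kappa> * T"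
      using assms by (simp add: y_def divide_le_eq algebra_simps)
    then show ?thesis unfolding exp_le_cancel_iff by linarith
  qed
  finally show ?thesis by (simp add: y_def)
qed

text \<open>The exponent is coarser than in \<open>sq_dist_iterates\<close>, but \<open_bound>
  depends on \<open>i\<close> and \<open>j\<close> only through the elapsed times and vanishes with
  the step sizes and the time difference.\<close>

lemma sq_dist_iterates_crude:
  assumes "0 < \<tau>" "6 * \<kappa> * \<tau> \<le> 1" "0 < h" "6 * \<kappa> * h \<le> 1" "slope_le S x"
    "real i * \<tau> \<le> T" "real j * h \<le> T"
  shows "(d (it \<tau> i x) (it h j x))\<^sup>2 \<le> S\<^sup>2 * exp (8 * \<kappa> * T) * ((real i * \<tau> - real j * h)\<^sup>2 + T * (\<tau> + h))"
proof -
  define p where "p = 1 - 2 * \<kappa> * h * \<tau> / (h + \<tau>)"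
  have "step_ok \<tau>" "step_ok h" using assms small_step_ok by auto
  then have p: "0 < p" and le: "(d (it \<tau> i x) (it h j x))\<^sup>2 \<le>
    S\<^sup>2 * exp (4 * \<kappa> * T) / p ^ (i + j) * ((real i * \<tau> - real j * h)\<^sup>2 + \<tau> * h * real (i + j))"
    using sq_dist_iterates[OF _ _ assms(5-7)] by (auto simp: p_def)
  note le
  also have "\<dots> = S\<^sup>2 * exp (4 * \<kappa> * T) * (1 / p ^ (i + j)) * ((real i * \<tau> - real j * h)\<^sup>2 + \<tau> * h * real (i + j))"
    by simp
  also have "\<dots> \<le> S\<^sup>2 * exp (4 * \<kappa> * T) * exp (4 * \<kappa> * T) * ((real i * \<tau> - real j * h)\<^sup>2 + T * (\<tau> + h))"
  proof (rule mult_mono)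
    have "1 / p ^ (i + j) \<le> exp (4 * \<kappa> * T)"
      unfolding p_def by (rule inverse_power_pair_le_exp[OF assms(1-3,6,7)])
    then show "S\<^sup>2 * exp (4 * \<kappa> * T) * (1 / p ^ (i + j)) \<le> S\<^sup>2 * exp (4 * \<kappa> * T) * exp (4 * \<kappa> * T)"
      by (rule mult_left_mono) simp
    have "real i * \<tau> * h + real j * h * \<tau> \<le> T * h + T * \<tau>"
      using assms by (intro add_mono mult_right_mono) auto
    then show "(real i * \<tau> - real j * h)\<^sup>2 + \<tau> * h * real (i + j) \<le> (real i * \<tau> - real j * h)\<^sup>2 + T * (\<tau> + h)"
      by (intro add_left_mono) (simp add: algebra_simps)
    show "0 \<le> (real i * \<tau> - real j * h)\<^sup>2 + \<tau> * h * real (i + j)"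
      using assms by simp
  qed auto
  also have "\<dots> = S\<^sup>2 * exp (8 * \<kappa> * T) * ((real i * \<tau> - real j * h)\<^sup>2 + T * (\<tau> + h))"
    by (simp add: mult_exp_exp)
  finally show ?thesis .
qed

text \<open>The inequality for \<open>x\<close> is tested with \<open>J \<tau> y\<close>, the one
  for \<open>y\<close> with \<open>x\<close>; on adding them the energy of \<open>J \<tau> y\<close>
  cancels. What remains is the energy drop of \<open>x\<close>, a defect that telescopes along
  iterates. Splitting \<open>\<kappa> * \<tau> * (d x (J \<tau> y))^2\<close> costs another
  \<open>2 * \<kappa> * \<tau>\<close>, hence the 3.\<close>

lemma J_almost_contraction:
  assumes "0 < \<tau>" "6 * \<kappa> * \<tau> \<le> 1" "x \<in> D" "y \<in> X"
  shows "(1 - 3 * \<kappa> * \<tau>) * (d (J \<tau> x) (J \<tau> y))\<^sup>2 \<le> (d x y)\<^sup>2 + 2 * \<tau> * (e x - e (J \<tau> x))"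
proof -
  have ok: "step_ok \<tau>" using assms small_step_ok by blast
  have xX: "x \<in> X" using assms DX by blast
  have JD: "J \<tau> x \<in> D" "J \<tau> y \<in> D" "J \<tau> x \<in> X" "J \<tau> y \<in> X"
    using J_D[OF ok] DX xX assms by auto
  have 1: "(1 - \<kappa> * \<tau>) * (d (J \<tau> x) (J \<tau> y))\<^sup>2 \<le> (d x (J \<tau> y))\<^sup>2 + 2 * \<tau> * (e (J \<tau> y) - e (J \<tau> x)) - (d x (J \<tau> x))\<^sup>2"
    by (rule J_evi_neg[OF ok xX JD(2)])
  have 2: "(1 - \<kappa> * \<tau>) * (d x (J \<tau> y))\<^sup>2 \<le> (d x y)\<^sup>2 + 2 * \<tau> * (e x - e (J \<tau> y)) - (d y (J \<tau> y))\<^sup>2"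
    using J_evi_neg[OF ok assms(4,3)] unfolding d_sym[OF JD(4) xX] d_sym[OF assms(4) xX] .
  have 3: "\<kappa> * \<tau> * (d x (J \<tau> y))\<^sup>2 \<le> \<kappa> * \<tau> * (2 * (d x (J \<tau> x))\<^sup>2 + 2 * (d (J \<tau> x) (J \<tau> y))\<^sup>2)"
    using \<kappa>_nonneg assms by (intro mult_left_mono d_sq_le xX JD) auto
  have 4: "2 * \<kappa> * \<tau> * (d x (J \<tau> x))\<^sup>2 \<le> 1 * (d x (J \<tau> x))\<^sup>2"
    using assms by (intro mult_right_mono) auto
  have "(1 - \<kappa> * \<tau>) * (d x (J \<tau> y))\<^sup>2 \<le> (d x y)\<^sup>2 + 2 * \<tau> * (e x - e (J \<tau> y))"
    using 2 zero_le_power2[of "d y (J \<tau> y)"] by linarith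
  then show ?thesis
    using 1 3 4 by (simp add: algebra_simps)
qed

text \<open>The defects of the single steps are nonnegative, so the growing weights
  \<open>1 / r ^ n\<close> may be applied to all of them, and they telescope to the total energy
  drop of the orbit of \<open>x\<close>.\<close>

lemma it_almost_contraction:
  assumes "0 < \<tau>" "6 * \<kappa> * \<tau> \<le> 1" "x \<in> D" "y \<in> X"
  shows "(d (it \<tau> n x) (it \<tau> n y))\<^sup>2 \<le> 1 / (1 - 3 * \<kappa> * \<tau>) ^ n * ((d x y)\<^sup>2 + 2 * \<tau> * (e x - e (it \<tau> n x)))"
proof (induction n)
  case (Suc n)
  have ok: "step_ok \<tau>" using assms small_step_ok by blast
  define r where "r = 1 - 3 * \<kappa> * \<tau>"
  have r: "0 < r" "r \<le> 1" using assms \<kappa>_nonneg by (auto simp: r_def)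
  define a where "a = 2 * \<tau> * (e (it \<tau> n x) - e (it \<tau> (Suc n) x))"
  have a: "0 \<le> a"
    using e_J_le(2)[OF ok it_D'[OF ok assms(3)], of n] assms(1) by (simp add: a_def)
  have "r * (d (it \<tau> (Suc n) x) (it \<tau> (Suc n) y))\<^sup>2 \<le> (d (it \<tau> n x) (it \<tau> n y))\<^sup>2 + a"
    using J_almost_contraction[OF assms(1,2) it_D'[OF ok assms(3)] it_X[OF ok assms(4)], of n n]
    by (simp add: r_def a_def)
  also have "\<dots> \<le> 1 / r ^ n * ((d x y)\<^sup>2 + 2 * \<tau> * (e x - e (it \<tau> n x))) + 1 / r ^ n * a"
  proof (rule add_mono)
    show "a \<le> 1 / r ^ n * a"
      using r a mult_right_mono[of 1 "1 / r ^ n" a] power_le_one[of r n] by simp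
  qed (use Suc in \<open>simp add: r_def\<close>)
  also have "\<dots> = 1 / r ^ n * ((d x y)\<^sup>2 + 2 * \<tau> * (e x - e (it \<tau> (Suc n) x)))"
    unfolding a_def distrib_left[symmetric] by (simp add: algebra_simps)
  also have "\<dots> = r * (1 / r ^ Suc n * ((d x y)\<^sup>2 + 2 * \<tau> * (e x - e (it \<tau> (Suc n) x))))"
    using r by simp
  finally show ?case
    using r unfolding r_def[symmetric] by (simp only: mult_le_cancel_left_pos)
qed simp

lemma energy_drop_le:
  assumes "step_ok \<tau>" "slope_le S x" "real n * \<tau> \<le> T"
  defines "R \<equiv> T * S * exp (2 * \<kappa> * T)"
  shows "d x (it \<tau> n x) \<le> R" "e x - e (it \<tau> n x) \<le> S * R + \<kappa> / 2 * R\<^sup>2"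
proof -
  have S: "0 \<le> S" and x: "x \<in> D" using assms by (auto simp: slope_le_def)
  have "real n * \<tau> * S * exp (2 * \<kappa> * T) \<le> R"
    unfolding R_def using assms S by (intro mult_right_mono) auto
  then show R: "d x (it \<tau> n x) \<le> R"
    using dist_it_exp[OF assms(1-3)] by linarith
  have "e x - e (it \<tau> n x) \<le> S * d x (it \<tau> n x) + \<kappa> / 2 * (d x (it \<tau> n x))\<^sup>2"
    using assms(2) it_D'[OF assms(1) x] by (auto simp: slope_le_def)
  also have "\<dots> \<le> S * R + \<kappa> / 2 * R\<^sup>2"
    using S R \<kappa>_nonneg d_nonneg by (intro add_mono mult_left_mono power_mono) auto
  finally show "e x - e (it \<tau> n x) \<le> S * R + \<kappa> / 2 * R\<^sup>2" .
qed

text \<open>The energy drop from a point of finite slope is bounded uniformly on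
  \<open>[0, T]\<close>, so the defect is a multiple of \<tau>. As \<open>C\<close> does not depend
  on \<open>y\<close>, convergence from \<open>x\<close> carries over to arbitrary nearby initial
  points, also of infinite energy.\<close>

lemma it_stable:
  assumes "slope_le S x"
  obtains C where "0 \<le> C" "\<And>\<tau> n y. 0 < \<tau> \<Longrightarrow> 6 * \<kappa> * \<tau> \<le> 1 \<Longrightarrow> real n * \<tau> \<le> T \<Longrightarrow> y \<in> X \<Longrightarrow>
    (d (it \<tau> n x) (it \<tau> n y))\<^sup>2 \<le> exp (6 * \<kappa> * T) * ((d x y)\<^sup>2 + \<tau> * C)"
proof -
  define R where "R = T * S * exp (2 * \<kappa> * T)"
  define C where "C = 2 * \<bar>S * R + \<kappa> / 2 * R\<^sup>2\<bar>"
  show ?thesis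
  proof (rule that)
    show "0 \<le> C" by (simp add: C_def)
    fix \<tau> n y assume A: "0 < \<tau>" "6 * \<kappa> * \<tau> \<le> 1" "real n * \<tau> \<le> T" "y \<in> X"
    have ok: "step_ok \<tau>" using A small_step_ok by blast
    have x: "x \<in> D" using assms by (auto simp: slope_le_def)
    have "2 * (e x - e (it \<tau> n x)) \<le> C"
      using order_trans[OF energy_drop_le(2)[OF ok assms A(3)] abs_ge_self] by (simp add: C_def R_def)
    then have 1: "2 * \<tau> * (e x - e (it \<tau> n x)) \<le> \<tau> * C"
      using mult_left_mono[of "2 * (e x - e (it \<tau> n x))" C \<tau>] A(1) by simp
    have "1 / (1 - 3 * \<kappa> * \<tau>) ^ n \<le> exp (2 * (real n * (3 * \<kappa> * \<tau>)))"
      using A \<kappa>_nonneg by (intro inverse_one_minus_power_le_exp) auto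
    also have "\<dots> \<le> exp (6 * \<kappa> * T)"
      using mult_left_mono[OF A(3) \<kappa>_nonneg] by (simp add: mult_ac)
    finally have 2: "1 / (1 - 3 * \<kappa> * \<tau>) ^ n \<le> exp (6 * \<kappa> * T)" .
    have 3: "0 \<le> (d x y)\<^sup>2 + 2 * \<tau> * (e x - e (it \<tau> n x))"
      using e_it_antimono[OF ok, of 0 x n] x A(1) by simp
    have "1 / (1 - 3 * \<kappa> * \<tau>) ^ n * ((d x y)\<^sup>2 + 2 * \<tau> * (e x - e (it \<tau> n x)))
        \<le> exp (6 * \<kappa> * T) * ((d x y)\<^sup>2 + \<tau> * C)"
      using 1 2 3 by (intro mult_mono) auto
    then show "(d (it \<tau> n x) (it \<tau> n y))\<^sup>2 \<le> exp (6 * \<kappa> * T) * ((d x y)\<^sup>2 + \<tau> * C)"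
      using it_almost_contraction[OF A(1,2) x A(4), of n] by linarith
  qed
qed

section \<open>Convergence of the scheme\<close>

definition D_closure :: "'b set" where
  "D_closure = {x\<in>X. \<forall>\<epsilon>>0. \<exists>y\<in>D. d x y < \<epsilon>}"

text \<open>A nearby \<open>y\<close> of finite energy is replaced by \<open>J \<sigma> y\<close>,
  which has finite slope. Minimality of \<open>J s y\<close> for one fixed step \<open>s\<close>
  bounds the energy drop to \<open>J \<sigma> y\<close> by \<open>K + g / (2 * s)\<close>, while the
  drop is at least \<open>g / (2 * \<sigma>)\<close>. With \<open>\<sigma> \<le> s / 2\<close> this
  gives \<open>g \<le> 4 * \<sigma> * K\<close>, so \<open>J \<sigma> y\<close> tends to
  \<open>y\<close>.\<close>

lemma slope_le_dense:
  assumes x: "x \<in> D_closure" and \<epsilon>: "0 < \<epsilon>"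
  obtains S y where "slope_le S y" "d x y < \<epsilon>"
proof -
  obtain y where y: "y \<in> D" "d x y < \<epsilon> / 2" and xX: "x \<in> X"
    using x half_gt_zero[OF \<epsilon>] unfolding D_closure_def by blast
  define s where "s = 1 / (6 * \<kappa> + 1)"
  have s: "0 < s" "step_ok s"
    using small_step[of s] small_bound_pos by (auto simp: s_def)
  define K where "K = e y - e (J s y)"
  have K: "0 \<le> K" using e_J_le(2)[OF s(2) y(1)] by (simp add: K_def)
  define \<sigma> where "\<sigma> = min (s / 2) (\<epsilon>\<^sup>2 / (32 * (K + 1)))"
  have sg: "0 < \<sigma>" using s K \<epsilon> by (auto simp: \<sigma>_def)
  have sg2: "\<sigma> \<le> s / 2" unfolding \<sigma>_def by (rule min.cobounded1)
  have "\<sigma> \<le> 1 / (6 * \<kappa> + 1)" using sg2 s(1) unfolding s_def[symmetric] by linarith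
  then have sok: "step_ok \<sigma>" using small_step(2) sg by blast
  define g where "g = (d y (J \<sigma> y))\<^sup>2"
  have 1: "g / (2 * \<sigma>) \<le> e y - e (J \<sigma> y)"
    using e_J_le(1)[OF sok y(1)] sg by (simp add: g_def field_simps)
  have "is_min s y (J s y)" using J_min[of s y] s DX y by (auto simp: step_ok_def)
  then have "(d y (J s y))\<^sup>2 / (2 * s) + e (J s y) \<le> g / (2 * s) + e (J \<sigma> y)"
    using J_D[OF sok DX[OF y(1)]] by (auto simp: is_min_def g_def)
  moreover have "0 \<le> (d y (J s y))\<^sup>2 / (2 * s)" using s by simp
  ultimately have 2: "e y - e (J \<sigma> y) \<le> K + g / (2 * s)" by (simp add: K_def)
  have "g / (2 * s) \<le> g / (4 * \<sigma>)"
    using sg sg2 s by (intro divide_left_mono) (auto simp: g_def)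
  moreover have "g / (2 * \<sigma>) = g / (4 * \<sigma>) + g / (4 * \<sigma>)"
    by (simp add: field_simps)
  ultimately have "g / (4 * \<sigma>) \<le> K" using 1 2 by linarith
  then have "g \<le> 4 * \<sigma> * K" using sg by (simp add: field_simps)
  also have "\<dots> \<le> 4 * (\<epsilon>\<^sup>2 / (32 * (K + 1))) * K"
    using K by (intro mult_right_mono mult_left_mono) (auto simp: \<sigma>_def)
  also have "\<dots> = \<epsilon>\<^sup>2 / 8 * (K / (K + 1))"
    using K by (simp add: divide_simps)
  also have "\<dots> \<le> \<epsilon>\<^sup>2 / 8 * 1"
    using K by (intro mult_left_mono) auto
  also have "\<dots> < (\<epsilon> / 2)\<^sup>2"
    using \<epsilon> by (simp add: power_divide)
  finally have "(d y (J \<sigma> y))\<^sup>2 < (\<epsilon> / 2)\<^sup>2" by (simp add: g_def)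
  then have "d y (J \<sigma> y) < \<epsilon> / 2"
    by (rule power2_less_imp_less) (use \<epsilon> in simp)
  then have "d x (J \<sigma> y) < \<epsilon>"
    using d_tri[OF xX DX[OF y(1)] J_X[OF sok DX[OF y(1)]]] y(2) by linarith
  then show ?thesis by (rule that[OF slope_le_J[OF sok DX[OF y(1)]]])
qed


lemma D_closure_X: "x \<in> D_closure \<Longrightarrow> x \<in> X"
  by (simp add: D_closure_def)

text \<open>The comparison passes through a point \<open>y\<close> of finite slope: stability
  relates the orbits of \<open>x\<close> and \<open>y\<close> for equal steps, and the recursion
  estimate relates the orbits of \<open>y\<close> for different steps.\<close>

lemma it_uniformly_cauchy:
  assumes x: "x \<in> D_closure" and T: "0 \<le> T" and \<epsilon>: "0 < \<epsilon>"
  obtains \<delta> where "0 < \<delta>" "\<delta> \<le> 1 / (6 * \<kappa> + 1)"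
    "\<And>\<tau> h i j. 0 < \<tau> \<Longrightarrow> \<tau> < \<delta> \<Longrightarrow> 0 < h \<Longrightarrow> h < \<delta> \<Longrightarrow> real i * \<tau> \<le> T \<Longrightarrow> real j * h \<le> T \<Longrightarrow>
      \<bar>real i * \<tau> - real j * h\<bar> < \<delta> \<Longrightarrow> d (it \<tau> i x) (it h j x) < \<epsilon>"
proof -
  define G where "G = exp (6 * \<kappa> * T)"
  have G: "0 < G" by (simp add: G_def)
  define \<eta> where "\<eta> = min 1 (\<epsilon>\<^sup>2 / (36 * G))"
  have \<eta>: "0 < \<eta>" "\<eta> \<le> 1" using \<epsilon> G by (auto simp: \<eta>_def)
  have "G * \<eta>\<^sup>2 \<le> G * (\<eta> * 1)"
    unfolding power2_eq_square using \<eta> G by (intro mult_left_mono) auto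
  also have "\<dots> \<le> G * (\<epsilon>\<^sup>2 / (36 * G))"
    using G by (intro mult_left_mono) (auto simp: \<eta>_def)
  finally have G\<eta>: "G * \<eta>\<^sup>2 \<le> \<epsilon>\<^sup>2 / 36" using G by simp
  obtain S y where y: "slope_le S y" "d x y < \<eta>" using slope_le_dense[OF x \<eta>(1)] .
  have yX: "y \<in> X" using y DX by (auto simp: slope_le_def)
  obtain C where C: "0 \<le> C" and stab: "\<And>\<tau> n z. 0 < \<tau> \<Longrightarrow> 6 * \<kappa> * \<tau> \<le> 1 \<Longrightarrow> real n * \<tau> \<le> T \<Longrightarrow> z \<in> X \<Longrightarrow>
    (d (it \<tau> n y) (it \<tau> n z))\<^sup>2 \<le> G * ((d y z)\<^sup>2 + \<tau> * C)"
    using it_stable[OF y(1), of T] unfolding G_def by blast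
  define H where "H = S\<^sup>2 * exp (8 * \<kappa> * T)"
  have H: "0 \<le> H" by (simp add: H_def)
  \<comment> \<open>Each of three distances has to stay below \<open>\<epsilon> / 3\<close>.
    Stability contributes \<open>G * \<eta>^2\<close> and \<open>\<delta> * G * C\<close> to a
    square, each at most \<open>\<epsilon>^2 / 36\<close>; the recursion contributes
    \<open>\<delta> * H * (1 + 2 * T)\<close>, at most \<open>\<epsilon>^2 / 18\<close>. The added
    ones keep denominators positive.\<close>
  define \<delta> where "\<delta> = Min {1, 1 / (6 * \<kappa> + 1), \<epsilon>\<^sup>2 / (36 * (G * C + 1)), \<epsilon>\<^sup>2 / (18 * (H * (1 + 2 * T) + 1))}"
  have pos: "0 < G * C + 1" "0 < H * (1 + 2 * T) + 1"
    using G C H T by (auto intro!: add_nonneg_pos)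
  have \<delta>0: "0 < \<delta>"
    using pos \<epsilon> small_bound_pos by (simp add: \<delta>_def)
  have \<delta>: "\<delta> \<le> 1" "\<delta> \<le> 1 / (6 * \<kappa> + 1)" "\<delta> \<le> \<epsilon>\<^sup>2 / (36 * (G * C + 1))" "\<delta> \<le> \<epsilon>\<^sup>2 / (18 * (H * (1 + 2 * T) + 1))"
    unfolding \<delta>_def by (auto intro!: Min_le)
  have close: "d (it \<tau> n x) (it \<tau> n y) < \<epsilon> / 3"
    if A: "0 < \<tau>" "\<tau> < \<delta>" "real n * \<tau> \<le> T" for \<tau> n
  proof -
    have sm: "6 * \<kappa> * \<tau> \<le> 1" "step_ok \<tau>" using small_step[of \<tau>] A \<delta> by auto
    have "(d (it \<tau> n x) (it \<tau> n y))\<^sup>2 \<le> G * ((d x y)\<^sup>2 + \<tau> * C)"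
      using stab[OF A(1) sm(1) A(3) D_closure_X[OF x]]
      unfolding d_sym[OF it_X[OF sm(2) yX] it_X[OF sm(2) D_closure_X[OF x]]] d_sym[OF yX D_closure_X[OF x]] .
    also have "\<dots> \<le> G * (\<eta>\<^sup>2 + \<delta> * C)"
      using A y C G d_nonneg[of x y] by (intro mult_left_mono add_mono power_mono mult_right_mono) auto
    also have "\<dots> = G * \<eta>\<^sup>2 + \<delta> * (G * C)" by (simp add: algebra_simps)
    also have "\<delta> * (G * C) \<le> \<delta> * (G * C + 1)" using \<delta>0 by (intro mult_left_mono) auto
    also have "\<dots> \<le> \<epsilon>\<^sup>2 / 36"
      using iffD1[OF pos_le_divide_eq \<delta>(3)] pos by (simp add: algebra_simps)
    also have "G * \<eta>\<^sup>2 + \<epsilon>\<^sup>2 / 36 < (\<epsilon> / 3)\<^sup>2"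
    proof -
      have "0 < \<epsilon>\<^sup>2" using \<epsilon> by simp
      moreover have "(\<epsilon> / 3)\<^sup>2 = \<epsilon>\<^sup>2 / 9" by (simp add: power_divide)
      ultimately show ?thesis using G\<eta> by linarith
    qed
    finally have "(d (it \<tau> n x) (it \<tau> n y))\<^sup>2 < (\<epsilon> / 3)\<^sup>2" by simp
    then show ?thesis by (rule power2_less_imp_less) (use \<epsilon> in simp)
  qed
  have "d (it \<tau> i x) (it h j x) < \<epsilon>"
    if A: "0 < \<tau>" "\<tau> < \<delta>" and B: "0 < h" "h < \<delta>" and i: "real i * \<tau> \<le> T" and j: "real j * h \<le> T"
      and ij: "\<bar>real i * \<tau> - real j * h\<bar> < \<delta>" for \<tau> h i j
  proof -
    have st: "6 * \<kappa> * \<tau> \<le> 1" "step_ok \<tau>" and sh: "6 * \<kappa> * h \<le> 1" "step_ok h"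
      using small_step[of \<tau>] small_step[of h] A B \<delta> by auto
    have "(d (it \<tau> i y) (it h j y))\<^sup>2 \<le> H * ((real i * \<tau> - real j * h)\<^sup>2 + T * (\<tau> + h))"
      unfolding H_def by (rule sq_dist_iterates_crude[OF A(1) st(1) B(1) sh(1) y(1) i j])
    also have "\<dots> \<le> H * (\<delta> + T * (\<delta> + \<delta>))"
    proof (intro mult_left_mono add_mono H T)
      have "(real i * \<tau> - real j * h)\<^sup>2 \<le> \<delta>\<^sup>2"
        using power_mono[OF less_imp_le[OF ij] abs_ge_zero, of 2] by simp
      also have "\<dots> \<le> \<delta> * 1"
        unfolding power2_eq_square using \<delta>(1) \<delta>0 by (intro mult_left_mono) auto
      finally show "(real i * \<tau> - real j * h)\<^sup>2 \<le> \<delta>" by simp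
    qed (use A B in auto)
    also have "\<dots> = \<delta> * (H * (1 + 2 * T))" by (simp add: algebra_simps)
    also have "\<dots> \<le> \<delta> * (H * (1 + 2 * T) + 1)" using \<delta>0 by (intro mult_left_mono) auto
    also have "\<dots> \<le> \<epsilon>\<^sup>2 / 18"
      using iffD1[OF pos_le_divide_eq \<delta>(4)] pos by (simp add: algebra_simps)
    also have "\<dots> < (\<epsilon> / 3)\<^sup>2" using \<epsilon> by (simp add: power_divide)
    finally have "d (it \<tau> i y) (it h j y) < \<epsilon> / 3"
      by (rule power2_less_imp_less) (use \<epsilon> in simp)
    moreover have "d (it \<tau> i x) (it \<tau> i y) < \<epsilon> / 3" "d (it h j x) (it h j y) < \<epsilon> / 3"
      using close A B i j by auto
    moreover have "d (it h j x) (it h j y) = d (it h j y) (it h j x)"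
      by (intro d_sym it_X sh yX D_closure_X x)
    moreover have "d (it \<tau> i x) (it h j x) \<le> d (it \<tau> i x) (it \<tau> i y) + d (it \<tau> i y) (it h j x)"
      "d (it \<tau> i y) (it h j x) \<le> d (it \<tau> i y) (it h j y) + d (it h j y) (it h j x)"
      by (intro d_tri it_X sh st yX D_closure_X x)+
    ultimately show ?thesis by linarith
  qed
  then show ?thesis using that[OF \<delta>0 \<delta>(2)] by blast
qed

text \<open>Every iterate whose elapsed time is close to \<open>t\<close> is required to be close to
  \<open>u t\<close>, not just the one with step \<open>t / n\<close>. Two different times can then
  be approximated along one orbit with a common step, as the Lipschitz bound and the limiting
  inequality demand.\<close>

definition limit_curve :: "'b \<Rightarrow> (real \<Rightarrow> 'b) \<Rightarrow> bool" where
  "limit_curve x u \<longleftrightarrow> u 0 = x \<and> (\<forall>t\<ge>0. u t \<in> X) \<and>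
     (\<forall>T\<ge>0. \<forall>\<epsilon>>0. \<exists>\<delta>>0. \<delta> \<le> 1 / (6 * \<kappa> + 1) \<and> (\<forall>\<tau> i t. 0 < \<tau> \<longrightarrow> \<tau> < \<delta> \<longrightarrow> 0 \<le> t \<longrightarrow> t \<le> T \<longrightarrow> real i * \<tau> \<le> T \<longrightarrow>
        \<bar>real i * \<tau> - t\<bar> < \<delta> \<longrightarrow> d (it \<tau> i x) (u t) < \<epsilon>))"

lemma it_limit_exists:
  assumes x: "x \<in> D_closure" and t: "0 < t"
  shows "\<exists>z\<in>X. (\<lambda>n. d (it (t / real n) n x) z) \<longlonglongrightarrow> 0"
proof -
  \<comment> \<open>For small \<open>n\<close> the step \<open>t / n\<close> may be inadmissible and
    the iterate may leave \<open>X\<close>; a harmless value is put there so that completeness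
    applies to the whole sequence.\<close>
  define s where "s n = (if step_ok (t / real n) then it (t / real n) n x else x)" for n
  have small: "\<exists>N. \<forall>n\<ge>N. 0 < n \<and> t / real n < \<delta>" if \<delta>: "0 < \<delta>" for \<delta>
  proof -
    have "(\<lambda>n. t / real n) \<longlonglongrightarrow> 0" by (rule lim_const_over_n)
    then have "eventually (\<lambda>n. t / real n < \<delta>) sequentially"
      using order_tendstoD(2) \<delta> by blast
    moreover have "eventually (\<lambda>n. 0 < n) sequentially"
      by (rule eventually_gt_at_top)
    ultimately show ?thesis
      using eventually_conj unfolding eventually_sequentially[symmetric] by fastforce
  qed
  have "\<exists>z\<in>X. (\<lambda>n. d (s n) z) \<longlonglongrightarrow> 0"
  proof (rule complete)
    show "s n \<in> X" for n using it_X D_closure_X[OF x] by (simp add: s_def)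
    fix \<epsilon> :: real assume \<epsilon>: "0 < \<epsilon>"
    obtain \<delta> where \<delta>: "0 < \<delta>" "\<delta> \<le> 1 / (6 * \<kappa> + 1)"
      "\<And>\<tau> h i j. 0 < \<tau> \<Longrightarrow> \<tau> < \<delta> \<Longrightarrow> 0 < h \<Longrightarrow> h < \<delta> \<Longrightarrow> real i * \<tau> \<le> t \<Longrightarrow> real j * h \<le> t \<Longrightarrow>
      \<bar>real i * \<tau> - real j * h\<bar> < \<delta> \<Longrightarrow> d (it \<tau> i x) (it h j x) < \<epsilon>"
      using it_uniformly_cauchy[OF x less_imp_le[OF t] \<epsilon>] by metis
    obtain N where N: "\<And>n. n \<ge> N \<Longrightarrow> 0 < n \<and> t / real n < \<delta>"
      using small[OF \<delta>(1)] by blast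
    have sn: "s n = it (t / real n) n x" if "n \<ge> N" for n
      using small_step(2)[of "t / real n"] N[OF that] t \<delta>(2) by (auto simp: s_def)
    have "d (s m) (s n) < \<epsilon>" if "m \<ge> N" "n \<ge> N" for m n
      unfolding sn[OF that(1)] sn[OF that(2)]
      using N[OF that(1)] N[OF that(2)] t \<delta>(1) by (intro \<delta>(3)) auto
    then show "\<exists>N. \<forall>m\<ge>N. \<forall>n\<ge>N. d (s m) (s n) < \<epsilon>" by blast
  qed
  then obtain z where z: "z \<in> X" "(\<lambda>n. d (s n) z) \<longlonglongrightarrow> 0" by blast
  obtain N where N: "\<And>n. n \<ge> N \<Longrightarrow> 0 < n \<and> t / real n < 1 / (6 * \<kappa> + 1)"
    using small[OF small_bound_pos] by blast
  have "eventually (\<lambda>n. d (s n) z = d (it (t / real n) n x) z) sequentially"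
    unfolding eventually_sequentially
  proof (intro exI allI impI)
    show "d (s n) z = d (it (t / real n) n x) z" if "N \<le> n" for n
      using small_step(2)[of "t / real n"] N[OF that] t by (auto simp: s_def)
  qed
  then have "(\<lambda>n. d (it (t / real n) n x) z) \<longlonglongrightarrow> 0"
    using z(2) by (rule Lim_transform_eventually[rotated])
  then show ?thesis using z(1) by blast
qed

text \<open>In the Cauchy estimate the second orbit has step \<open>t / n\<close> and index
  \<open>n\<close>, so its elapsed time is exactly \<open>t\<close>; letting \<open>n\<close> tend
  to infinity compares any other iterate with the limit. At \<open>t = 0\<close> the zeroth iterate,
  which is \<open>x\<close>, takes this role.\<close>

lemma limit_curve_exists:
  assumes x: "x \<in> D_closure"
  shows "\<exists>u. limit_curve x u"
proof -
  obtain v where v: "\<And>t. 0 < t \<Longrightarrow> v t \<in> X \<and> (\<lambda>n. d (it (t / real n) n x) (v t)) \<longlonglongrightarrow> 0"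
    using it_limit_exists[OF x] by metis
  define u where "u t = (if 0 < t then v t else x)" for t
  have uX: "u t \<in> X" for t using v D_closure_X[OF x] by (auto simp: u_def)
  have "limit_curve x u"
    unfolding limit_curve_def
  proof (intro conjI allI impI)
    show "u 0 = x" by (simp add: u_def)
    show "u t \<in> X" for t by (rule uX)
    fix T \<epsilon> :: real assume T: "0 \<le> T" and \<epsilon>: "0 < \<epsilon>"
    obtain \<delta> where \<delta>: "0 < \<delta>" "\<delta> \<le> 1 / (6 * \<kappa> + 1)"
      "\<And>\<tau> h i j. 0 < \<tau> \<Longrightarrow> \<tau> < \<delta> \<Longrightarrow> 0 < h \<Longrightarrow> h < \<delta> \<Longrightarrow> real i * \<tau> \<le> T \<Longrightarrow> real j * h \<le> T \<Longrightarrow>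
      \<bar>real i * \<tau> - real j * h\<bar> < \<delta> \<Longrightarrow> d (it \<tau> i x) (it h j x) < \<epsilon> / 2"
      using it_uniformly_cauchy[OF x T half_gt_zero[OF \<epsilon>]] by metis
    have "d (it \<tau> i x) (u t) < \<epsilon>"
      if A: "0 < \<tau>" "\<tau> < \<delta>" "0 \<le> t" "t \<le> T" "real i * \<tau> \<le> T" "\<bar>real i * \<tau> - t\<bar> < \<delta>" for \<tau> i t
    proof (cases "t = 0")
      case True
      then have "d (it \<tau> i x) (it \<tau> 0 x) < \<epsilon> / 2"
        using A T by (intro \<delta>(3)) auto
      then show ?thesis using True \<epsilon> by (simp add: u_def)
    next
      case False
      then have t: "0 < t" using A by simp
      have ok: "step_ok \<tau>" using small_step A \<delta> by simp
      have "eventually (\<lambda>n. d (it (t / real n) n x) (v t) < \<epsilon> / 2) sequentially"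
        using v[OF t] order_tendstoD(2) half_gt_zero[OF \<epsilon>] by blast
      moreover have "eventually (\<lambda>n. t / real n < \<delta>) sequentially"
        using order_tendstoD(2)[OF lim_const_over_n[of t] \<delta>(1)] .
      ultimately have "eventually (\<lambda>n. d (it (t / real n) n x) (v t) < \<epsilon> / 2 \<and> t / real n < \<delta> \<and> 0 < n) sequentially"
        using eventually_gt_at_top[of 0] by eventually_elim auto
      then obtain n where n: "d (it (t / real n) n x) (v t) < \<epsilon> / 2" "t / real n < \<delta>" "0 < n"
        unfolding eventually_sequentially by blast
      have okn: "step_ok (t / real n)" using small_step[of "t / real n"] n t \<delta> by simp
      have "d (it \<tau> i x) (it (t / real n) n x) < \<epsilon> / 2"
        using A n t by (intro \<delta>(3)) auto
      moreover have "d (it \<tau> i x) (v t) \<le> d (it \<tau> i x) (it (t / real n) n x) + d (it (t / real n) n x) (v t)"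
        using v[OF t] it_X[OF ok D_closure_X[OF x]] it_X[OF okn D_closure_X[OF x]] by (intro d_tri) auto
      ultimately show ?thesis using n t by (simp add: u_def)
    qed
    then show "\<exists>\<delta>>0. \<delta> \<le> 1 / (6 * \<kappa> + 1) \<and> (\<forall>\<tau> i t. 0 < \<tau> \<longrightarrow> \<tau> < \<delta> \<longrightarrow> 0 \<le> t \<longrightarrow> t \<le> T \<longrightarrow> real i * \<tau> \<le> T \<longrightarrow>
        \<bar>real i * \<tau> - t\<bar> < \<delta> \<longrightarrow> d (it \<tau> i x) (u t) < \<epsilon>)"
      using \<delta>(1,2) by blast
  qed
  then show ?thesis by blast
qed

lemma limit_curveD:
  assumes "limit_curve x u"
  shows "u 0 = x" "\<And>t. 0 \<le> t \<Longrightarrow> u t \<in> X"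
  using assms by (auto simp: limit_curve_def)

lemma limit_curveE:
  assumes "limit_curve x u" "0 \<le> T" "0 < \<epsilon>"
  obtains \<delta> where "0 < \<delta>" "\<delta> \<le> 1 / (6 * \<kappa> + 1)"
    "\<And>\<tau> i t. 0 < \<tau> \<Longrightarrow> \<tau> < \<delta> \<Longrightarrow> 0 \<le> t \<Longrightarrow> t \<le> T \<Longrightarrow> real i * \<tau> \<le> T \<Longrightarrow>
        \<bar>real i * \<tau> - t\<bar> < \<delta> \<Longrightarrow> d (it \<tau> i x) (u t) < \<epsilon>"
proof -
  have "\<exists>\<delta>>0. \<delta> \<le> 1 / (6 * \<kappa> + 1) \<and> (\<forall>\<tau> i t. 0 < \<tau> \<longrightarrow> \<tau> < \<delta> \<longrightarrow> 0 \<le> t \<longrightarrow> t \<le> T \<longrightarrow> real i * \<tau> \<le> T \<longrightarrow>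
        \<bar>real i * \<tau> - t\<bar> < \<delta> \<longrightarrow> d (it \<tau> i x) (u t) < \<epsilon>)"
    using assms by (auto simp: limit_curve_def)
  then obtain \<delta> where "0 < \<delta>" "\<delta> \<le> 1 / (6 * \<kappa> + 1)" "\<forall>\<tau> i t. 0 < \<tau> \<longrightarrow> \<tau> < \<delta> \<longrightarrow> 0 \<le> t \<longrightarrow> t \<le> T \<longrightarrow> real i * \<tau> \<le> T \<longrightarrow>
        \<bar>real i * \<tau> - t\<bar> < \<delta> \<longrightarrow> d (it \<tau> i x) (u t) < \<epsilon>" by blast
  then show ?thesis using that by simp
qed

text \<open>The \<open>n\<close>-th iterate with step \<open>t / n\<close> has elapsed time exactly
  \<open>t\<close>, and \<open>t / n \<le> T / n\<close> makes the threshold for \<open>n\<close>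
  independent of \<open>t\<close>.\<close>

lemma limit_curve_uniform:
  assumes x: "x \<in> X" and u: "limit_curve x u" and T: "0 \<le> T" and \<epsilon>: "0 < \<epsilon>"
  shows "\<exists>N. \<forall>n\<ge>N. \<forall>t\<in>{0..T}. d (it (t / real n) n x) (u t) < \<epsilon>"
proof -
  obtain \<delta> where \<delta>: "0 < \<delta>" "\<delta> \<le> 1 / (6 * \<kappa> + 1)"
    "\<And>\<tau> i t. 0 < \<tau> \<Longrightarrow> \<tau> < \<delta> \<Longrightarrow> 0 \<le> t \<Longrightarrow> t \<le> T \<Longrightarrow> real i * \<tau> \<le> T \<Longrightarrow>
        \<bar>real i * \<tau> - t\<bar> < \<delta> \<Longrightarrow> d (it \<tau> i x) (u t) < \<epsilon>"
    using limit_curveE[OF u T \<epsilon>] by metis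
  have "eventually (\<lambda>n. T / real n < \<delta>) sequentially"
    using order_tendstoD(2)[OF lim_const_over_n[of T] \<delta>(1)] .
  then have "eventually (\<lambda>n. \<forall>t\<in>{0..T}. d (it (t / real n) n x) (u t) < \<epsilon>) sequentially"
    using eventually_gt_at_top[of 0]
  proof eventually_elim
    case (elim n)
    show ?case
    proof
      fix t assume t: "t \<in> {0..T}"
      show "d (it (t / real n) n x) (u t) < \<epsilon>"
      proof (cases "t = 0")
        case True
        have "it 0 n x = x" by (induction n) (auto simp: J_zero)
        then show ?thesis using True limit_curveD(1)[OF u] d_refl[OF x] \<epsilon> by simp
      next
        case False
        have "t / real n \<le> T / real n" using t by (intro divide_right_mono) auto
        then show ?thesis using elim t False \<delta>(1) by (intro \<delta>(3)) auto
      qed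
    qed
  qed
  then show ?thesis by (simp add: eventually_sequentially)
qed

lemma limit_curve_tendsto_0:
  assumes x: "x \<in> X" and u: "limit_curve x u"
  shows "((\<lambda>t. d (u t) x) \<longlongrightarrow> 0) (at_right 0)"
proof (rule order_tendstoI)
  fix a :: real assume "a < 0"
  then show "eventually (\<lambda>t. a < d (u t) x) (at_right 0)"
    using d_nonneg by (intro always_eventually) (meson less_le_trans)
next
  fix a :: real assume a: "0 < a"
  obtain \<delta> where \<delta>: "0 < \<delta>" "\<delta> \<le> 1 / (6 * \<kappa> + 1)"
    "\<And>\<tau> i t. 0 < \<tau> \<Longrightarrow> \<tau> < \<delta> \<Longrightarrow> 0 \<le> t \<Longrightarrow> t \<le> 1 \<Longrightarrow> real i * \<tau> \<le> 1 \<Longrightarrow>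
        \<bar>real i * \<tau> - t\<bar> < \<delta> \<Longrightarrow> d (it \<tau> i x) (u t) < a"
    using limit_curveE[OF u zero_le_one a] by metis
  have "d (u t) x < a" if "0 < t" "t < min 1 \<delta>" for t
  proof -
    \<comment> \<open>The zeroth iterate is \<open>x\<close> for any step;
      \<open>\<delta> / 2\<close> is merely an admissible one.\<close>
    have "d (it (\<delta> / 2) 0 x) (u t) < a" using \<delta>(1) that by (intro \<delta>(3)) auto
    then show ?thesis using d_sym[OF x limit_curveD(2)[OF u]] that by simp
  qed
  then show "eventually (\<lambda>t. d (u t) x < a) (at_right 0)"
    unfolding eventually_at_right_field using \<delta>(1) by (intro exI[of _ "min 1 \<delta>"]) auto
qed

text \<open>The step \<open>t / n\<close> is kept fixed and compared with \<open>t / m\<close> for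
  \<open>m\<close> tending to infinity. Both orbits reach time \<open>t\<close> exactly, so only the
  variance term \<open>t^2 * (1 / n + 1 / m)\<close> survives, and it tends to
  \<open>t^2 / n\<close>. The condition on \<open>n\<close> says that \<open>t / n\<close> is an
  admissible step.\<close>

lemma limit_curve_error:
  assumes u: "limit_curve x u" and S: "slope_le S x" and t: "0 \<le> t" and n: "2 * \<kappa> * t < real n"
  shows "d (it (t / real n) n x) (u t) \<le> t / sqrt (real n) * exp (3 * \<kappa> * t) * S"
proof (cases "t = 0")
  case True
  have "it 0 n x = x" by (induction n) (auto simp: J_zero)
  then show ?thesis using True limit_curveD(1)[OF u] d_refl DX S by (simp add: slope_le_def)
next
  case False
  then have t: "0 < t" using t by simp
  have x: "x \<in> X" and S0: "0 \<le> S" using S DX by (auto simp: slope_le_def)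
  have n0: "0 < real n" using n t \<kappa>_nonneg mult_nonneg_nonneg[of "2 * \<kappa>" t] by linarith
  have ok: "step_ok (t / real m)" if "m \<ge> n" for m
  proof -
    have m: "0 < real m" "2 * \<kappa> * t < real m" using that n0 n by linarith+
    then show ?thesis using t by (simp add: step_ok_def divide_less_eq)
  qed
  \<comment> \<open>The bound of \<open>sq_dist_iterates\<close> for the steps \<open>t / n\<close>
    and \<open>t / m\<close>: there \<open>h * \<tau> / (h + \<tau>)\<close> equals
    \<open>t / (n + m)\<close>, so the power of \<open>p\<close> converges to
    \<open>exp (- (2 * \<kappa> * t))\<close>.\<close>
  define f where "f m = S\<^sup>2 * exp (4 * \<kappa> * t) / (1 + (- (2 * \<kappa> * t)) / real (n + m)) ^ (n + m)
      * (t\<^sup>2 * (1 / real n + 1 / real m))" for m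
  have le: "(d (it (t / real n) n x) (it (t / real m) m x))\<^sup>2 \<le> f m" if m: "m \<ge> n" for m
  proof -
    have m0: "0 < real m" using m n0 by linarith
    have "t * real m + t * real n \<noteq> 0"
      using add_pos_pos[OF mult_pos_pos[OF t m0] mult_pos_pos[OF t n0]] by simp
    then have "t / real m * (t / real n) / (t / real m + t / real n) = t / real (n + m)"
      using t n0 m0 by (simp add: field_simps)
    then have p: "1 - 2 * \<kappa> * (t / real m) * (t / real n) / (t / real m + t / real n)
        = 1 + (- (2 * \<kappa> * t)) / real (n + m)"
      by (metis (no_types, opaque_lifting) mult.assoc times_divide_eq_right minus_divide_left diff_conv_add_uminus)
    have q: "(real n * (t / real n) - real m * (t / real m))\<^sup>2 + t / real n * (t / real m) * real (n + m)
        = t\<^sup>2 * (1 / real n + 1 / real m)"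
      using n0 m0 by (simp add: field_simps power2_eq_square)
    show ?thesis
      using sq_dist_iterates[OF ok[OF order_refl] ok[OF m] S, of n t m] n0 m0
      unfolding p q f_def by simp
  qed
  have lim: "(\<lambda>m. d (it (t / real m) m x) (u t)) \<longlonglongrightarrow> 0"
  proof (rule LIMSEQ_I)
    fix r :: real assume "0 < r"
    then obtain N where "\<forall>m\<ge>N. \<forall>s\<in>{0..t}. d (it (s / real m) m x) (u s) < r"
      using limit_curve_uniform[OF x u less_imp_le[OF t]] by blast
    then show "\<exists>N. \<forall>m\<ge>N. norm (d (it (t / real m) m x) (u t) - 0) < r"
      using t d_nonneg by (intro exI[of _ N]) auto
  qed
  define s where "s m = it (t / real (m + n)) (m + n) x" for m
  have sX: "s m \<in> X" for m unfolding s_def by (intro it_X ok x) simp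
  have sl: "(\<lambda>m. d (s m) (u t)) \<longlonglongrightarrow> 0"
    unfolding s_def by (rule LIMSEQ_ignore_initial_segment[OF lim])
  define z where "z = it (t / real n) n x"
  have zX: "z \<in> X" unfolding z_def by (intro it_X ok x) simp
  have uX: "u t \<in> X" using limit_curveD(2)[OF u] t by simp
  have "(\<lambda>m. (d (s m) z)\<^sup>2) \<longlonglongrightarrow> (d (u t) z)\<^sup>2"
    by (intro tendsto_power tendsto_d sX uX zX sl)
  moreover have "(\<lambda>m. f (m + n)) \<longlonglongrightarrow> S\<^sup>2 * exp (4 * \<kappa> * t) / exp (- (2 * \<kappa> * t)) * (t\<^sup>2 * (1 / real n + 0))"
  proof (rule LIMSEQ_ignore_initial_segment)
    have "(\<lambda>m. (1 + (- (2 * \<kappa> * t)) / real (m + n)) ^ (m + n)) \<longlonglongrightarrow> exp (- (2 * \<kappa> * t))"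
      by (rule LIMSEQ_ignore_initial_segment[OF tendsto_exp_limit_sequentially])
    then show "f \<longlonglongrightarrow> S\<^sup>2 * exp (4 * \<kappa> * t) / exp (- (2 * \<kappa> * t)) * (t\<^sup>2 * (1 / real n + 0))"
      unfolding f_def add.commute[of n] by (intro tendsto_intros lim_const_over_n) auto
  qed
  moreover have "\<forall>\<^sub>F m in sequentially. (d (s m) z)\<^sup>2 \<le> f (m + n)"
  proof (intro always_eventually allI)
    show "(d (s m) z)\<^sup>2 \<le> f (m + n)" for m
      using le[of "m + n"] d_sym[OF sX zX, of m] by (simp add: s_def z_def)
  qed
  ultimately have "(d (u t) z)\<^sup>2 \<le> S\<^sup>2 * exp (4 * \<kappa> * t) / exp (- (2 * \<kappa> * t)) * (t\<^sup>2 * (1 / real n + 0))"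
    by (intro tendsto_le[OF sequentially_bot])
  \<comment> \<open>Origin of the exponent 3: the distance bound contributes 4, the limit of the
    powers of \<open>p\<close> another 2, and the square root halves the sum.\<close>
  also have "\<dots> = (t / sqrt (real n) * exp (3 * \<kappa> * t) * S)\<^sup>2"
  proof -
    have "exp (4 * \<kappa> * t) / exp (- (2 * \<kappa> * t)) = (exp (3 * \<kappa> * t))\<^sup>2"
      by (simp add: exp_double[symmetric] exp_diff[symmetric])
    then show ?thesis using n0 by (simp add: power_mult_distrib power_divide field_simps)
  qed
  finally have "d (u t) z \<le> t / sqrt (real n) * exp (3 * \<kappa> * t) * S"
    by (rule power2_le_imp_le) (use t S0 in simp)
  then show ?thesis using d_sym[OF uX zX] by (simp add: z_def)
qed


section \<open>Regularity at positive times\<close>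

lemma it_bounded:
  assumes x: "x \<in> D_closure" and T: "0 \<le> T"
  obtains R where "0 \<le> R" "\<And>\<tau> n. 0 < \<tau> \<Longrightarrow> \<tau> \<le> 1 / (6 * \<kappa> + 1) \<Longrightarrow> real n * \<tau> \<le> T \<Longrightarrow> d x (it \<tau> n x) \<le> R"
proof -
  define G where "G = exp (6 * \<kappa> * T)"
  obtain S y where y: "slope_le S y" "d x y < 1" using slope_le_dense[OF x zero_less_one] .
  have yX: "y \<in> X" and S: "0 \<le> S" using y DX by (auto simp: slope_le_def)
  have xX: "x \<in> X" by (rule D_closure_X[OF x])
  obtain C where C: "0 \<le> C" and stab: "\<And>\<tau> n z. 0 < \<tau> \<Longrightarrow> 6 * \<kappa> * \<tau> \<le> 1 \<Longrightarrow> real n * \<tau> \<le> T \<Longrightarrow> z \<in> X \<Longrightarrow>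
    (d (it \<tau> n y) (it \<tau> n z))\<^sup>2 \<le> G * ((d y z)\<^sup>2 + \<tau> * C)"
    using it_stable[OF y(1), of T] unfolding G_def by blast
  define B where "B = G * (1 + C)"
  have B: "0 \<le> B" using C by (simp add: B_def G_def)
  have "d x (it \<tau> n x) \<le> 1 + T * S * exp (2 * \<kappa> * T) + (B + 1)"
    if A: "0 < \<tau>" "\<tau> \<le> 1 / (6 * \<kappa> + 1)" "real n * \<tau> \<le> T" for \<tau> n
  proof -
    have ok: "6 * \<kappa> * \<tau> \<le> 1" "step_ok \<tau>" using small_step[OF A(1,2)] by auto
    have "1 / (6 * \<kappa> + 1) \<le> 1" using \<kappa>_nonneg by (simp add: divide_le_eq)
    then have t1: "\<tau> \<le> 1" using A by linarith
    have "(d (it \<tau> n y) (it \<tau> n x))\<^sup>2 \<le> G * ((d y x)\<^sup>2 + \<tau> * C)"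
      by (rule stab[OF A(1) ok(1) A(3) xX])
    also have "\<dots> \<le> G * (1 + 1 * C)"
      using C t1 y(2) d_sym[OF yX xX] d_nonneg[of y x]
      by (intro mult_left_mono add_mono mult_right_mono power_le_one) (auto simp: G_def)
    also have "\<dots> \<le> (B + 1)\<^sup>2"
    proof -
      have "G * (1 + 1 * C) = B" by (simp add: B_def)
      then show ?thesis using B by (simp add: power2_eq_square algebra_simps)
    qed
    finally have "d (it \<tau> n y) (it \<tau> n x) \<le> B + 1"
      by (rule power2_le_imp_le) (use B in simp)
    moreover have "d y (it \<tau> n y) \<le> T * S * exp (2 * \<kappa> * T)"
      by (rule energy_drop_le(1)[OF ok(2) y(1) A(3)])
    moreover have "d x (it \<tau> n x) \<le> d x y + d y (it \<tau> n x)"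
      "d y (it \<tau> n x) \<le> d y (it \<tau> n y) + d (it \<tau> n y) (it \<tau> n x)"
      using it_X[OF ok(2) xX] it_X[OF ok(2) yX] xX yX by (auto intro: d_tri)
    ultimately show ?thesis using y(2) by linarith
  qed
  moreover have "0 \<le> 1 + T * S * exp (2 * \<kappa> * T) + (B + 1)" using T S B by simp
  ultimately show ?thesis using that by blast
qed

text \<open>The length of a step divided by \<tau> bounds the slope at its end, and that slope
  bounds the next step; each passage costs a factor
  \<open>1 / (1 - \<kappa> * \<tau>)\<close>.\<close>

lemma step_almost_antimono:
  assumes "step_ok \<tau>" "x \<in> X"
  shows "d (it \<tau> (i + k) x) (it \<tau> (Suc (i + k)) x) \<le> d (it \<tau> i x) (it \<tau> (Suc i) x) / (1 - \<kappa> * \<tau>) ^ k"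
proof (induction k)
  case (Suc k)
  note t = step_okD[OF assms(1)]
  let ?z = "it \<tau> (i + k) x"
  have zX: "?z \<in> X" by (rule it_X[OF assms])
  have "d (J \<tau> ?z) (J \<tau> (J \<tau> ?z)) \<le> \<tau> * (d ?z (J \<tau> ?z) / \<tau>) / (1 - \<kappa> * \<tau>)"
    by (rule slope_le_step(1)[OF assms(1) slope_le_J[OF assms(1) zX]])
  also have "\<dots> = d ?z (J \<tau> ?z) / (1 - \<kappa> * \<tau>)" using t by simp
  also have "\<dots> \<le> (d (it \<tau> i x) (it \<tau> (Suc i) x) / (1 - \<kappa> * \<tau>) ^ k) / (1 - \<kappa> * \<tau>)"
    using Suc t by (intro divide_right_mono) auto
  finally show ?case by (simp add: mult.commute)
qed simp

text \<open>Summing the energy drops with weights bounds the last step by squared distances alone, without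
  any bound on the energy of the initial point.\<close>

lemma step_size_bound:
  assumes x: "x \<in> D_closure" and a: "0 < a" "a \<le> T"
  obtains K where "0 \<le> K"
    "\<And>\<tau> n. 0 < \<tau> \<Longrightarrow> \<tau> \<le> 1 / (6 * \<kappa> + 1) \<Longrightarrow> 2 * \<tau> \<le> a \<Longrightarrow> a \<le> real (Suc n) * \<tau> \<Longrightarrow> real (Suc n) * \<tau> \<le> T \<Longrightarrow>
      d (it \<tau> n x) (it \<tau> (Suc n) x) \<le> K * \<tau>"
proof -
  have xX: "x \<in> X" by (rule D_closure_X[OF x])
  have T: "0 \<le> T" using a by simp
  obtain R where R: "0 \<le> R" "\<And>\<tau> n. 0 < \<tau> \<Longrightarrow> \<tau> \<le> 1 / (6 * \<kappa> + 1) \<Longrightarrow> real n * \<tau> \<le> T \<Longrightarrow> d x (it \<tau> n x) \<le> R"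
    using it_bounded[OF x T] by blast
  define M where "M = exp (2 * \<kappa> * T)"
  have M: "0 < M" by (simp add: M_def)
  define c where "c = 1 + \<kappa> * T"
  have c: "1 \<le> c" using \<kappa>_nonneg T by (simp add: c_def)
  have "d (it \<tau> n x) (it \<tau> (Suc n) x) \<le> (4 * R * M * c / a) * \<tau>"
    if A: "0 < \<tau>" "\<tau> \<le> 1 / (6 * \<kappa> + 1)" "2 * \<tau> \<le> a" "a \<le> real (Suc n) * \<tau>" "real (Suc n) * \<tau> \<le> T" for \<tau> n
  proof -
    have ok: "step_ok \<tau>" by (rule small_step(2)[OF A(1,2)])
    note t = step_okD[OF ok]
    define z where "z i = it \<tau> i x" for i
    have zX: "z i \<in> X" for i unfolding z_def by (rule it_X[OF ok xX])
    have zD: "z (Suc i) \<in> D" for i unfolding z_def by (rule it_D[OF ok xX])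
    have zS: "z (Suc i) = J \<tau> (z i)" for i by (simp add: z_def)
    have le_T: "real i * \<tau> \<le> T" if "i \<le> Suc n" for i
    proof -
      have "real i * \<tau> \<le> real (Suc n) * \<tau>" using that A by (intro mult_right_mono) auto
      then show ?thesis using A by linarith
    qed
    have dR: "d (z i) (z (Suc n)) \<le> 2 * R" if "i \<le> Suc n" for i
    proof -
      have "d x (z i) \<le> R" "d x (z (Suc n)) \<le> R"
        unfolding z_def by (rule R(2)[OF A(1,2) le_T[OF that]], rule R(2)[OF A(1,2) le_T[OF order_refl]])
      moreover have "d (z i) (z (Suc n)) \<le> d (z i) x + d x (z (Suc n))" "d (z i) x = d x (z i)"
        by (auto intro!: d_tri d_sym zX xX)
      ultimately show ?thesis by linarith
    qed
    define \<Delta> where "\<Delta> = d (z n) (z (Suc n))"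
    have \<Delta>: "0 \<le> \<Delta>" using d_nonneg by (simp add: \<Delta>_def)
    \<comment> \<open>Steps almost decrease, so the last one is at most \<open>M\<close> times each
      earlier one, whose square is in turn paid for by its energy drop.\<close>
    have \<Delta>_le: "\<Delta>\<^sup>2 \<le> 2 * M\<^sup>2 * \<tau> * (e (z i) - e (z (Suc i)))" if i: "1 \<le> i" "i \<le> n" for i
    proof -
      obtain k where k: "n = i + k" using i le_Suc_ex by blast
      have "1 / (1 - \<kappa> * \<tau>) ^ k \<le> M"
        unfolding M_def using le_T[of k] k by (intro inverse_power_le_exp ok) auto
      then have "d (z i) (z (Suc i)) * (1 / (1 - \<kappa> * \<tau>) ^ k) \<le> d (z i) (z (Suc i)) * M"
        by (intro mult_left_mono d_nonneg)
      then have "\<Delta> \<le> d (z i) (z (Suc i)) * M"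
        using step_almost_antimono[OF ok xX, of i k] unfolding \<Delta>_def z_def k by simp
      then have "\<Delta>\<^sup>2 \<le> (d (z i) (z (Suc i)) * M)\<^sup>2"
        using \<Delta> by (intro power_mono)
      also have "\<dots> = M\<^sup>2 * (d (z i) (J \<tau> (z i)))\<^sup>2" by (simp add: power_mult_distrib zS)
      also have "\<dots> \<le> M\<^sup>2 * (2 * \<tau> * (e (z i) - e (J \<tau> (z i))))"
        using zD[of "i - 1"] i by (intro mult_left_mono e_J_le ok) auto
      finally show ?thesis by (simp add: zS)
    qed
    have drop: "real (Suc n - i) * \<Delta>\<^sup>2 \<le> 2 * M\<^sup>2 * \<tau> * (e (z i) - e (z (Suc n)))" if i: "1 \<le> i" "i \<le> Suc n" for i
      using i(2) i(1)
    proof (induction rule: inc_induct)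
      case (step m)
      have "real (Suc n - m) * \<Delta>\<^sup>2 = real (Suc n - Suc m) * \<Delta>\<^sup>2 + \<Delta>\<^sup>2"
        using step.hyps by (simp add: of_nat_diff algebra_simps)
      then show ?case
        using step.IH \<Delta>_le[of m] step.hyps step.prems by (simp add: algebra_simps)
    qed simp
    \<comment> \<open>The discrete inequality tested with the last iterate bounds the energy excess
      over it by a telescoping difference of squared distances. It starts with
      \<open>z (Suc j)\<close>, which has finite energy even if \<open>z 0\<close> has not.\<close>
    have tel: "2 * \<tau> * (e (z (Suc j)) - e (z (Suc n))) \<le>
        (d (z j) (z (Suc n)))\<^sup>2 - (d (z (Suc j)) (z (Suc n)))\<^sup>2 + \<kappa> * \<tau> * (4 * R\<^sup>2)" if j: "j < n" for j
    proof -
      have "(1 - \<kappa> * \<tau>) * (d (z (Suc j)) (z (Suc n)))\<^sup>2 \<le> (d (z j) (z (Suc n)))\<^sup>2 + 2 * \<tau> * (e (z (Suc n)) - e (z (Suc j)))"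
        using J_evi_neg[OF ok zX[of j] zD[of n]] zero_le_power2[of "d (z j) (J \<tau> (z j))"] unfolding zS[of j] by linarith
      moreover have "(d (z (Suc j)) (z (Suc n)))\<^sup>2 \<le> (2 * R)\<^sup>2"
        using dR[of "Suc j"] j d_nonneg by (intro power_mono) auto
      then have "\<kappa> * \<tau> * (d (z (Suc j)) (z (Suc n)))\<^sup>2 \<le> \<kappa> * \<tau> * (4 * R\<^sup>2)"
        using t by (intro mult_left_mono) auto
      ultimately show ?thesis by (simp add: algebra_simps)
    qed
    have "\<Delta>\<^sup>2 * (real n * real (Suc n) / 2) = (\<Sum>j<n. real (n - j) * \<Delta>\<^sup>2)"
      unfolding sum_descending[symmetric] sum_distrib_left by (simp add: mult.commute)
    also have "\<dots> \<le> (\<Sum>j<n. M\<^sup>2 * (2 * \<tau> * (e (z (Suc j)) - e (z (Suc n)))))"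
    proof (rule sum_mono)
      show "real (n - j) * \<Delta>\<^sup>2 \<le> M\<^sup>2 * (2 * \<tau> * (e (z (Suc j)) - e (z (Suc n))))" if "j \<in> {..<n}" for j
        using drop[of "Suc j"] that by (simp add: algebra_simps)
    qed
    also have "\<dots> \<le> (\<Sum>j<n. M\<^sup>2 * (((d (z j) (z (Suc n)))\<^sup>2 - (d (z (Suc j)) (z (Suc n)))\<^sup>2) + \<kappa> * \<tau> * (4 * R\<^sup>2)))"
      using tel by (intro sum_mono mult_left_mono) auto
    also have "\<dots> = M\<^sup>2 * ((d (z 0) (z (Suc n)))\<^sup>2 - (d (z n) (z (Suc n)))\<^sup>2 + real n * (\<kappa> * \<tau> * (4 * R\<^sup>2)))"
      unfolding sum_distrib_left[symmetric] sum.distrib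
      using sum_lessThan_telescope'[of "\<lambda>j. (d (z j) (z (Suc n)))\<^sup>2" n] by simp
    also have "\<dots> \<le> M\<^sup>2 * (4 * R\<^sup>2 * c)"
    proof (intro mult_left_mono)
      have "(d (z 0) (z (Suc n)))\<^sup>2 \<le> (2 * R)\<^sup>2"
        using dR[of 0] d_nonneg by (intro power_mono) auto
      moreover have "(real n * \<tau>) * (\<kappa> * (4 * R\<^sup>2)) \<le> T * (\<kappa> * (4 * R\<^sup>2))"
        using le_T[of n] \<kappa>_nonneg by (intro mult_right_mono) auto
      ultimately have "(d (z 0) (z (Suc n)))\<^sup>2 + real n * (\<kappa> * \<tau> * (4 * R\<^sup>2)) \<le> 4 * R\<^sup>2 * c"
        unfolding c_def by (simp add: algebra_simps)
      then show "(d (z 0) (z (Suc n)))\<^sup>2 - (d (z n) (z (Suc n)))\<^sup>2 + real n * (\<kappa> * \<tau> * (4 * R\<^sup>2)) \<le> 4 * R\<^sup>2 * c"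
        using zero_le_power2[of "d (z n) (z (Suc n))"] by linarith
    qed simp
    finally have main: "\<Delta>\<^sup>2 * (real n * real (Suc n)) \<le> 8 * M\<^sup>2 * R\<^sup>2 * c" by simp
    have n1: "1 \<le> n"
    proof (rule ccontr)
      assume "\<not> 1 \<le> n"
      then have "real (Suc n) * \<tau> = \<tau>" by simp
      then show False using A by linarith
    qed
    have na: "a / 2 \<le> real n * \<tau>"
    proof -
      have "real (Suc n) * \<tau> \<le> (2 * real n) * \<tau>" using n1 A by (intro mult_right_mono) auto
      then show ?thesis using A by linarith
    qed
    have "\<Delta>\<^sup>2 * (a / 2 * a) \<le> \<Delta>\<^sup>2 * ((real n * \<tau>) * (real (Suc n) * \<tau>))"
      using na A a by (intro mult_left_mono mult_mono) auto
    also have "\<dots> = \<Delta>\<^sup>2 * (real n * real (Suc n)) * \<tau>\<^sup>2" by (simp add: power2_eq_square)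
    also have "\<dots> \<le> 8 * M\<^sup>2 * R\<^sup>2 * c * \<tau>\<^sup>2" using main by (intro mult_right_mono) auto
    \<comment> \<open>Enlarging \<open>c\<close> to its square makes the right-hand side a perfect
      square up to the factor 2 that is lost with \<open>a / 2\<close>.\<close>
    also have "\<dots> \<le> 8 * M\<^sup>2 * R\<^sup>2 * c\<^sup>2 * \<tau>\<^sup>2"
      using c mult_left_mono[of 1 c c] by (intro mult_right_mono mult_left_mono) (auto simp: power2_eq_square)
    finally have "\<Delta>\<^sup>2 * a\<^sup>2 \<le> 16 * M\<^sup>2 * R\<^sup>2 * c\<^sup>2 * \<tau>\<^sup>2" by (simp add: power2_eq_square)
    also have "\<dots> = (4 * R * M * c * \<tau>)\<^sup>2" by (simp add: power_mult_distrib)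
    finally have "(\<Delta> * a)\<^sup>2 \<le> (4 * R * M * c * \<tau>)\<^sup>2" by (simp add: power_mult_distrib)
    then have "\<Delta> * a \<le> 4 * R * M * c * \<tau>"
      by (rule power2_le_imp_le) (use R M c A in simp)
    then show ?thesis using a unfolding \<Delta>_def z_def by (simp add: field_simps)
  qed
  moreover have "0 \<le> 4 * R * M * c / a" using R M c a by simp
  ultimately show ?thesis using that by blast
qed

text \<open>A time \<open>s \<ge> a\<close> rounded down to the grid may fall short of
  \<open>a\<close> by almost one step, hence the hypothesis
  \<open>a \<le> real i * \<tau> + \<tau>\<close>. The step bound is invoked for
  \<open>a / 2\<close> to leave room for this.\<close>

lemma it_lipschitz:
  assumes x: "x \<in> D_closure" and a: "0 < a" "a \<le> T"
  obtains K where "0 \<le> K"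
    "\<And>\<tau> i j. 0 < \<tau> \<Longrightarrow> \<tau> \<le> 1 / (6 * \<kappa> + 1) \<Longrightarrow> 4 * \<tau> \<le> a \<Longrightarrow> a \<le> real i * \<tau> + \<tau> \<Longrightarrow> i \<le> j \<Longrightarrow> real j * \<tau> \<le> T \<Longrightarrow>
      d (it \<tau> i x) (it \<tau> j x) \<le> K * (real j * \<tau> - real i * \<tau>)"
proof -
  obtain K where K: "0 \<le> K"
    "\<And>\<tau> n. 0 < \<tau> \<Longrightarrow> \<tau> \<le> 1 / (6 * \<kappa> + 1) \<Longrightarrow> 2 * \<tau> \<le> a / 2 \<Longrightarrow> a / 2 \<le> real (Suc n) * \<tau> \<Longrightarrow> real (Suc n) * \<tau> \<le> T \<Longrightarrow>
      d (it \<tau> n x) (it \<tau> (Suc n) x) \<le> K * \<tau>"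
    using step_size_bound[OF x, of "a / 2" T] a by auto
  have "d (it \<tau> i x) (it \<tau> j x) \<le> K * (real j * \<tau> - real i * \<tau>)"
    if A: "0 < \<tau>" "\<tau> \<le> 1 / (6 * \<kappa> + 1)" "4 * \<tau> \<le> a" "a \<le> real i * \<tau> + \<tau>" "i \<le> j" "real j * \<tau> \<le> T" for \<tau> i j
  proof -
    have ok: "step_ok \<tau>" by (rule small_step(2)[OF A(1,2)])
    note itX = it_X[OF ok D_closure_X[OF x]]
    show ?thesis using A(5,6)
    proof (induction rule: dec_induct)
      case (step m)
      have mT: "real m * \<tau> \<le> T" using step.prems A(1) by (simp add: algebra_simps)
      have "real i * \<tau> \<le> real m * \<tau>" using step.hyps A(1) by simp
      moreover have "real (Suc m) * \<tau> = real m * \<tau> + \<tau>" by (simp add: algebra_simps)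
      ultimately have "a / 2 \<le> real (Suc m) * \<tau>" using A a by linarith
      then have "d (it \<tau> m x) (it \<tau> (Suc m) x) \<le> K * \<tau>"
        using A step.prems by (intro K(2)) auto
      moreover have "d (it \<tau> i x) (it \<tau> (Suc m) x) \<le> d (it \<tau> i x) (it \<tau> m x) + d (it \<tau> m x) (it \<tau> (Suc m) x)"
        by (rule d_tri[OF itX itX itX])
      moreover have "K * (real (Suc m) * \<tau> - real i * \<tau>) = K * (real m * \<tau> - real i * \<tau>) + K * \<tau>"
        by (simp add: algebra_simps)
      ultimately show ?case using step.IH[OF mT] by linarith
    qed (simp add: d_refl itX)
  qed
  with K(1) show ?thesis using that by blast
qed

lemma limit_curve_lipschitz:
  assumes x: "x \<in> D_closure" and u: "limit_curve x u" and a: "0 < a" "a \<le> T"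
  obtains K where "0 \<le> K" "\<And>s t. a \<le> s \<Longrightarrow> s \<le> t \<Longrightarrow> t \<le> T \<Longrightarrow> d (u s) (u t) \<le> K * (t - s)"
proof -
  obtain K where K: "0 \<le> K"
    "\<And>\<tau> i j. 0 < \<tau> \<Longrightarrow> \<tau> \<le> 1 / (6 * \<kappa> + 1) \<Longrightarrow> 4 * \<tau> \<le> a \<Longrightarrow> a \<le> real i * \<tau> + \<tau> \<Longrightarrow> i \<le> j \<Longrightarrow> real j * \<tau> \<le> T \<Longrightarrow>
      d (it \<tau> i x) (it \<tau> j x) \<le> K * (real j * \<tau> - real i * \<tau>)"
    using it_lipschitz[OF x a] by blast
  have T: "0 \<le> T" using a by simp
  have "d (u s) (u t) \<le> K * (t - s)" if st: "a \<le> s" "s \<le> t" "t \<le> T" for s t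
  proof (rule le_of_le_add_scaled)
    fix \<epsilon> :: real assume \<epsilon>: "0 < \<epsilon>" "\<epsilon> < 1"
    obtain \<delta> where \<delta>: "0 < \<delta>" "\<delta> \<le> 1 / (6 * \<kappa> + 1)"
      "\<And>\<tau> i t. 0 < \<tau> \<Longrightarrow> \<tau> < \<delta> \<Longrightarrow> 0 \<le> t \<Longrightarrow> t \<le> T \<Longrightarrow> real i * \<tau> \<le> T \<Longrightarrow>
        \<bar>real i * \<tau> - t\<bar> < \<delta> \<Longrightarrow> d (it \<tau> i x) (u t) < \<epsilon>"
      using limit_curveE[OF u T \<epsilon>(1)] by metis
    define \<tau> where "\<tau> = Min {\<delta> / 2, a / 4, \<epsilon>}"
    have \<tau>0: "0 < \<tau>" using \<delta>(1) a \<epsilon> by (simp add: \<tau>_def)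
    have "\<tau> \<le> \<delta> / 2" "\<tau> \<le> a / 4" "\<tau> \<le> \<epsilon>" unfolding \<tau>_def by (auto intro!: Min_le)
    then have \<tau>: "\<tau> < \<delta>" "4 * \<tau> \<le> a" "\<tau> \<le> \<epsilon>" using \<delta>(1) by auto
    have ok: "step_ok \<tau>" using small_step(2)[of \<tau>] \<tau>0 \<tau> \<delta>(2) by simp
    define i where "i = nat \<lfloor>s / \<tau>\<rfloor>"
    define j where "j = nat \<lfloor>t / \<tau>\<rfloor>"
    have i: "real i * \<tau> \<le> s" "s < real i * \<tau> + \<tau>"
      unfolding i_def using floor_multiple[OF \<tau>0, of s] st a by linarith+
    have j: "real j * \<tau> \<le> t" "t < real j * \<tau> + \<tau>"
      unfolding j_def using floor_multiple[OF \<tau>0, of t] st a by linarith+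
    have ij: "i \<le> j" unfolding i_def j_def using st \<tau>0 by (intro nat_mono floor_mono divide_right_mono) auto
    have 1: "d (it \<tau> i x) (u s) < \<epsilon>" using i \<tau>0 \<tau> st a by (intro \<delta>(3)) auto
    have 2: "d (it \<tau> j x) (u t) < \<epsilon>" using j \<tau>0 \<tau> st a by (intro \<delta>(3)) auto
    have "d (it \<tau> i x) (it \<tau> j x) \<le> K * (real j * \<tau> - real i * \<tau>)"
      using i j ij \<tau>0 \<tau> \<delta>(2) st by (intro K(2)) auto
    also have "\<dots> \<le> K * (t - s + \<epsilon>)"
      using i j \<tau> K(1) by (intro mult_left_mono) auto
    finally have 3: "d (it \<tau> i x) (it \<tau> j x) \<le> K * (t - s) + K * \<epsilon>" by (simp add: algebra_simps)
    have us: "u s \<in> X" "u t \<in> X" using limit_curveD(2)[OF u] st a by auto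
    note itX = it_X[OF ok D_closure_X[OF x]]
    have "d (u s) (u t) \<le> d (u s) (it \<tau> i x) + d (it \<tau> i x) (u t)"
      "d (it \<tau> i x) (u t) \<le> d (it \<tau> i x) (it \<tau> j x) + d (it \<tau> j x) (u t)"
      "d (u s) (it \<tau> i x) = d (it \<tau> i x) (u s)"
      by (auto intro!: d_tri d_sym us itX)
    then have "d (u s) (u t) \<le> K * (t - s) + (2 * \<epsilon> + K * \<epsilon>)" using 1 2 3 by linarith
    then show "d (u s) (u t) \<le> K * (t - s) + \<epsilon> * (2 + K)" by (simp add: algebra_simps)
  qed
  with K(1) show ?thesis using that by blast
qed


section \<open>Passage to the limit in the variational inequality\<close>

text \<open>The discrete inequality is summed over the grid steps between \<open>s\<close> and
  \<open>t\<close>. Monotonicity replaces the intermediate energies by the last one, and the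
  Lipschitz bound replaces the intermediate distances at the cost of the term with \<open>C\<close>.
  Lower semicontinuity handles the limit and puts \<open>u t\<close> into \<open>D\<close> even if
  \<open>x\<close> has infinite energy.\<close>

lemma limit_curve_evi:
  assumes x: "x \<in> D_closure" and u: "limit_curve x u" and y: "y \<in> D" and a: "0 < a" "a \<le> T"
  obtains C where "\<And>s t. a \<le> s \<Longrightarrow> s < t \<Longrightarrow> t \<le> T \<Longrightarrow> u t \<in> D \<and>
    (d (u t) y)\<^sup>2 - (d (u s) y)\<^sup>2 \<le> (t - s) * (2 * (e y - e (u t)) - lam * (d (u t) y)\<^sup>2 + C * (t - s))"
proof -
  have xX: "x \<in> X" and yX: "y \<in> X" using D_closure_X[OF x] DX[OF y] by auto
  have T: "0 \<le> T" using a by simp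
  obtain K where K: "0 \<le> K"
    "\<And>\<tau> i j. 0 < \<tau> \<Longrightarrow> \<tau> \<le> 1 / (6 * \<kappa> + 1) \<Longrightarrow> 4 * \<tau> \<le> a \<Longrightarrow> a \<le> real i * \<tau> + \<tau> \<Longrightarrow> i \<le> j \<Longrightarrow> real j * \<tau> \<le> T \<Longrightarrow>
      d (it \<tau> i x) (it \<tau> j x) \<le> K * (real j * \<tau> - real i * \<tau>)"
    using it_lipschitz[OF x a] by blast
  obtain R where R: "0 \<le> R" "\<And>\<tau> n. 0 < \<tau> \<Longrightarrow> \<tau> \<le> 1 / (6 * \<kappa> + 1) \<Longrightarrow> real n * \<tau> \<le> T \<Longrightarrow> d x (it \<tau> n x) \<le> R"
    using it_bounded[OF x T] by blast
  define B where "B = R + d x y"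
  have B: "0 \<le> B" using R d_nonneg by (simp add: B_def)
  define C where "C = \<bar>lam\<bar> * (2 * B * K)"
  have C0: "0 \<le> C" using B K by (simp add: C_def)
  have discrete: "(d (it \<tau> n x) y)\<^sup>2 - (d (it \<tau> i x) y)\<^sup>2 \<le>
      (real n * \<tau> - real i * \<tau>) * (2 * (e y - e (it \<tau> n x)) - lam * (d (it \<tau> n x) y)\<^sup>2 + C * (real n * \<tau> - real i * \<tau>))"
    if A: "0 < \<tau>" "\<tau> \<le> 1 / (6 * \<kappa> + 1)" "4 * \<tau> \<le> a" "a \<le> real i * \<tau> + \<tau>" "i \<le> n" "real n * \<tau> \<le> T" for \<tau> i n
  proof -
    have ok: "step_ok \<tau>" by (rule small_step(2)[OF A(1,2)])
    define z where "z k = it \<tau> k x" for k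
    have zX: "z k \<in> X" for k unfolding z_def by (rule it_X[OF ok xX])
    have zS: "z (Suc k) = J \<tau> (z k)" for k by (simp add: z_def)
    define F where "F k = (d (z k) y)\<^sup>2" for k
    define L where "L = real n * \<tau> - real i * \<tau>"
    define Q where "Q = 2 * (e y - e (z n)) - lam * F n + C * L"
    have L0: "0 \<le> L" using A by (simp add: L_def)
    have dB: "d (z k) y \<le> B" if "k \<le> n" for k
    proof -
      have "real k * \<tau> \<le> real n * \<tau>" using that A by simp
      then have "real k * \<tau> \<le> T" using A by linarith
      then have "d x (z k) \<le> R" unfolding z_def by (rule R(2)[OF A(1,2)])
      moreover have "d (z k) y \<le> d (z k) x + d x y" "d (z k) x = d x (z k)"
        by (auto intro!: d_tri d_sym zX xX yX)
      ultimately show ?thesis by (simp add: B_def)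
    qed
    have step: "F (Suc k) - F k \<le> \<tau> * Q" if k: "i \<le> k" "k < n" for k
    proof -
      have ik: "real i * \<tau> \<le> real (Suc k) * \<tau>" using k A by (intro mult_right_mono) auto
      have "d (z (Suc k)) (z n) \<le> K * (real n * \<tau> - real (Suc k) * \<tau>)"
        unfolding z_def using k by (intro K(2) A order_trans[OF A(4)] add_right_mono ik) auto
      also have "\<dots> \<le> K * L"
        using K(1) ik by (intro mult_left_mono) (auto simp: L_def)
      finally have dd: "d (z (Suc k)) (z n) \<le> K * L" .
      have "\<bar>F n - F (Suc k)\<bar> = \<bar>d (z (Suc k)) y - d (z n) y\<bar> * (d (z n) y + d (z (Suc k)) y)"
      proof -
        have "F n - F (Suc k) = (d (z n) y - d (z (Suc k)) y) * (d (z n) y + d (z (Suc k)) y)"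
          by (simp add: F_def power2_eq_square algebra_simps)
        then show ?thesis
          using d_nonneg[of "z n" y] d_nonneg[of "z (Suc k)" y] by (simp add: abs_mult abs_minus_commute)
      qed
      also have "\<dots> \<le> (K * L) * (B + B)"
        using abs_d_diff_le[OF zX zX yX, of "Suc k" n] dd dB[of n] dB[of "Suc k"] k d_nonneg K(1) L0
        by (intro mult_mono add_mono) auto
      finally have "\<bar>lam\<bar> * \<bar>F n - F (Suc k)\<bar> \<le> \<bar>lam\<bar> * ((K * L) * (B + B))"
        by (intro mult_left_mono) auto
      then have "\<bar>lam * (F n - F (Suc k))\<bar> \<le> C * L"
        unfolding abs_mult by (simp add: C_def algebra_simps)
      then have 1: "lam * F n - lam * F (Suc k) \<le> C * L"
        by (simp add: right_diff_distrib)
      have zD: "z (Suc k) \<in> D" unfolding z_def by (rule it_D[OF ok xX])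
      have 2: "e (z n) \<le> e (z (Suc k))"
        using e_it_antimono[OF ok, of "Suc k" x n] zD k unfolding z_def by simp
      have "(1 + lam * \<tau>) * F (Suc k) \<le> F k + 2 * \<tau> * (e y - e (z (Suc k)))"
        using J_evi[OF ok zX[of k] y] zero_le_power2[of "d (z k) (J \<tau> (z k))"]
        unfolding F_def zS by linarith
      then have "F (Suc k) - F k \<le> \<tau> * (2 * (e y - e (z (Suc k))) - lam * F (Suc k))"
        by (simp add: algebra_simps)
      also have "\<dots> \<le> \<tau> * Q"
        unfolding Q_def using 1 2 A(1) by (intro mult_left_mono) auto
      finally show ?thesis .
    qed
    have "F m - F i \<le> (real m - real i) * (\<tau> * Q)" if "i \<le> m" "m \<le> n" for m
      using that
    proof (induction rule: dec_induct)
      case (step m)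
      then show ?case using \<open>\<And>k. i \<le> k \<Longrightarrow> k < n \<Longrightarrow> F (Suc k) - F k \<le> \<tau> * Q\<close>[of m]
        by (simp add: algebra_simps)
    qed simp
    from this[OF A(5) order_refl] have "F n - F i \<le> L * Q" by (simp add: L_def algebra_simps)
    then show ?thesis by (simp add: F_def L_def Q_def z_def)
  qed
  have "u t \<in> D \<and> (d (u t) y)\<^sup>2 - (d (u s) y)\<^sup>2 \<le>
      (t - s) * (2 * (e y - e (u t)) - lam * (d (u t) y)\<^sup>2 + C * (t - s))"
    if st: "a \<le> s" "s < t" "t \<le> T" for s t
  proof -
    \<comment> \<open>The three bounds make the steps admissible, small enough for the Lipschitz
      estimate, and so small that the grid points below \<open>s\<close> and \<open>t\<close>
      differ, whence \<open>L m\<close> is positive.\<close>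
    define c where "c = Min {1 / (6 * \<kappa> + 1), a / 4, (t - s) / 2}"
    have c0: "0 < c" using small_bound_pos a st by (simp add: c_def)
    have c: "c \<le> 1 / (6 * \<kappa> + 1)" "c \<le> a / 4" "c \<le> (t - s) / 2"
      unfolding c_def by (rule Min_le; simp)+
    define \<tau> where "\<tau> m = c / real (Suc m)" for m
    have \<tau>0: "0 < \<tau> m" for m using c0 by (simp add: \<tau>_def)
    have \<tau>c: "\<tau> m \<le> c" for m using c0 by (simp add: \<tau>_def divide_le_eq)
    have \<tau>lim: "\<tau> \<longlonglongrightarrow> 0"
      unfolding \<tau>_def by (rule LIMSEQ_Suc[OF lim_const_over_n])
    define i where "i m = nat \<lfloor>s / \<tau> m\<rfloor>" for m
    define n where "n m = nat \<lfloor>t / \<tau> m\<rfloor>" for m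
    have i: "real (i m) * \<tau> m \<le> s" "s < real (i m) * \<tau> m + \<tau> m" for m
      unfolding i_def using floor_multiple[OF \<tau>0, of s m] st a by linarith+
    have n: "real (n m) * \<tau> m \<le> t" "t < real (n m) * \<tau> m + \<tau> m" for m
      unfolding n_def using floor_multiple[OF \<tau>0, of t m] st a by linarith+
    have i_n: "i m \<le> n m" for m
      unfolding i_def n_def using st less_imp_le[OF \<tau>0] by (intro nat_mono floor_mono divide_right_mono) auto
    have ok: "step_ok (\<tau> m)" for m using small_step(2)[OF \<tau>0] \<tau>c c order_trans by blast
    have lim: "(\<lambda>m. d (it (\<tau> m) (k m) x) (u r)) \<longlonglongrightarrow> 0"
      if k: "\<And>m. real (k m) * \<tau> m \<le> r" "\<And>m. r < real (k m) * \<tau> m + \<tau> m" and r: "0 \<le> r" "r \<le> T" for k r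
    proof (rule LIMSEQ_I)
      fix \<epsilon> :: real assume \<epsilon>: "0 < \<epsilon>"
      obtain \<delta> where \<delta>: "0 < \<delta>" "\<delta> \<le> 1 / (6 * \<kappa> + 1)"
        "\<And>\<tau> i t. 0 < \<tau> \<Longrightarrow> \<tau> < \<delta> \<Longrightarrow> 0 \<le> t \<Longrightarrow> t \<le> T \<Longrightarrow> real i * \<tau> \<le> T \<Longrightarrow>
          \<bar>real i * \<tau> - t\<bar> < \<delta> \<Longrightarrow> d (it \<tau> i x) (u t) < \<epsilon>"
        using limit_curveE[OF u T \<epsilon>] by metis
      obtain N where N: "\<And>m. m \<ge> N \<Longrightarrow> \<tau> m < \<delta>"
        using order_tendstoD(2)[OF \<tau>lim \<delta>(1)] by (auto simp: eventually_sequentially)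
      have "d (it (\<tau> m) (k m) x) (u r) < \<epsilon>" if "m \<ge> N" for m
        using N[OF that] k[of m] \<tau>0[of m] r by (intro \<delta>(3)) auto
      then show "\<exists>N. \<forall>m\<ge>N. norm (d (it (\<tau> m) (k m) x) (u r) - 0) < \<epsilon>"
        using d_nonneg by (intro exI[of _ N]) auto
    qed
    have mul_lim: "(\<lambda>m. real (k m) * \<tau> m) \<longlonglongrightarrow> r"
      if k: "\<And>m. real (k m) * \<tau> m \<le> r" "\<And>m. r < real (k m) * \<tau> m + \<tau> m" for k r
    proof (rule tendsto_sandwich)
      show "\<forall>\<^sub>F m in sequentially. r - \<tau> m \<le> real (k m) * \<tau> m"
        using k(2) by (intro always_eventually allI) (simp add: less_imp_le algebra_simps)
      show "(\<lambda>m. r - \<tau> m) \<longlonglongrightarrow> r" using tendsto_diff[OF tendsto_const \<tau>lim, of r] by simp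
    qed (use k in auto)
    define L where "L m = real (n m) * \<tau> m - real (i m) * \<tau> m" for m
    have Llim: "L \<longlonglongrightarrow> t - s"
      unfolding L_def by (intro tendsto_diff mul_lim i n)
    have L0: "0 < L m" for m
    proof -
      have "t - \<tau> m < real (n m) * \<tau> m" using n(2)[of m] by linarith
      moreover have "\<tau> m \<le> (t - s) / 2" using \<tau>c[of m] c(3) by linarith
      ultimately show ?thesis using i(1)[of m] st(2) unfolding L_def by argo
    qed
    define F where "F m = (d (it (\<tau> m) (n m) x) y)\<^sup>2" for m
    define G where "G m = (d (it (\<tau> m) (i m) x) y)\<^sup>2" for m
    have uX: "u s \<in> X" "u t \<in> X" using limit_curveD(2)[OF u] st a by auto
    have limn: "(\<lambda>m. d (it (\<tau> m) (n m) x) (u t)) \<longlonglongrightarrow> 0" by (rule lim[OF n]) (use st a in auto)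
    have limi: "(\<lambda>m. d (it (\<tau> m) (i m) x) (u s)) \<longlonglongrightarrow> 0" by (rule lim[OF i]) (use st a in auto)
    have Flim: "F \<longlonglongrightarrow> (d (u t) y)\<^sup>2"
      unfolding F_def by (intro tendsto_power tendsto_d[OF _ uX(2) yX limn] it_X ok xX)
    have Glim: "G \<longlonglongrightarrow> (d (u s) y)\<^sup>2"
      unfolding G_def by (intro tendsto_power tendsto_d[OF _ uX(1) yX limi] it_X ok xX)
    \<comment> \<open>The summed inequality solved for the energy of the later iterate, the form in
      which lower semicontinuity applies.\<close>
    define E where "E m = e y + (G m - F m) / (2 * L m) - lam / 2 * F m + C / 2 * L m" for m
    have le: "e (it (\<tau> m) (n m) x) \<le> E m" for m
    proof -
      have "F m - G m \<le> L m * (2 * (e y - e (it (\<tau> m) (n m) x)) - lam * F m + C * L m)"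
        unfolding F_def G_def L_def
        using \<tau>0[of m] \<tau>c[of m] c i[of m] n[of m] i_n[of m] st by (intro discrete) linarith+
      moreover define Q where "Q = (F m - G m) / L m"
      ultimately have "Q \<le> 2 * (e y - e (it (\<tau> m) (n m) x)) - lam * F m + C * L m"
        using L0[of m] by (simp add: divide_le_eq mult.commute)
      moreover have "(G m - F m) / (2 * L m) = - Q / 2"
        using L0[of m] by (simp add: Q_def field_simps)
      then have "E m = e y - Q / 2 - lam / 2 * F m + C / 2 * L m" unfolding E_def by simp
      ultimately show ?thesis by simp
    qed
    have Elim: "E \<longlonglongrightarrow> e y + ((d (u s) y)\<^sup>2 - (d (u t) y)\<^sup>2) / (2 * (t - s)) - lam / 2 * (d (u t) y)\<^sup>2 + C / 2 * (t - s)"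
      unfolding E_def using st by (intro tendsto_intros Flim Glim Llim) auto
    have nD: "it (\<tau> m) (n m) x \<in> D" for m
    proof -
      have "0 < real (n m) * \<tau> m" using n(2)[of m] \<tau>c[of m] c st a by linarith
      then obtain k where "n m = Suc k" by (cases "n m") auto
      then show ?thesis using it_D[OF ok xX, of k m] by simp
    qed
    have "u t \<in> D" and eu: "e (u t) \<le> e y + ((d (u s) y)\<^sup>2 - (d (u t) y)\<^sup>2) / (2 * (t - s)) - lam / 2 * (d (u t) y)\<^sup>2 + C / 2 * (t - s)"
      using lsc_tendsto[OF nD Elim le uX(2) limn] by auto
    define \<Delta> where "\<Delta> = ((d (u t) y)\<^sup>2 - (d (u s) y)\<^sup>2) / (t - s)"
    have "((d (u s) y)\<^sup>2 - (d (u t) y)\<^sup>2) / (2 * (t - s)) = - \<Delta> / 2"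
      using st by (simp add: \<Delta>_def field_simps)
    then have "\<Delta> \<le> 2 * (e y - e (u t)) - lam * (d (u t) y)\<^sup>2 + C * (t - s)"
      using eu by simp
    then have "(t - s) * \<Delta> \<le> (t - s) * (2 * (e y - e (u t)) - lam * (d (u t) y)\<^sup>2 + C * (t - s))"
      using st by (intro mult_left_mono) auto
    moreover have "(t - s) * \<Delta> = (d (u t) y)\<^sup>2 - (d (u s) y)\<^sup>2" using st by (simp add: \<Delta>_def)
    ultimately show ?thesis using \<open>u t \<in> D\<close> by simp
  qed
  then show ?thesis using that by blast
qed

text \<open>On intervals ending at \<open>t\<close> the integrated inequality contains the energy at
  \<open>t\<close> itself. The left difference quotient therefore yields the claim with
  \<open>e (u t)\<close> as a constant.\<close>

lemma limit_curve_evi_deriv: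
  assumes x: "x \<in> D_closure" and u: "limit_curve x u" and y: "y \<in> D" and t: "0 < t"
  shows "u t \<in> D"
    and "((\<lambda>s. (d (u s) y)\<^sup>2) has_real_derivative A) (at t) \<Longrightarrow> A / 2 + lam / 2 * (d (u t) y)\<^sup>2 \<le> e y - e (u t)"
proof -
  have "0 < t / 2" "t / 2 \<le> t" using t by auto
  then obtain C where C: "\<And>s r. t / 2 \<le> s \<Longrightarrow> s < r \<Longrightarrow> r \<le> t \<Longrightarrow> u r \<in> D \<and>
    (d (u r) y)\<^sup>2 - (d (u s) y)\<^sup>2 \<le> (r - s) * (2 * (e y - e (u r)) - lam * (d (u r) y)\<^sup>2 + C * (r - s))"
    using limit_curve_evi[OF x u y] by blast
  show "u t \<in> D" using C[of "t / 2" t] t by simp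
  assume der: "((\<lambda>s. (d (u s) y)\<^sup>2) has_real_derivative A) (at t)"
  have "A \<le> 2 * (e y - e (u t)) - lam * (d (u t) y)\<^sup>2"
    by (rule left_difference_quotient_bound[OF der, of "t / 2" _ C]) (use C t in auto)
  then show "A / 2 + lam / 2 * (d (u t) y)\<^sup>2 \<le> e y - e (u t)" by simp
qed


lemma limit_curve_sq_dist_lipschitz:
  assumes x: "x \<in> D_closure" and u: "limit_curve x u" and y: "y \<in> X" and a: "0 < a" "a \<le> T"
  shows "\<exists>L. \<forall>s\<in>{a..T}. \<forall>t\<in>{a..T}. \<bar>(d (u s) y)\<^sup>2 - (d (u t) y)\<^sup>2\<bar> \<le> L * \<bar>s - t\<bar>"
proof -
  obtain K where K: "0 \<le> K" "\<And>s t. a \<le> s \<Longrightarrow> s \<le> t \<Longrightarrow> t \<le> T \<Longrightarrow> d (u s) (u t) \<le> K * (t - s)"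
    using limit_curve_lipschitz[OF x u a] by blast
  have uX: "u t \<in> X" if "a \<le> t" for t using limit_curveD(2)[OF u] that a by simp
  have K': "d (u s) (u t) \<le> K * \<bar>s - t\<bar>" if "a \<le> s" "s \<le> T" "a \<le> t" "t \<le> T" for s t
  proof (cases "s \<le> t")
    case True
    then show ?thesis using K(2)[of s t] that by simp
  next
    case False
    then show ?thesis using K(2)[of t s] that d_sym[OF uX uX, of s t] by simp
  qed
  define B where "B = K * (T - a) + d (u a) y"
  have B: "d (u t) y \<le> B" if "a \<le> t" "t \<le> T" for t
  proof -
    have "d (u t) y \<le> d (u t) (u a) + d (u a) y" by (rule d_tri[OF uX uX y]) (use that in auto)
    moreover have "d (u t) (u a) \<le> K * \<bar>t - a\<bar>" using that by (intro K') auto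
    moreover have "K * \<bar>t - a\<bar> \<le> K * (T - a)" using that K(1) by (intro mult_left_mono) auto
    ultimately show ?thesis by (simp add: B_def)
  qed
  have "\<bar>(d (u s) y)\<^sup>2 - (d (u t) y)\<^sup>2\<bar> \<le> (K * (B + B)) * \<bar>s - t\<bar>"
    if st: "s \<in> {a..T}" "t \<in> {a..T}" for s t
  proof -
    have "\<bar>(d (u s) y)\<^sup>2 - (d (u t) y)\<^sup>2\<bar> = \<bar>d (u s) y - d (u t) y\<bar> * (d (u s) y + d (u t) y)"
    proof -
      have "(d (u s) y)\<^sup>2 - (d (u t) y)\<^sup>2 = (d (u s) y - d (u t) y) * (d (u s) y + d (u t) y)"
        by (simp add: power2_eq_square algebra_simps)
      then show ?thesis using d_nonneg[of "u s" y] d_nonneg[of "u t" y] by (simp add: abs_mult)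
    qed
    also have "\<dots> \<le> (K * \<bar>s - t\<bar>) * (B + B)"
    proof (rule mult_mono)
      show "\<bar>d (u s) y - d (u t) y\<bar> \<le> K * \<bar>s - t\<bar>"
        using abs_d_diff_le[OF uX uX y, of s t] K'[of s t] st by auto
      show "d (u s) y + d (u t) y \<le> B + B" using B st by (intro add_mono) auto
    qed (use K(1) d_nonneg in auto)
    finally show ?thesis by (simp add: mult_ac)
  qed
  then show ?thesis by blast
qed

end

section \<open>Almost everywhere differentiability of Lipschitz functions\<close>

text \<open>Lebesgue differentiation is applied to cubes with lower corner \<open>x\<close>; in
  dimension one these are the intervals from \<open>x\<close> to \<open>x + h\<close>, which give
  the right difference quotient.\<close>

lemma lebesgue_point_right:
  fixes g :: "real \<Rightarrow> real"
  assumes int: "\<And>a b. g integrable_on {a..b}" and F: "\<And>a b. a \<le> b \<Longrightarrow> F b - F a = integral {a..b} g"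
  obtains N where "negligible N" "\<And>x. x \<notin> N \<Longrightarrow> ((\<lambda>h. (F (x + h) - F x) / h) \<longlongrightarrow> g x) (at_right 0)"
proof -
  have "\<exists>N. negligible N \<and> (\<forall>x e. x \<notin> N \<longrightarrow> 0 < e \<longrightarrow>
      (\<exists>d>0. \<forall>h. 0 < h \<and> h < d \<longrightarrow> norm (integral (cbox x (x + h *\<^sub>R One)) g /\<^sub>R h ^ DIM(real) - g x) < e))"
  proof (rule integrable_ccontinuous_explicit[of g])
    show "g integrable_on cbox a b" for a b using int by simp
  qed (rule exI, erule conjI, simp)
  then obtain N where N: "negligible N" and lim: "\<And>x e. \<lbrakk>x \<notin> N; 0 < e\<rbrakk> \<Longrightarrow>
      \<exists>d>0. \<forall>h. 0 < h \<and> h < d \<longrightarrow> norm (integral (cbox x (x + h *\<^sub>R One)) g /\<^sub>R h ^ DIM(real) - g x) < e"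
    by auto
  have "((\<lambda>h. (F (x + h) - F x) / h) \<longlongrightarrow> g x) (at_right 0)" if "x \<notin> N" for x
  proof (rule tendstoI)
    fix e :: real assume "0 < e"
    then obtain d where d: "d > 0" "\<And>h. 0 < h \<Longrightarrow> h < d \<Longrightarrow> norm (integral (cbox x (x + h *\<^sub>R One)) g /\<^sub>R h ^ DIM(real) - g x) < e"
      using lim[OF \<open>x \<notin> N\<close> \<open>0 < e\<close>] by auto
    have "dist ((F (x + h) - F x) / h) (g x) < e" if "0 < h" "h < d" for h
    proof -
      have "integral (cbox x (x + h *\<^sub>R One)) g /\<^sub>R h ^ DIM(real) = (F (x + h) - F x) / h"
        using F[of x "x + h"] that by (simp add: divide_inverse)
      then show ?thesis using d(2)[OF that] by (simp only: dist_norm)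
    qed
    then show "\<forall>\<^sub>F h in at_right 0. dist ((F (x + h) - F x) / h) (g x) < e"
      unfolding eventually_at_right_field using d(1) by blast
  qed
  then show ?thesis by (rule that[OF N])
qed

text \<open>Left difference quotients of \<open>F\<close> at \<open>x\<close> are right ones of the
  reflected function \<open>- F (- t)\<close> at \<open>- x\<close>. Reflection preserves negligible
  sets, so the two exceptional sets can be united.\<close>

lemma indefinite_integral_AE_differentiable:
  fixes g :: "real \<Rightarrow> real"
  assumes int: "\<And>a b. g integrable_on {a..b}" and F: "\<And>a b. a \<le> b \<Longrightarrow> F b - F a = integral {a..b} g"
  obtains N where "negligible N" "\<And>x. x \<notin> N \<Longrightarrow> (F has_real_derivative g x) (at x)"
proof -
  obtain N1 where N1: "negligible N1" "\<And>x. x \<notin> N1 \<Longrightarrow> ((\<lambda>h. (F (x + h) - F x) / h) \<longlongrightarrow> g x) (at_right 0)"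
    using lebesgue_point_right[OF int F] by blast
  have int': "(\<lambda>x. g (- x)) integrable_on {a..b}" for a b
    using Henstock_Kurzweil_Integration.integrable_reflect_real[where f = g and a = "- b" and b = "- a"] int by simp
  have F': "- F (- b) - - F (- a) = integral {a..b} (\<lambda>x. g (- x))" if "a \<le> b" for a b
    using Henstock_Kurzweil_Integration.integral_reflect_real[where f = g and a = "- b" and b = "- a"] F[of "- b" "- a"] that by simp
  obtain N2 where N2: "negligible N2" "\<And>x. x \<notin> N2 \<Longrightarrow> ((\<lambda>h. (- F (- (x + h)) - - F (- x)) / h) \<longlongrightarrow> g (- x)) (at_right 0)"
    using lebesgue_point_right[OF int' F'] by blast
  have "(F has_real_derivative g x) (at x)" if x: "x \<notin> N1 \<union> uminus ` N2" for x
  proof -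
    have "((\<lambda>h. (F (x + h) - F x) / h) \<longlongrightarrow> g x) (at_right 0)" using N1(2) x by blast
    moreover have "((\<lambda>h. (F (x + h) - F x) / h) \<longlongrightarrow> g x) (at_left 0)"
    proof -
      have "- x \<notin> N2" using x by (metis UnCI image_eqI minus_minus)
      then have "((\<lambda>h. (- F (- (- x + h)) - - F (- (- x))) / h) \<longlongrightarrow> g (- (- x))) (at_right 0)" by (rule N2(2))
      moreover have "(- F (- (- x + h)) - - F (- (- x))) / h = (F (x + - h) - F x) / (- h)" for h
        by (simp add: diff_divide_distrib)
      ultimately have "((\<lambda>h. (F (x + - h) - F x) / (- h)) \<longlongrightarrow> g x) (at_right 0)"
        by simp
      then show ?thesis
        unfolding at_left_minus[of "0::real"] filterlim_filtermap by simp
    qed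
    ultimately have "((\<lambda>h. (F (x + h) - F x) / h) \<longlongrightarrow> g x) (at 0)"
      by (rule filterlim_split_at[rotated])
    then show ?thesis by (simp add: DERIV_def)
  qed
  moreover have "negligible (N1 \<union> uminus ` N2)"
  proof (rule negligible_Un[OF N1(1)])
    show "negligible (uminus ` N2)"
      using N2(1)
    proof (rule negligible_locally_Lipschitz_image[rotated])
      show "\<exists>T B. open T \<and> x \<in> T \<and> (\<forall>y\<in>N2 \<inter> T. norm (- y - - x) \<le> B * norm (y - x))" for x :: real
        by (intro exI[of _ UNIV] exI[of _ 1]) auto
    qed simp
  qed
  ultimately show ?thesis using that by blast
qed

text \<open>Adding a linear function makes \<open>f\<close> a homeomorphism; the image of Lebesgue measure under its inverse
  is absolutely continuous, and the density is the derivative.\<close>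

lemma lipschitz_AE_differentiable:
  fixes f :: "real \<Rightarrow> real"
  assumes L: "\<And>s t. \<bar>f s - f t\<bar> \<le> L * \<bar>s - t\<bar>"
  obtains N where "negligible N" "\<And>x. x \<notin> N \<Longrightarrow> \<exists>D. (f has_real_derivative D) (at x)"
proof -
  have L0: "0 \<le> L" using L[of 0 1] by simp
  \<comment> \<open>The summand \<open>(L + 1) * t\<close> raises every difference quotient to at
    least 1, so \<open>F\<close> is strictly increasing and onto, while it remains
    Lipschitz.\<close>
  define F where "F t = f t + (L + 1) * t" for t
  have F_ge: "t - s \<le> F t - F s" if "s \<le> t" for s t
  proof -
    have "- (L * (t - s)) \<le> f t - f s" using L[of t s] that by (simp add: abs_le_iff)
    then show ?thesis by (simp add: F_def algebra_simps)
  qed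
  have F_le: "\<bar>F t - F s\<bar> \<le> (2 * L + 1) * \<bar>t - s\<bar>" for s t
  proof -
    have "F t - F s = (f t - f s) + (L + 1) * (t - s)"
      by (simp add: F_def algebra_simps)
    then have "\<bar>F t - F s\<bar> \<le> \<bar>f t - f s\<bar> + \<bar>(L + 1) * (t - s)\<bar>"
      using abs_triangle_ineq[of "f t - f s" "(L + 1) * (t - s)"] by simp
    also have "\<dots> \<le> L * \<bar>t - s\<bar> + (L + 1) * \<bar>t - s\<bar>"
      using L[of t s] L0 by (simp add: abs_mult)
    finally show ?thesis by (simp add: algebra_simps)
  qed
  have F_mono: "strict_mono F"
  proof (rule strict_monoI)
    show "F s < F t" if "s < t" for s t using F_ge[of s t] that by simp
  qed
  have F_cont: "continuous_on UNIV F"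
  proof (rule lipschitz_on_continuous_on)
    show "(2 * L + 1)-lipschitz_on UNIV F"
      using F_le L0 by (auto simp: lipschitz_on_def dist_real_def)
  qed
  have F_surj: "\<exists>x. F x = y" for y
  proof -
    define b where "b = \<bar>y - F 0\<bar>"
    have "F (- b) \<le> y" "y \<le> F b"
      using F_ge[of "- b" 0] F_ge[of 0 b] by (auto simp: b_def)
    then show ?thesis
      using IVT'[of F "- b" y b] continuous_on_subset[OF F_cont] by (auto simp: b_def)
  qed
  define G where "G = inv F"
  have GF: "G (F x) = x" for x
    unfolding G_def using strict_mono_imp_inj_on[OF F_mono] by simp
  have FG: "F (G y) = y" for y
    unfolding G_def by (rule f_inv_into_f) (metis F_surj rangeI)
  have G_mono: "mono G"
  proof (rule monoI)
    show "G y \<le> G z" if "y \<le> z" for y z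
      using that FG strict_mono_less_eq[OF F_mono, of "G y" "G z"] by simp
  qed
  have Gm[measurable]: "G \<in> borel_measurable borel"
    by (rule borel_measurable_mono[OF G_mono])
  define \<nu> where "\<nu> = distr lborel borel G"
  have sets\<nu>: "sets \<nu> = sets lborel" by (simp add: \<nu>_def)
  have vim: "G -` A = F ` A" for A
  proof (intro set_eqI iffI)
    show "y \<in> F ` A" if "y \<in> G -` A" for y
      using that FG[of y] by (intro image_eqI[of y F "G y"]) auto
  qed (auto simp: GF)
  have \<nu>_int: "emeasure \<nu> {a..b} = ennreal (F b - F a)" if "a \<le> b" for a b
  proof -
    have "G -` {a..b} = {F a..F b}"
    proof (intro set_eqI iffI)
      fix y assume "y \<in> G -` {a..b}"
      then show "y \<in> {F a..F b}"
        using strict_mono_less_eq[OF F_mono, of a "G y"] strict_mono_less_eq[OF F_mono, of "G y" b] by (simp add: FG)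
    next
      fix y assume "y \<in> {F a..F b}"
      then show "y \<in> G -` {a..b}"
        using strict_mono_less_eq[OF F_mono, of a "G y"] strict_mono_less_eq[OF F_mono, of "G y" b] by (simp add: FG)
    qed
    then show ?thesis
      using F_ge[OF that] that by (simp add: \<nu>_def emeasure_distr)
  qed
  \<comment> \<open>The preimage of a null set under \<open>G\<close> is its image under the
    Lipschitz function \<open>F\<close>, hence negligible; being Borel it is null for
    \<open>lborel\<close> and not only for the completion.\<close>
  have "absolutely_continuous lborel \<nu>"
    unfolding absolutely_continuous_def
  proof
    fix A :: "real set" assume A: "A \<in> null_sets lborel"
    then have Ab[measurable]: "A \<in> sets borel" by auto
    have "negligible A"
      using A null_sets_completionI[of A lborel] by (simp add: negligible_iff_null_sets)
    then have "negligible (F ` A)"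
    proof (rule negligible_locally_Lipschitz_image[rotated])
      show "\<exists>T B. open T \<and> x \<in> T \<and> (\<forall>y\<in>A \<inter> T. norm (F y - F x) \<le> B * norm (y - x))" for x
        using F_le by (intro exI[of _ UNIV] exI[of _ "2 * L + 1"]) auto
    qed simp
    then have "G -` A \<in> null_sets (completion lborel)"
      unfolding vim by (simp add: negligible_iff_null_sets)
    moreover have "G -` A \<in> sets lborel"
      using measurable_sets[OF Gm Ab] by simp
    ultimately have "emeasure lborel (G -` A) = 0"
      using null_sets_completion_iff[of "G -` A" lborel] by auto
    then show "A \<in> null_sets \<nu>"
      using Ab by (auto simp: \<nu>_def null_sets_def emeasure_distr)
  qed
  then obtain g where g[measurable]: "g \<in> borel_measurable lborel" and dens: "density lborel g = \<nu>"
    using sigma_finite_measure.Radon_Nikodym[OF sigma_finite_lborel _ sets\<nu>] by blast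
  have nn: "(\<integral>\<^sup>+x. g x * indicator {a..b} x \<partial>lborel) = ennreal (F b - F a)" if "a \<le> b" for a b
    using emeasure_density[OF g, of "{a..b}"] \<nu>_int[OF that] unfolding dens by simp
  have fin: "AE x in lborel. g x \<noteq> \<infinity>"
  proof -
    have "AE x in lborel. \<forall>n::nat. g x * indicator {- real n..real n} x \<noteq> \<infinity>"
      unfolding AE_all_countable
    proof
      fix n :: nat
      show "AE x in lborel. g x * indicator {- real n..real n} x \<noteq> \<infinity>"
        using nn[of "- real n" "real n"] by (intro nn_integral_PInf_AE) auto
    qed
    then show ?thesis
    proof eventually_elim
      case (elim x)
      obtain n :: nat where "\<bar>x\<bar> \<le> real n" using real_arch_simple by blast
      then show ?case using elim[rule_format, of n] by (auto simp: abs_le_iff)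
    qed
  qed
  define r where "r x = enn2real (g x)" for x
  have rm[measurable]: "r \<in> borel_measurable borel"
    unfolding r_def using g by simp
  have r_int: "(r has_integral (F b - F a)) {a..b}" if ab: "a \<le> b" for a b
  proof -
    have "(\<integral>\<^sup>+x. ennreal (r x * indicator {a..b} x) \<partial>lborel) = (\<integral>\<^sup>+x. g x * indicator {a..b} x \<partial>lborel)"
    proof (rule nn_integral_cong_AE)
      show "AE x in lborel. ennreal (r x * indicator {a..b} x) = g x * indicator {a..b} x"
        using fin
      proof eventually_elim
        case (elim x)
        then have "ennreal (r x) = g x" unfolding r_def by (simp add: ennreal_enn2real top.not_eq_extremum)
        then show ?case by (simp split: split_indicator)
      qed
    qed
    then have "(\<integral>\<^sup>+x. ennreal (r x * indicator {a..b} x) \<partial>lborel) = ennreal (F b - F a)"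
      using nn[OF ab] by simp
    then have "((\<lambda>x. r x * indicator {a..b} x) has_integral (F b - F a)) UNIV"
      using F_ge[OF ab] ab by (intro nn_integral_has_integral) (auto simp: r_def split: split_indicator)
    moreover have "(\<lambda>x. r x * indicator {a..b} x) = (\<lambda>x. if x \<in> {a..b} then r x else 0)"
      by (auto simp: fun_eq_iff)
    ultimately show ?thesis
      using has_integral_restrict_UNIV[of "{a..b}" r] by simp
  qed
  have "r integrable_on {a..b}" for a b
  proof (cases "a \<le> b")
    case True
    then show ?thesis using r_int by blast
  qed (simp add: integrable_on_empty)
  moreover have "F b - F a = integral {a..b} r" if "a \<le> b" for a b
    using r_int[OF that] by (simp add: integral_unique)
  ultimately obtain N where N: "negligible N" "\<And>x. x \<notin> N \<Longrightarrow> (F has_real_derivative r x) (at x)"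
    using indefinite_integral_AE_differentiable[of r F] by blast
  have "\<exists>D. (f has_real_derivative D) (at x)" if "x \<notin> N" for x
  proof -
    have "((\<lambda>t. F t - (L + 1) * t) has_real_derivative (r x - (L + 1) * 1)) (at x)"
      by (rule DERIV_diff[OF N(2)[OF that] DERIV_cmult[OF DERIV_ident]])
    then show ?thesis unfolding F_def by auto
  qed
  then show ?thesis by (rule that[OF N(1)])
qed

lemma clamp_lipschitz:
  fixes a b s t :: real
  shows "\<bar>max a (min b s) - max a (min b t)\<bar> \<le> \<bar>s - t\<bar>"
  by linarith

text \<open>Composition with the clamp to \<open>[1 / (n + 1), n + 1]\<close> makes \<open>f\<close>
  globally Lipschitz and leaves it unchanged inside that interval. The intervals exhaust the
  positive half-line, and countably many exceptional sets remain negligible.\<close>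

lemma locally_lipschitz_AE_differentiable:
  fixes f :: "real \<Rightarrow> real"
  assumes "\<And>a T. 0 < a \<Longrightarrow> a \<le> T \<Longrightarrow> \<exists>L. \<forall>s\<in>{a..T}. \<forall>t\<in>{a..T}. \<bar>f s - f t\<bar> \<le> L * \<bar>s - t\<bar>"
  shows "AE t in lborel. 0 < t \<longrightarrow> (\<exists>D. (f has_real_derivative D) (at t))"
proof -
  define c :: "nat \<Rightarrow> real \<Rightarrow> real" where "c n t = max (1 / real (Suc n)) (min (real (Suc n)) t)" for n t
  have c_lip: "\<bar>c n s - c n t\<bar> \<le> \<bar>s - t\<bar>" for n s t
    unfolding c_def by (rule clamp_lipschitz)
  have "\<exists>N. negligible N \<and> (\<forall>x. x \<notin> N \<longrightarrow> (\<exists>D. ((\<lambda>t. f (c n t)) has_real_derivative D) (at x)))" for n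
  proof -
    have "1 / real (Suc n) \<le> 1" "1 \<le> real (Suc n)" by simp_all
    then have le: "1 / real (Suc n) \<le> real (Suc n)" by (rule order_trans)
    have "0 < 1 / real (Suc n)" by simp
    then obtain L where L: "\<forall>s\<in>{1 / real (Suc n)..real (Suc n)}. \<forall>t\<in>{1 / real (Suc n)..real (Suc n)}.
        \<bar>f s - f t\<bar> \<le> L * \<bar>s - t\<bar>"
      using assms[OF _ le] by blast
    have cin: "c n t \<in> {1 / real (Suc n)..real (Suc n)}" for t
      unfolding c_def atLeastAtMost_iff using le by (intro conjI max.cobounded1 max.boundedI min.cobounded1)
    have "\<bar>f (c n s) - f (c n t)\<bar> \<le> \<bar>L\<bar> * \<bar>s - t\<bar>" for s t
    proof -
      have "\<bar>f (c n s) - f (c n t)\<bar> \<le> L * \<bar>c n s - c n t\<bar>" using L cin by blast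
      also have "\<dots> \<le> \<bar>L\<bar> * \<bar>s - t\<bar>" by (intro mult_mono c_lip) auto
      finally show ?thesis .
    qed
    from lipschitz_AE_differentiable[OF this] show ?thesis by blast
  qed
  then obtain N where N: "\<And>n. negligible (N n)"
    "\<And>n x. x \<notin> N n \<Longrightarrow> \<exists>D. ((\<lambda>t. f (c n t)) has_real_derivative D) (at x)"
    by metis
  have "negligible (\<Union>n. N n)"
    using N(1) by (intro negligible_countable_Union) auto
  then have "AE t in lebesgue. t \<notin> (\<Union>n. N n)"
    by (intro AE_not_in) (simp add: negligible_iff_null_sets)
  then have "AE t in lebesgue. 0 < t \<longrightarrow> (\<exists>D. (f has_real_derivative D) (at t))"
  proof eventually_elim
    case (elim t)
    show ?case
    proof
      assume t: "0 < t"
      obtain n0 :: nat where n0: "max t (1 / t) < real n0" using reals_Archimedean2 by blast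
      define n where "n = n0"
      have tn: "t < real (Suc n)" "1 / real (Suc n) < t"
      proof -
        have "t < real n0" "1 / t < real n0" using n0 by auto
        then have "t < real (Suc n)" "1 / t < real (Suc n)" unfolding n_def by simp_all
        then show "t < real (Suc n)" "1 / real (Suc n) < t" using t by (simp_all add: field_simps)
      qed
      obtain D where D: "((\<lambda>t. f (c n t)) has_real_derivative D) (at t)"
        using N(2)[of t n] elim by blast
      have "(f has_real_derivative D) (at t)"
      proof (rule has_field_derivative_transform_within_open[OF D])
        show "open {1 / real (Suc n)<..<real (Suc n)}" by simp
      qed (use tn in \<open>auto simp: c_def\<close>)
      then show "\<exists>D. (f has_real_derivative D) (at t)" by blast
    qed
  qed
  then show ?thesis by (simp add: AE_completion_iff)
qed

section \<open>Approximate gluing of couplings\<close>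

lemma PiM_coordinates_indep:
  fixes K :: "'i \<Rightarrow> 'b::topological_space measure"
  assumes "\<And>i. prob_space (K i)" and sets: "\<And>i. sets (K i) = sets borel"
  shows "prob_space.indep_vars (PiM UNIV K) (\<lambda>_. borel) (\<lambda>i \<omega>. \<omega> i) UNIV"
proof -
  interpret P: prob_space "PiM UNIV K" by (rule prob_space_PiM) (rule assms)
  have sets_eq: "sets (PiM UNIV (\<lambda>_::'i. borel :: 'b measure)) = sets (PiM UNIV K)"
    by (intro sets_PiM_cong) (auto simp: sets)
  have comp: "distr (PiM UNIV K) borel (\<lambda>\<omega>. \<omega> i) = K i" for i
  proof -
    have "distr (PiM UNIV K) borel (\<lambda>\<omega>. \<omega> i) = distr (PiM UNIV K) (K i) (\<lambda>\<omega>. \<omega> i)"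
      by (intro distr_cong) (auto simp: sets)
    also have "\<dots> = K i" using distr_PiM_component[of UNIV K i] assms by simp
    finally show ?thesis .
  qed
  have rv: "(\<lambda>\<omega>. \<omega> i) \<in> PiM UNIV K \<rightarrow>\<^sub>M borel" for i
    using measurable_component_singleton[of i UNIV K] by (simp cong: measurable_cong_sets add: sets)
  have "distr (PiM UNIV K) (PiM UNIV (\<lambda>_. borel)) (\<lambda>x. \<lambda>i\<in>UNIV. x i) = PiM UNIV (\<lambda>i. distr (PiM UNIV K) borel (\<lambda>\<omega>. \<omega> i))"
    using distr_id2[OF sets_eq] unfolding comp by (simp add: sets_eq restrict_UNIV)
  then show ?thesis
    using P.indep_vars_iff_distr_eq_PiM'[where I = UNIV and M' = "\<lambda>_. borel" and X = "\<lambda>i \<omega>. \<omega> i"] rv by simp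
qed

text \<open>Coordinate \<open>(Suc n, i)\<close> is a candidate for the next point, prepared for the
  case that the current point lies in cell \<open>i\<close>. The chain selects the candidate of the
  actual cell, so all candidates can be drawn independently in advance.\<close>

primrec cell_chain :: "(nat \<Rightarrow> 'b \<Rightarrow> nat) \<Rightarrow> nat \<Rightarrow> (nat \<times> nat \<Rightarrow> 'b) \<Rightarrow> 'b" where
  "cell_chain q 0 \<omega> = \<omega> (0, 0)"
| "cell_chain q (Suc n) \<omega> = \<omega> (Suc n, q n (cell_chain q n \<omega>))"

lemma cell_chain_measurable:
  fixes q :: "nat \<Rightarrow> 'b::topological_space \<Rightarrow> nat"
  assumes q: "\<And>n. q n \<in> borel \<rightarrow>\<^sub>M count_space UNIV" and A: "{..n} \<times> UNIV \<subseteq> A"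
  shows "cell_chain q n \<in> PiM A (\<lambda>_. borel) \<rightarrow>\<^sub>M borel"
  using A
proof (induction n)
  case 0
  then show ?case
    unfolding cell_chain.simps by (intro measurable_component_singleton) auto
next
  case (Suc n)
  have IH: "cell_chain q n \<in> PiM A (\<lambda>_. borel) \<rightarrow>\<^sub>M borel"
    using Suc.prems by (intro Suc.IH) force
  have "(\<lambda>\<omega>. \<omega> (Suc n, i)) \<in> PiM A (\<lambda>_. borel) \<rightarrow>\<^sub>M borel" for i
    using Suc.prems by (intro measurable_component_singleton) auto
  moreover have "(\<lambda>\<omega>. q n (cell_chain q n \<omega>)) \<in> PiM A (\<lambda>_. borel) \<rightarrow>\<^sub>M count_space UNIV"
    by (rule measurable_compose[OF IH q])
  ultimately show ?case
    unfolding cell_chain.simps by (rule measurable_compose_countable)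
qed

lemma cell_chain_restrict:
  "{..n} \<times> UNIV \<subseteq> A \<Longrightarrow> cell_chain q n (restrict \<omega> A) = cell_chain q n \<omega>"
proof (induction n)
  case (Suc n)
  have "{..n} \<times> UNIV \<subseteq> A" using Suc.prems by force
  then show ?case using Suc by auto
qed auto

text \<open>The chain up to \<open>n\<close> reads only coordinates with first index at most
  \<open>n\<close>. The candidate \<open>(Suc n, i)\<close> belongs to a disjoint index set and is
  independent of it.\<close>

lemma cell_chain_indep:
  fixes K :: "nat \<times> nat \<Rightarrow> 'b::topological_space measure"
  assumes q: "\<And>n. q n \<in> borel \<rightarrow>\<^sub>M count_space UNIV"
    and K: "\<And>i. prob_space (K i)" "\<And>i. sets (K i) = sets borel" and B: "B \<in> sets borel"
  shows "emeasure (PiM UNIV K) {\<omega>. q n (cell_chain q n \<omega>) = i \<and> \<omega> (Suc n, i) \<in> B} =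
    emeasure (PiM UNIV K) {\<omega>. q n (cell_chain q n \<omega>) = i} * emeasure (K (Suc n, i)) B"
proof -
  interpret P: prob_space "PiM UNIV K" by (rule prob_space_PiM) (rule K)
  interpret Ki: prob_space "K (Suc n, i)" by (rule K)
  have space: "space (PiM UNIV K) = UNIV"
    using sets_eq_imp_space_eq[OF K(2)] by (auto simp: space_PiM)
  let ?A = "{..n} \<times> (UNIV :: nat set)" and ?C = "{(Suc n, i)}"
  define U where "U = {\<omega> \<in> space (PiM ?A (\<lambda>_. borel :: 'b measure)). q n (cell_chain q n \<omega>) = i}"
  define V where "V = {\<omega> \<in> space (PiM ?C (\<lambda>_. borel :: 'b measure)). \<omega> (Suc n, i) \<in> B}"
  have U: "U \<in> sets (PiM ?A (\<lambda>_. borel))"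
  proof -
    have "(\<lambda>\<omega>. q n (cell_chain q n \<omega>)) \<in> PiM ?A (\<lambda>_. borel) \<rightarrow>\<^sub>M count_space UNIV"
      by (rule measurable_compose[OF cell_chain_measurable[OF q] q]) simp
    then show ?thesis unfolding U_def by measurable
  qed
  have V: "V \<in> sets (PiM ?C (\<lambda>_. borel))"
  proof -
    have "(\<lambda>\<omega>. \<omega> (Suc n, i)) \<in> PiM ?C (\<lambda>_. borel :: 'b measure) \<rightarrow>\<^sub>M borel"
      by (rule measurable_component_singleton) simp
    from measurable_sets[OF this B] show ?thesis
      by (simp add: V_def vimage_def Int_def conj_commute)
  qed
  have "P.indep_var (PiM ?A (\<lambda>_. borel)) (\<lambda>\<omega>. restrict (\<lambda>i. \<omega> i) ?A) (PiM ?C (\<lambda>_. borel)) (\<lambda>\<omega>. restrict (\<lambda>i. \<omega> i) ?C)"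
    by (rule P.indep_var_restrict[OF PiM_coordinates_indep[OF K]]) auto
  from P.indep_varD[OF this U V] have *:
    "P.prob ((\<lambda>\<omega>. (restrict \<omega> ?A, restrict \<omega> ?C)) -` (U \<times> V) \<inter> UNIV) =
      P.prob ((\<lambda>\<omega>. restrict \<omega> ?A) -` U \<inter> UNIV) * P.prob ((\<lambda>\<omega>. restrict \<omega> ?C) -` V \<inter> UNIV)"
    unfolding space .
  have 1: "(\<lambda>\<omega>. restrict \<omega> ?A) -` U = {\<omega>. q n (cell_chain q n \<omega>) = i}"
    by (auto simp: U_def space_PiM cell_chain_restrict)
  have 2: "(\<lambda>\<omega>. restrict \<omega> ?C) -` V = {\<omega>. \<omega> (Suc n, i) \<in> B}"
    by (auto simp: V_def space_PiM)
  have 3: "(\<lambda>\<omega>. (restrict \<omega> ?A, restrict \<omega> ?C)) -` (U \<times> V) = {\<omega>. q n (cell_chain q n \<omega>) = i \<and> \<omega> (Suc n, i) \<in> B}"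
    using 1 2 by auto
  have 4: "P.prob {\<omega>. \<omega> (Suc n, i) \<in> B} = Ki.prob B"
  proof -
    have "distr (PiM UNIV K) (K (Suc n, i)) (\<lambda>\<omega>. \<omega> (Suc n, i)) = K (Suc n, i)"
      by (rule distr_PiM_component) (auto simp: K)
    then have "Ki.prob B = measure (distr (PiM UNIV K) (K (Suc n, i)) (\<lambda>\<omega>. \<omega> (Suc n, i))) B" by simp
    also have "\<dots> = P.prob {\<omega>. \<omega> (Suc n, i) \<in> B}"
      using B measurable_component_singleton[of "(Suc n, i)" UNIV K]
      by (subst measure_distr) (auto simp: K space vimage_def)
    finally show ?thesis by simp
  qed
  show ?thesis
    using * unfolding Int_UNIV_right 1 2 3 4
    by (simp add: P.emeasure_eq_measure Ki.emeasure_eq_measure ennreal_mult)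
qed

text \<open>The conditional law of the second component given that the first lies in cell
  \<open>i\<close>. On cells of measure zero a Dirac mass stands in, so that every factor of the
  product space is a probability measure.\<close>

definition cell_kernel :: "('b::{topological_space,zero} \<times> 'b) measure \<Rightarrow> ('b \<Rightarrow> nat) \<Rightarrow> nat \<Rightarrow> 'b measure" where
  "cell_kernel \<gamma> q i = (if emeasure \<gamma> {p. q (fst p) = i} = 0 then return borel 0
     else distr (uniform_measure \<gamma> {p. q (fst p) = i}) borel snd)"

lemma cell_kernel:
  fixes \<gamma> :: "('b::euclidean_space \<times> 'b) measure"
  assumes "prob_space \<gamma>" and s: "sets \<gamma> = sets borel" and q: "q \<in> borel \<rightarrow>\<^sub>M count_space UNIV"
  shows "prob_space (cell_kernel \<gamma> q i)" "sets (cell_kernel \<gamma> q i) = sets borel"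
    and "B \<in> sets borel \<Longrightarrow> emeasure \<gamma> {p. q (fst p) = i} * emeasure (cell_kernel \<gamma> q i) B =
      emeasure \<gamma> {p. q (fst p) = i \<and> snd p \<in> B}"
proof -
  interpret prob_space \<gamma> by fact
  have sp: "space \<gamma> = UNIV" using sets_eq_imp_space_eq[OF s] by simp
  have fst_m: "fst \<in> \<gamma> \<rightarrow>\<^sub>M borel" and snd_m[measurable]: "snd \<in> \<gamma> \<rightarrow>\<^sub>M borel"
    using s by (auto simp: measurable_cong_sets[OF s refl] borel_prod[symmetric])
  have qf[measurable]: "(\<lambda>p. q (fst p)) \<in> \<gamma> \<rightarrow>\<^sub>M count_space UNIV"
    by (rule measurable_compose[OF fst_m q])
  let ?S = "{p. q (fst p) = i}"
  have S: "?S \<in> sets \<gamma>"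
    using measurable_sets[OF qf, of "{i}"] by (simp add: sp vimage_def)
  show "sets (cell_kernel \<gamma> q i) = sets borel" by (simp add: cell_kernel_def)
  show "prob_space (cell_kernel \<gamma> q i)"
  proof (cases "emeasure \<gamma> ?S = 0")
    case True
    then show ?thesis by (simp add: cell_kernel_def prob_space_return)
  next
    case False
    then interpret u: prob_space "uniform_measure \<gamma> ?S"
      by (intro prob_space_uniform_measure) auto
    have "snd \<in> uniform_measure \<gamma> ?S \<rightarrow>\<^sub>M borel" using snd_m by simp
    then show ?thesis using False by (simp add: cell_kernel_def u.prob_space_distr)
  qed
  assume B: "B \<in> sets borel"
  have SB: "snd -` B \<in> sets \<gamma>" using measurable_sets[OF snd_m B] by (simp add: sp)
  have eq: "{p. q (fst p) = i \<and> snd p \<in> B} = ?S \<inter> snd -` B" by auto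
  show "emeasure \<gamma> ?S * emeasure (cell_kernel \<gamma> q i) B = emeasure \<gamma> {p. q (fst p) = i \<and> snd p \<in> B}"
  proof (cases "emeasure \<gamma> ?S = 0")
    case True
    then have "emeasure \<gamma> (?S \<inter> snd -` B) = 0"
      using S emeasure_mono[of "?S \<inter> snd -` B" ?S \<gamma>] by simp
    then show ?thesis using True eq by simp
  next
    case False
    have "emeasure (cell_kernel \<gamma> q i) B = emeasure (uniform_measure \<gamma> ?S) (snd -` B)"
      using False B snd_m by (simp add: cell_kernel_def emeasure_distr sp)
    also have "\<dots> = emeasure \<gamma> (?S \<inter> snd -` B) / emeasure \<gamma> ?S"
      by (rule emeasure_uniform_measure[OF S SB])
    finally have "emeasure \<gamma> ?S * emeasure (cell_kernel \<gamma> q i) B = emeasure \<gamma> (?S \<inter> snd -` B) * emeasure \<gamma> ?S / emeasure \<gamma> ?S"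
      by (simp add: ennreal_times_divide mult.commute)
    also have "\<dots> = emeasure \<gamma> (?S \<inter> snd -` B)"
      using False by (intro ennreal_mult_divide_eq) auto
    finally show ?thesis unfolding eq .
  qed
qed

lemma exists_cells:
  assumes "0 < (\<epsilon>::real)"
  shows "\<exists>q c. q \<in> borel \<rightarrow>\<^sub>M count_space UNIV \<and> (\<forall>x::'b::euclidean_space. dist x (c (q x :: nat)) < \<epsilon>)"
proof -
  obtain S :: "'b set" where S: "countable S" "\<And>X. open X \<Longrightarrow> X \<noteq> {} \<Longrightarrow> \<exists>d\<in>S. d \<in> X"
    using countable_dense_setE by blast
  have ne: "S \<noteq> {}" using S(2)[of UNIV] by auto
  define c where "c = from_nat_into S"
  have ex: "\<exists>k. dist x (c k) < \<epsilon>" for x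
  proof -
    obtain s where "s \<in> S" "s \<in> ball x \<epsilon>" using S(2)[of "ball x \<epsilon>"] assms by auto
    then show ?thesis using from_nat_into_surj[OF S(1), of s] by (auto simp: c_def)
  qed
  define q where "q x = (LEAST k. dist x (c k) < \<epsilon>)" for x
  have "q \<in> borel \<rightarrow>\<^sub>M count_space UNIV" unfolding q_def by measurable
  moreover have "dist x (c (q x)) < \<epsilon>" for x unfolding q_def by (rule LeastI_ex[OF ex])
  ultimately show ?thesis by blast
qed

text \<open>The hypothesis says that \<open>Y\<close> restricted to \<open>U\<close> and
  \<open>Z\<close> restricted to \<open>V\<close> push the two measures forward to the same measure;
  densities by indicators express the restriction.\<close>

lemma nn_integral_eq_of_joint_law:
  assumes [measurable]: "U \<in> sets P" "V \<in> sets Q" "Y \<in> P \<rightarrow>\<^sub>M N" "Z \<in> Q \<rightarrow>\<^sub>M N" "h \<in> borel_measurable N"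
    and eq: "\<And>B. B \<in> sets N \<Longrightarrow> emeasure P {\<omega>\<in>space P. \<omega> \<in> U \<and> Y \<omega> \<in> B} = emeasure Q {\<omega>\<in>space Q. \<omega> \<in> V \<and> Z \<omega> \<in> B}"
  shows "(\<integral>\<^sup>+\<omega>. indicator U \<omega> * h (Y \<omega>) \<partial>P) = (\<integral>\<^sup>+\<omega>. indicator V \<omega> * h (Z \<omega>) \<partial>Q)"
proof -
  have "distr (density P (indicator U)) N Y = distr (density Q (indicator V)) N Z"
  proof (rule measure_eqI)
    fix B assume "B \<in> sets (distr (density P (indicator U)) N Y)"
    then have B[measurable]: "B \<in> sets N" by simp
    have "emeasure (distr (density P (indicator U)) N Y) B = (\<integral>\<^sup>+\<omega>. indicator U \<omega> * indicator (Y -` B \<inter> space P) \<omega> \<partial>P)"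
      by (simp add: emeasure_distr emeasure_density)
    also have "\<dots> = (\<integral>\<^sup>+\<omega>. indicator {\<omega>\<in>space P. \<omega> \<in> U \<and> Y \<omega> \<in> B} \<omega> \<partial>P)"
      by (rule nn_integral_cong) (auto split: split_indicator)
    also have "\<dots> = emeasure P {\<omega>\<in>space P. \<omega> \<in> U \<and> Y \<omega> \<in> B}"
      by (intro nn_integral_indicator) measurable
    also have "\<dots> = emeasure Q {\<omega>\<in>space Q. \<omega> \<in> V \<and> Z \<omega> \<in> B}" by (rule eq[OF B])
    also have "\<dots> = (\<integral>\<^sup>+\<omega>. indicator {\<omega>\<in>space Q. \<omega> \<in> V \<and> Z \<omega> \<in> B} \<omega> \<partial>Q)"
      by (intro nn_integral_indicator[symmetric]) measurable
    also have "\<dots> = (\<integral>\<^sup>+\<omega>. indicator V \<omega> * indicator (Z -` B \<inter> space Q) \<omega> \<partial>Q)"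
      by (rule nn_integral_cong) (auto split: split_indicator)
    also have "\<dots> = emeasure (distr (density Q (indicator V)) N Z) B"
      by (simp add: emeasure_distr emeasure_density)
    finally show "emeasure (distr (density P (indicator U)) N Y) B = emeasure (distr (density Q (indicator V)) N Z) B" .
  qed simp
  then have "(\<integral>\<^sup>+y. h y \<partial>distr (density P (indicator U)) N Y) = (\<integral>\<^sup>+y. h y \<partial>distr (density Q (indicator V)) N Z)" by simp
  then show ?thesis by (simp add: nn_integral_distr nn_integral_density)
qed

lemma nn_integral_split_nat:
  fixes f :: "'c \<Rightarrow> ennreal" and k :: "'c \<Rightarrow> nat"
  assumes [measurable]: "k \<in> P \<rightarrow>\<^sub>M count_space UNIV" "f \<in> borel_measurable P"
  shows "(\<integral>\<^sup>+\<omega>. f \<omega> \<partial>P) = (\<Sum>i. \<integral>\<^sup>+\<omega>. indicator {\<omega>\<in>space P. k \<omega> = i} \<omega> * f \<omega> \<partial>P)"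
proof -
  have "(\<integral>\<^sup>+\<omega>. f \<omega> \<partial>P) = (\<integral>\<^sup>+\<omega>. (\<Sum>i. indicator {\<omega>\<in>space P. k \<omega> = i} \<omega> * f \<omega>) \<partial>P)"
  proof (rule nn_integral_cong)
    fix \<omega> assume w: "\<omega> \<in> space P"
    have "(\<Sum>i. indicator {\<omega>\<in>space P. k \<omega> = i} \<omega> * f \<omega>) = (\<Sum>i\<in>{k \<omega>}. indicator {\<omega>\<in>space P. k \<omega> = i} \<omega> * f \<omega>)"
      by (rule suminf_finite) auto
    then show "f \<omega> = (\<Sum>i. indicator {\<omega>\<in>space P. k \<omega> = i} \<omega> * f \<omega>)" using w by simp
  qed
  also have "\<dots> = (\<Sum>i. \<integral>\<^sup>+\<omega>. indicator {\<omega>\<in>space P. k \<omega> = i} \<omega> * f \<omega> \<partial>P)"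
    by (intro nn_integral_suminf) measurable
  finally show ?thesis .
qed

lemma couplingD:
  assumes "\<gamma> \<in> couplings \<mu> \<nu>"
  shows "prob_space \<gamma>" "sets \<gamma> = sets borel" "space \<gamma> = UNIV" "distr \<gamma> borel fst = \<mu>" "distr \<gamma> borel snd = \<nu>"
    "fst \<in> \<gamma> \<rightarrow>\<^sub>M borel" "snd \<in> \<gamma> \<rightarrow>\<^sub>M borel"
    "prob_space \<mu>" "sets \<mu> = sets borel" "prob_space \<nu>" "sets \<nu> = sets borel"
proof -
  show c: "prob_space \<gamma>" "sets \<gamma> = sets borel" "distr \<gamma> borel fst = \<mu>" "distr \<gamma> borel snd = \<nu>"
    using assms by (auto simp: couplings_def)
  show "space \<gamma> = UNIV" using sets_eq_imp_space_eq[OF c(2)] by simp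
  show m: "fst \<in> \<gamma> \<rightarrow>\<^sub>M borel" "snd \<in> \<gamma> \<rightarrow>\<^sub>M borel"
    using c(2) by (auto simp: measurable_cong_sets[OF c(2) refl] borel_prod[symmetric])
  interpret prob_space \<gamma> by fact
  show "prob_space \<mu>" "prob_space \<nu>" "sets \<mu> = sets borel" "sets \<nu> = sets borel"
    using prob_space_distr[OF m(1)] prob_space_distr[OF m(2)] c by auto
qed

lemma sq_dist_le2:
  fixes x y z :: "'b::metric_space"
  shows "(dist x z)\<^sup>2 \<le> 2 * (dist x y)\<^sup>2 + 2 * (dist y z)\<^sup>2"
proof -
  have "(dist x z)\<^sup>2 \<le> (dist x y + dist y z)\<^sup>2"
    by (intro power_mono dist_triangle) auto
  also have "\<dots> \<le> 2 * (dist x y)\<^sup>2 + 2 * (dist y z)\<^sup>2"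
    using zero_le_power2[of "dist x y - dist y z"] by (simp add: power2_eq_square algebra_simps)
  finally show ?thesis .
qed

text \<open>Gluing of couplings up to a small error. Given the cell of \<open>X n\<close>, the next point is drawn from
  the second marginal of the coupling conditioned on that cell, so that no disintegration is needed.\<close>

lemma chain_realization:
  fixes M :: "nat \<Rightarrow> 'a::euclidean_space measure"
  assumes \<gamma>: "\<And>n. \<gamma> n \<in> couplings (M n) (M (Suc n))" and \<epsilon>: "\<And>n. 0 < \<epsilon> n"
  shows "\<exists>(P :: (nat \<times> nat \<Rightarrow> 'a) measure) X. prob_space P \<and>
    (\<forall>n. X n \<in> P \<rightarrow>\<^sub>M borel) \<and> (\<forall>n. distr P borel (X n) = M n) \<and>
    (\<forall>n. (\<integral>\<^sup>+\<omega>. ennreal ((dist (X n \<omega>) (X (Suc n) \<omega>))\<^sup>2) \<partial>P) \<le> 6 * ennreal ((\<epsilon> n)\<^sup>2) + 4 * tcost (\<gamma> n))"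
proof -
  note c = couplingD[OF \<gamma>]
  obtain q c where q: "\<And>n. q n \<in> borel \<rightarrow>\<^sub>M count_space UNIV"
    and qc: "\<And>n (x::'a). dist x (c n (q n x :: nat)) < \<epsilon> n"
    using exists_cells[OF \<epsilon>, where 'b = 'a] by metis
  define K where "K = (\<lambda>(n, i). case n of 0 \<Rightarrow> M 0 | Suc m \<Rightarrow> cell_kernel (\<gamma> m) (q m) i)"
  have K: "prob_space (K j)" "sets (K j) = sets borel" for j
    using c(8)[of 0] c(9)[of 0] cell_kernel(1,2)[OF c(1) c(2) q]
    by (auto simp: K_def split: prod.split nat.split)
  define P where "P = PiM UNIV K"
  interpret P: prob_space P unfolding P_def by (rule prob_space_PiM) (rule K)
  have space: "space P = UNIV"
    using sets_eq_imp_space_eq[OF K(2)] by (auto simp: P_def space_PiM)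
  have setsP: "sets P = sets (PiM UNIV (\<lambda>_. borel))"
    unfolding P_def by (intro sets_PiM_cong) (auto simp: K)
  define X where "X = cell_chain q"
  have X[measurable]: "X n \<in> P \<rightarrow>\<^sub>M borel" for n
    using cell_chain_measurable[OF q, of n UNIV] unfolding X_def by (simp add: measurable_cong_sets[OF setsP refl])
  have coord[measurable]: "(\<lambda>\<omega>. \<omega> j) \<in> P \<rightarrow>\<^sub>M borel" for j
    using measurable_component_singleton[of j UNIV "\<lambda>_. borel"] by (simp add: measurable_cong_sets[OF setsP refl])
  have qX[measurable]: "(\<lambda>\<omega>. q n (X n \<omega>)) \<in> P \<rightarrow>\<^sub>M count_space UNIV" for n
    by (rule measurable_compose[OF X q])
  have qf[measurable]: "(\<lambda>p. q n (fst p)) \<in> \<gamma> n \<rightarrow>\<^sub>M count_space UNIV" for n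
    by (rule measurable_compose[OF c(6) q])
  \<comment> \<open>The pair of the cell of \<open>X n\<close> and the point
    \<open>X (Suc n)\<close> has the joint law that \<gamma> prescribes for the cell of the first
    component and the second component. The position inside the cell is not matched, so the cost is
    later compared through the cell centre.\<close>
  have step: "(\<integral>\<^sup>+\<omega>. h (q n (X n \<omega>)) (X (Suc n) \<omega>) \<partial>P) = (\<integral>\<^sup>+p. h (q n (fst p)) (snd p) \<partial>\<gamma> n)"
    if law: "distr P borel (X n) = M n" and h: "\<And>i. h i \<in> borel_measurable borel" for h n
  proof -
    have m1: "(\<lambda>\<omega>. h (q n (X n \<omega>)) (X (Suc n) \<omega>)) \<in> borel_measurable P"
      by (rule measurable_compose_countable[OF measurable_compose[OF X h] qX])
    have m2: "(\<lambda>p. h (q n (fst p)) (snd p)) \<in> borel_measurable (\<gamma> n)"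
      by (rule measurable_compose_countable[OF measurable_compose[OF c(7) h] qf])
    have "(\<integral>\<^sup>+\<omega>. indicator {\<omega>\<in>space P. q n (X n \<omega>) = i} \<omega> * h (q n (X n \<omega>)) (X (Suc n) \<omega>) \<partial>P) =
        (\<integral>\<^sup>+p. indicator {p\<in>space (\<gamma> n). q n (fst p) = i} p * h (q n (fst p)) (snd p) \<partial>\<gamma> n)" for i
    proof -
      have "(\<integral>\<^sup>+\<omega>. indicator {\<omega>\<in>space P. q n (X n \<omega>) = i} \<omega> * h (q n (X n \<omega>)) (X (Suc n) \<omega>) \<partial>P) =
        (\<integral>\<^sup>+\<omega>. indicator {\<omega>\<in>space P. q n (X n \<omega>) = i} \<omega> * h i (\<omega> (Suc n, i)) \<partial>P)"
        by (intro nn_integral_cong) (auto simp: X_def split: split_indicator)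
      also have "\<dots> = (\<integral>\<^sup>+p. indicator {p\<in>space (\<gamma> n). q n (fst p) = i} p * h i (snd p) \<partial>\<gamma> n)"
      proof (rule nn_integral_eq_of_joint_law[OF _ _ coord c(7) h])
        show "{\<omega> \<in> space P. q n (X n \<omega>) = i} \<in> sets P" by measurable
        show "{p \<in> space (\<gamma> n). q n (fst p) = i} \<in> sets (\<gamma> n)" by measurable
        fix B :: "'a set" assume B: "B \<in> sets borel"
        have "emeasure P {\<omega>. q n (X n \<omega>) = i} = emeasure (distr P borel (X n)) {x. q n x = i}"
        proof (subst emeasure_distr)
          show "{x. q n x = i} \<in> sets borel"
            using measurable_sets[OF q[of n], of "{i}"] by (simp add: vimage_def)
        qed (auto simp: space vimage_def)
        also have "\<dots> = emeasure (distr (\<gamma> n) borel fst) {x. q n x = i}"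
          unfolding law c(4) ..
        also have "\<dots> = emeasure (\<gamma> n) {p. q n (fst p) = i}"
        proof (subst emeasure_distr[OF c(6)])
          show "{x. q n x = i} \<in> sets borel"
            using measurable_sets[OF q[of n], of "{i}"] by (simp add: vimage_def)
        qed (auto simp: c(3) vimage_def)
        finally have "emeasure P {\<omega>. q n (X n \<omega>) = i} * emeasure (K (Suc n, i)) B =
            emeasure (\<gamma> n) {p. q n (fst p) = i \<and> snd p \<in> B}"
          using cell_kernel(3)[OF c(1) c(2) q B] by (simp add: K_def)
        then show "emeasure P {\<omega> \<in> space P. \<omega> \<in> {\<omega> \<in> space P. q n (X n \<omega>) = i} \<and> \<omega> (Suc n, i) \<in> B} =
          emeasure (\<gamma> n) {p \<in> space (\<gamma> n). p \<in> {p \<in> space (\<gamma> n). q n (fst p) = i} \<and> snd p \<in> B}"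
          using cell_chain_indep[of q K B n i, OF q K B, folded P_def] by (simp add: space c(3) X_def)
      qed
      also have "\<dots> = (\<integral>\<^sup>+p. indicator {p\<in>space (\<gamma> n). q n (fst p) = i} p * h (q n (fst p)) (snd p) \<partial>\<gamma> n)"
        by (intro nn_integral_cong) (auto split: split_indicator)
      finally show ?thesis .
    qed
    then have "(\<Sum>i. \<integral>\<^sup>+\<omega>. indicator {\<omega>\<in>space P. q n (X n \<omega>) = i} \<omega> * h (q n (X n \<omega>)) (X (Suc n) \<omega>) \<partial>P) =
        (\<Sum>i. \<integral>\<^sup>+p. indicator {p\<in>space (\<gamma> n). q n (fst p) = i} p * h (q n (fst p)) (snd p) \<partial>\<gamma> n)"
      by presburger
    then show ?thesis
      by (rule trans[OF nn_integral_split_nat[OF qX m1] trans[OF _ nn_integral_split_nat[OF qf m2, symmetric]]])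
  qed
  have law: "distr P borel (X n) = M n" for n
  proof (induction n)
    case 0
    have "distr P borel (X 0) = distr P (K (0, 0)) (\<lambda>\<omega>. \<omega> (0, 0))"
      by (intro distr_cong) (auto simp: X_def K)
    also have "\<dots> = K (0, 0)" unfolding P_def by (rule distr_PiM_component) (auto simp: K)
    finally show ?case by (simp add: K_def)
  next
    case (Suc n)
    show ?case
    proof (rule measure_eqI)
      show "sets (distr P borel (X (Suc n))) = sets (M (Suc n))" using c(11)[of n] by simp
      fix B assume "B \<in> sets (distr P borel (X (Suc n)))"
      then have B[measurable]: "B \<in> sets borel" by simp
      have "emeasure (distr P borel (X (Suc n))) B = (\<integral>\<^sup>+x. indicator B x \<partial>distr P borel (X (Suc n)))"
        by simp
      also have "\<dots> = (\<integral>\<^sup>+\<omega>. indicator B (X (Suc n) \<omega>) \<partial>P)"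
        by (rule nn_integral_distr) auto
      also have "\<dots> = (\<integral>\<^sup>+p. indicator B (snd p) \<partial>\<gamma> n)"
        using step[OF Suc, of "\<lambda>_. indicator B"] by simp
      also have "\<dots> = (\<integral>\<^sup>+x. indicator B x \<partial>distr (\<gamma> n) borel snd)"
        by (rule nn_integral_distr[OF c(7), symmetric]) auto
      also have "\<dots> = emeasure (M (Suc n)) B" using c(5)[of n] c(11)[of n] by simp
      finally show "emeasure (distr P borel (X (Suc n))) B = emeasure (M (Suc n)) B" .
    qed
  qed
  \<comment> \<open>The cell centre is inserted twice, once for \<open>X n\<close> and once for the
    first component of \<gamma>. Each time \<open>(a + b)^2 \<le> 2 * a^2 + 2 * b^2\<close> is used,
    and \<open>2 + 2 * 2 = 6\<close>, \<open>2 * 2 = 4\<close> are the constants.\<close>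
  have cost: "(\<integral>\<^sup>+\<omega>. ennreal ((dist (X n \<omega>) (X (Suc n) \<omega>))\<^sup>2) \<partial>P) \<le> 6 * ennreal ((\<epsilon> n)\<^sup>2) + 4 * tcost (\<gamma> n)" for n
  proof -
    interpret G: prob_space "\<gamma> n" by (rule c(1))
    define h where "h i y = ennreal ((dist (c n i) y)\<^sup>2)" for i y
    have h[measurable]: "h i \<in> borel_measurable borel" for i unfolding h_def by measurable
    have hX: "(\<lambda>\<omega>. h (q n (X n \<omega>)) (X (Suc n) \<omega>)) \<in> borel_measurable P"
      by (rule measurable_compose_countable[OF measurable_compose[OF X h] qX])
    have d_m: "(\<lambda>p. ennreal ((dist (fst p) (snd p))\<^sup>2)) \<in> borel_measurable (\<gamma> n)"
      using c(6,7) by measurable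
    have *: "ennreal (2 * a\<^sup>2 + 2 * b\<^sup>2) = 2 * ennreal (a\<^sup>2) + 2 * ennreal (b\<^sup>2)" for a b :: real
      by (simp add: ennreal_plus ennreal_mult' flip: ennreal_numeral)
    have "(\<integral>\<^sup>+\<omega>. ennreal ((dist (X n \<omega>) (X (Suc n) \<omega>))\<^sup>2) \<partial>P)
        \<le> (\<integral>\<^sup>+\<omega>. 2 * ennreal ((\<epsilon> n)\<^sup>2) + 2 * h (q n (X n \<omega>)) (X (Suc n) \<omega>) \<partial>P)"
    proof (rule nn_integral_mono)
      fix \<omega>
      have "(dist (X n \<omega>) (c n (q n (X n \<omega>))))\<^sup>2 \<le> (\<epsilon> n)\<^sup>2"
        using qc[of "X n \<omega>" n] by (intro power_mono) auto
      then have "(dist (X n \<omega>) (X (Suc n) \<omega>))\<^sup>2 \<le> 2 * (\<epsilon> n)\<^sup>2 + 2 * (dist (c n (q n (X n \<omega>))) (X (Suc n) \<omega>))\<^sup>2"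
        using sq_dist_le2[of "X n \<omega>" "X (Suc n) \<omega>" "c n (q n (X n \<omega>))"] by linarith
      then show "ennreal ((dist (X n \<omega>) (X (Suc n) \<omega>))\<^sup>2) \<le> 2 * ennreal ((\<epsilon> n)\<^sup>2) + 2 * h (q n (X n \<omega>)) (X (Suc n) \<omega>)"
        unfolding h_def *[symmetric] by (rule ennreal_leI)
    qed
    also have "\<dots> = 2 * ennreal ((\<epsilon> n)\<^sup>2) + 2 * (\<integral>\<^sup>+\<omega>. h (q n (X n \<omega>)) (X (Suc n) \<omega>) \<partial>P)"
      using hX by (simp add: nn_integral_add nn_integral_cmult P.emeasure_space_1)
    also have "(\<integral>\<^sup>+\<omega>. h (q n (X n \<omega>)) (X (Suc n) \<omega>) \<partial>P) = (\<integral>\<^sup>+p. h (q n (fst p)) (snd p) \<partial>\<gamma> n)"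
      by (rule step[OF law h])
    also have "\<dots> \<le> (\<integral>\<^sup>+p. 2 * ennreal ((\<epsilon> n)\<^sup>2) + 2 * ennreal ((dist (fst p) (snd p))\<^sup>2) \<partial>\<gamma> n)"
    proof (rule nn_integral_mono)
      fix p :: "'a \<times> 'a"
      have "(dist (c n (q n (fst p))) (fst p))\<^sup>2 \<le> (\<epsilon> n)\<^sup>2"
        using qc[of "fst p" n] by (intro power_mono) (auto simp: dist_commute)
      then have "(dist (c n (q n (fst p))) (snd p))\<^sup>2 \<le> 2 * (\<epsilon> n)\<^sup>2 + 2 * (dist (fst p) (snd p))\<^sup>2"
        using sq_dist_le2[of "c n (q n (fst p))" "snd p" "fst p"] by linarith
      then show "h (q n (fst p)) (snd p) \<le> 2 * ennreal ((\<epsilon> n)\<^sup>2) + 2 * ennreal ((dist (fst p) (snd p))\<^sup>2)"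
        unfolding h_def *[symmetric] by (rule ennreal_leI)
    qed
    also have "\<dots> = 2 * ennreal ((\<epsilon> n)\<^sup>2) + 2 * tcost (\<gamma> n)"
      using d_m by (simp add: nn_integral_add nn_integral_cmult G.emeasure_space_1 tcost_def)
    finally have "(\<integral>\<^sup>+\<omega>. ennreal ((dist (X n \<omega>) (X (Suc n) \<omega>))\<^sup>2) \<partial>P)
        \<le> 2 * ennreal ((\<epsilon> n)\<^sup>2) + 2 * (2 * ennreal ((\<epsilon> n)\<^sup>2) + 2 * tcost (\<gamma> n))"
      by (simp add: mult_left_mono add_left_mono)
    also have "\<dots> = 6 * ennreal ((\<epsilon> n)\<^sup>2) + 4 * tcost (\<gamma> n)"
      by (simp add: distrib_left mult.assoc[symmetric] add.assoc[symmetric] flip: distrib_right)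
    finally show ?thesis .
  qed
  show ?thesis
    using P.prob_space_axioms X law cost by blast
qed

lemma geometric_steps_limit:
  fixes x :: "nat \<Rightarrow> 'b::banach"
  assumes st: "\<And>k. dist (x k) (x (Suc k)) \<le> s / 2 ^ k"
  shows "dist (x n) (lim x) \<le> 2 * s / 2 ^ n"
proof -
  have s: "0 \<le> s" using order_trans[OF zero_le_dist st[of 0]] by simp
  define r where "r k = 2 * s / 2 ^ k" for k :: nat
  have r_nonneg: "0 \<le> r k" for k using s by (simp add: r_def)
  have r_Suc: "s / 2 ^ k = r k - r (Suc k)" for k by (simp add: r_def)
  have le: "dist (x n) (x (n + m)) \<le> r n - r (n + m)" for n m
  proof (induction m)
    case (Suc m)
    show ?case
      using dist_triangle[of "x n" "x (n + Suc m)" "x (n + m)"] st[of "n + m"] Suc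
      unfolding r_Suc add_Suc_right by linarith
  qed simp
  have le': "dist (x n) (x m) \<le> r n" if "n \<le> m" for n m
    using le[of n "m - n"] r_nonneg[of m] that by simp
  have lim0: "r \<longlonglongrightarrow> 0"
    unfolding r_def by (rule LIMSEQ_divide_realpow_zero) simp
  have "Cauchy x"
  proof (rule metric_CauchyI)
    fix e :: real assume e: "0 < e"
    obtain N where N: "r N < e / 2"
      using order_tendstoD(2)[OF lim0 half_gt_zero[OF e]] eventually_happens'[OF sequentially_bot] by blast
    have "dist (x m) (x n) < e" if "m \<ge> N" "n \<ge> N" for m n
      using dist_triangle3[of "x m" "x n" "x N"] le'[OF that(1)] le'[OF that(2)] N by linarith
    then show "\<exists>M. \<forall>m\<ge>M. \<forall>n\<ge>M. dist (x m) (x n) < e" by blast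
  qed
  then have "x \<longlonglongrightarrow> lim x"
    unfolding Cauchy_convergent_iff convergent_LIMSEQ_iff .
  then have "(\<lambda>m. dist (x n) (x m)) \<longlonglongrightarrow> dist (x n) (lim x)"
    by (rule tendsto_dist[OF tendsto_const])
  then have "dist (x n) (lim x) \<le> r n"
    by (rule LIMSEQ_le_const2) (intro exI[of _ n] allI impI le')
  then show ?thesis by (simp add: r_def)
qed

lemma joint_law_coupling:
  fixes f g :: "'c \<Rightarrow> 'a::euclidean_space"
  assumes "prob_space P" and [measurable]: "f \<in> P \<rightarrow>\<^sub>M borel" "g \<in> P \<rightarrow>\<^sub>M borel"
  shows "distr P borel (\<lambda>\<omega>. (f \<omega>, g \<omega>)) \<in> couplings (distr P borel f) (distr P borel g)"
    and "tcost (distr P borel (\<lambda>\<omega>. (f \<omega>, g \<omega>))) = (\<integral>\<^sup>+\<omega>. ennreal ((dist (f \<omega>) (g \<omega>))\<^sup>2) \<partial>P)"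
proof -
  interpret prob_space P by fact
  have m[measurable]: "(\<lambda>\<omega>. (f \<omega>, g \<omega>)) \<in> P \<rightarrow>\<^sub>M borel"
    unfolding borel_prod[symmetric] by measurable
  have p: "fst \<in> (borel :: ('a \<times> 'a) measure) \<rightarrow>\<^sub>M borel" "snd \<in> (borel :: ('a \<times> 'a) measure) \<rightarrow>\<^sub>M borel"
    unfolding borel_prod[symmetric] by auto
  show "distr P borel (\<lambda>\<omega>. (f \<omega>, g \<omega>)) \<in> couplings (distr P borel f) (distr P borel g)"
    unfolding couplings_def using prob_space_distr[OF m]
    by (auto simp: distr_distr[OF p(1) m] distr_distr[OF p(2) m] comp_def)
  have "(\<lambda>p. ennreal ((dist (fst p) (snd p))\<^sup>2)) \<in> borel_measurable (borel :: ('a \<times> 'a) measure)"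
    using p by measurable
  then show "tcost (distr P borel (\<lambda>\<omega>. (f \<omega>, g \<omega>))) = (\<integral>\<^sup>+\<omega>. ennreal ((dist (f \<omega>) (g \<omega>))\<^sup>2) \<partial>P)"
    unfolding tcost_def by (simp add: nn_integral_distr[OF m])
qed

lemma distr_self: "sets \<mu> = sets borel \<Longrightarrow> distr \<mu> borel (\<lambda>x. x) = \<mu>"
  by (rule distr_id2) simp

lemma diagonal_coupling:
  fixes \<mu> :: "'a::euclidean_space measure"
  assumes "prob_space \<mu>" "sets \<mu> = sets borel"
  shows "distr \<mu> borel (\<lambda>x. (x, x)) \<in> couplings \<mu> \<mu>" "tcost (distr \<mu> borel (\<lambda>x. (x, x))) = 0"
proof -
  have m: "(\<lambda>x. x) \<in> \<mu> \<rightarrow>\<^sub>M borel" using assms(2) by (simp cong: measurable_cong_sets)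
  show "distr \<mu> borel (\<lambda>x. (x, x)) \<in> couplings \<mu> \<mu>"
    using joint_law_coupling(1)[OF assms(1) m m] distr_self[OF assms(2)] by simp
  show "tcost (distr \<mu> borel (\<lambda>x. (x, x))) = 0"
    using joint_law_coupling(2)[OF assms(1) m m] by simp
qed

lemma W2cost_le_tcost: "\<gamma> \<in> couplings \<mu> \<nu> \<Longrightarrow> W2cost \<mu> \<nu> \<le> tcost \<gamma>"
  unfolding W2cost_def by (rule INF_lower)

lemma W2cost_lessE:
  assumes "W2cost \<mu> \<nu> < c"
  obtains \<gamma> where "\<gamma> \<in> couplings \<mu> \<nu>" "tcost \<gamma> < c"
  using assms unfolding W2cost_def INF_less_iff by blast

lemma W2cost_self: "prob_space \<mu> \<Longrightarrow> sets \<mu> = sets borel \<Longrightarrow> W2cost \<mu> \<mu> = 0"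
  using W2cost_le_tcost[OF diagonal_coupling(1)] diagonal_coupling(2) by (metis le_zero_eq)

lemma W2cost_commute_le: "W2cost \<nu> \<mu> \<le> W2cost \<mu> \<nu>"
  unfolding W2cost_def[of \<mu> \<nu>]
proof (rule INF_greatest)
  fix \<gamma> assume g: "\<gamma> \<in> couplings \<mu> \<nu>"
  note c = couplingD[OF g]
  have "W2cost \<nu> \<mu> \<le> tcost (distr \<gamma> borel (\<lambda>p. (snd p, fst p)))"
    using joint_law_coupling(1)[OF c(1) c(7) c(6)] unfolding c(4,5) by (rule W2cost_le_tcost)
  also have "\<dots> = tcost \<gamma>"
    using joint_law_coupling(2)[OF c(1) c(7) c(6)] by (simp add: tcost_def[of \<gamma>] dist_commute)
  finally show "W2cost \<nu> \<mu> \<le> tcost \<gamma>" .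
qed

lemma W2cost_commute: "W2cost \<nu> \<mu> = W2cost \<mu> \<nu>"
  by (intro antisym W2cost_commute_le)

text \<open>Only finiteness is claimed, so gluing with error 1 is enough. The chain is
  \<open>a\<close>, \<open>b\<close>, \<open>c\<close>, prolonged by diagonal couplings of
  \<open>c\<close>. The triangle inequality proper comes later, from plans whose base is the middle
  measure.\<close>

lemma W2cost_finite_trans:
  fixes a b c :: "'a::euclidean_space measure"
  assumes "W2cost a b < \<infinity>" "W2cost b c < \<infinity>"
  shows "W2cost a c < \<infinity>"
proof -
  obtain g1 where g1: "g1 \<in> couplings a b" "tcost g1 < \<infinity>" by (rule W2cost_lessE[OF assms(1)])
  obtain g2 where g2: "g2 \<in> couplings b c" "tcost g2 < \<infinity>" by (rule W2cost_lessE[OF assms(2)])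
  define M where "M n = (case n of 0 \<Rightarrow> a | Suc 0 \<Rightarrow> b | _ \<Rightarrow> c)" for n :: nat
  define \<gamma> where "\<gamma> n = (case n of 0 \<Rightarrow> g1 | Suc 0 \<Rightarrow> g2 | _ \<Rightarrow> distr c borel (\<lambda>x. (x, x)))" for n :: nat
  have "\<gamma> n \<in> couplings (M n) (M (Suc n))" for n
    using g1(1) g2(1) diagonal_coupling(1)[OF couplingD(10,11)[OF g2(1)]]
    by (auto simp: M_def \<gamma>_def split: nat.split)
  from chain_realization[of \<gamma> M "\<lambda>_. 1", OF this zero_less_one]
  obtain P :: "(nat \<times> nat \<Rightarrow> 'a) measure" and X where P: "prob_space P"
    and X: "\<And>n. X n \<in> P \<rightarrow>\<^sub>M borel" and law: "\<And>n. distr P borel (X n) = M n"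
    and cost: "\<And>n. (\<integral>\<^sup>+\<omega>. ennreal ((dist (X n \<omega>) (X (Suc n) \<omega>))\<^sup>2) \<partial>P) \<le> 6 * ennreal (1\<^sup>2) + 4 * tcost (\<gamma> n)"
    by blast
  note [measurable] = X
  have *: "ennreal (2 * a\<^sup>2 + 2 * b\<^sup>2) = 2 * ennreal (a\<^sup>2) + 2 * ennreal (b\<^sup>2)" for a b :: real
    by (simp add: ennreal_plus ennreal_mult' flip: ennreal_numeral)
  have "W2cost a c \<le> (\<integral>\<^sup>+\<omega>. ennreal ((dist (X 0 \<omega>) (X 2 \<omega>))\<^sup>2) \<partial>P)"
    using W2cost_le_tcost[OF joint_law_coupling(1)[OF P X X, of 0 2]]
    unfolding joint_law_coupling(2)[OF P X X] law by (simp add: M_def numeral_2_eq_2)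
  also have "\<dots> \<le> (\<integral>\<^sup>+\<omega>. 2 * ennreal ((dist (X 0 \<omega>) (X 1 \<omega>))\<^sup>2) + 2 * ennreal ((dist (X 1 \<omega>) (X 2 \<omega>))\<^sup>2) \<partial>P)"
    unfolding *[symmetric] by (intro nn_integral_mono ennreal_leI sq_dist_le2)
  also have "\<dots> = 2 * (\<integral>\<^sup>+\<omega>. ennreal ((dist (X 0 \<omega>) (X 1 \<omega>))\<^sup>2) \<partial>P) + 2 * (\<integral>\<^sup>+\<omega>. ennreal ((dist (X 1 \<omega>) (X 2 \<omega>))\<^sup>2) \<partial>P)"
    by (simp add: nn_integral_add nn_integral_cmult)
  also have "\<dots> < \<infinity>"
  proof -
    have "(\<integral>\<^sup>+\<omega>. ennreal ((dist (X 0 \<omega>) (X 1 \<omega>))\<^sup>2) \<partial>P) < \<infinity>"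
      using le_less_trans[OF cost[of 0]] g1(2) by (simp add: \<gamma>_def ennreal_mult_less_top)
    moreover have "(\<integral>\<^sup>+\<omega>. ennreal ((dist (X 1 \<omega>) (X 2 \<omega>))\<^sup>2) \<partial>P) < \<infinity>"
      using le_less_trans[OF cost[of 1]] g2(2) by (simp add: \<gamma>_def ennreal_mult_less_top numeral_2_eq_2)
    ultimately show ?thesis by (simp add: ennreal_mult_less_top)
  qed
  finally show ?thesis .
qed

text \<open>The weights \<open>4 ^ k\<close> make the steps of almost every path at most a multiple
  of \<open>1 / 2 ^ k\<close>, so the paths converge. The joint laws of \<open>X n\<close> with the
  limit are the couplings, and the common bound \<open>C\<close> means that the distance to the
  limit law is of order \<open>1 / 2 ^ n\<close>.\<close>

lemma chain_limit:
  fixes M :: "nat \<Rightarrow> 'a::euclidean_space measure"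
  assumes \<gamma>: "\<And>n. \<gamma> n \<in> couplings (M n) (M (Suc n))" and fin: "(\<Sum>k. 4 ^ k * tcost (\<gamma> k)) < \<infinity>"
  obtains \<nu> and C :: ennreal where "C < \<infinity>" "\<And>n. \<exists>g\<in>couplings (M n) \<nu>. 4 ^ n * tcost g \<le> C"
proof -
  \<comment> \<open>The gluing errors \<open>(1/4) ^ n\<close> enter squared and thus stay summable
    after multiplication by \<open>4 ^ n\<close>.\<close>
  obtain P :: "(nat \<times> nat \<Rightarrow> 'a) measure" and X where P: "prob_space P"
    and X: "\<And>n. X n \<in> P \<rightarrow>\<^sub>M borel" and law: "\<And>n. distr P borel (X n) = M n"
    and cost: "\<And>n. (\<integral>\<^sup>+\<omega>. ennreal ((dist (X n \<omega>) (X (Suc n) \<omega>))\<^sup>2) \<partial>P) \<le> 6 * ennreal (((1/4) ^ n)\<^sup>2) + 4 * tcost (\<gamma> n)"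
    using chain_realization[of \<gamma> M "\<lambda>n. (1/4) ^ n", OF \<gamma> zero_less_power] by force
  note [measurable] = X
  define Z where "Z \<omega> = (\<Sum>k. 4 ^ k * ennreal ((dist (X k \<omega>) (X (Suc k) \<omega>))\<^sup>2))" for \<omega>
  have Zm[measurable]: "Z \<in> borel_measurable P" unfolding Z_def by measurable
  have geo: "4 ^ k * (6 * ennreal (((1/4) ^ k)\<^sup>2)) = ennreal (6 * (1/4) ^ k)" for k :: nat
  proof -
    have "(4::ennreal) ^ k = ennreal (4 ^ k)" by (simp add: ennreal_power flip: ennreal_numeral)
    then have "4 ^ k * (6 * ennreal (((1/4) ^ k)\<^sup>2)) = ennreal (4 ^ k * (6 * ((1/4) ^ k)\<^sup>2))"
      by (simp add: ennreal_mult flip: ennreal_numeral)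
    also have "4 ^ k * (6 * ((1/4) ^ k)\<^sup>2) = 6 * ((1/4::real) ^ k)"
      by (simp add: power2_eq_square power_divide)
    finally show ?thesis .
  qed
  have "(\<integral>\<^sup>+\<omega>. Z \<omega> \<partial>P) = (\<Sum>k. 4 ^ k * (\<integral>\<^sup>+\<omega>. ennreal ((dist (X k \<omega>) (X (Suc k) \<omega>))\<^sup>2) \<partial>P))"
    unfolding Z_def by (subst nn_integral_suminf) (auto simp: nn_integral_cmult)
  also have "\<dots> \<le> (\<Sum>k. 4 ^ k * (6 * ennreal (((1/4) ^ k)\<^sup>2) + 4 * tcost (\<gamma> k)))"
    by (intro suminf_le mult_left_mono cost) auto
  also have "\<dots> = (\<Sum>k. ennreal (6 * (1/4) ^ k) + 4 * (4 ^ k * tcost (\<gamma> k)))"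
    unfolding distrib_left geo by (simp add: mult_ac)
  also have "\<dots> = (\<Sum>k. ennreal (6 * (1/4) ^ k)) + 4 * (\<Sum>k. 4 ^ k * tcost (\<gamma> k))"
    by (subst suminf_add[symmetric]) auto
  also have "\<dots> < \<infinity>"
  proof -
    have "summable (\<lambda>k. 6 * (1/4::real) ^ k)" by (intro summable_mult summable_geometric) simp
    then have "(\<Sum>k. ennreal (6 * (1/4) ^ k)) < \<infinity>"
      by (simp add: suminf_ennreal2)
    then show ?thesis using fin by (simp add: ennreal_mult_less_top)
  qed
  finally have Zfin: "(\<integral>\<^sup>+\<omega>. Z \<omega> \<partial>P) < \<infinity>" .
  have AE: "AE \<omega> in P. Z \<omega> \<noteq> \<infinity>"
    by (rule nn_integral_PInf_AE[OF Zm]) (use Zfin in simp)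
  \<comment> \<open>As a total function \<open>lim\<close> gives a variable that is measurable
    everywhere; it is the limit of the path where \<open>Z\<close> is finite, that is almost
    everywhere.\<close>
  define Y where "Y \<omega> = lim (\<lambda>n. X n \<omega>)" for \<omega>
  have Y[measurable]: "Y \<in> P \<rightarrow>\<^sub>M borel" unfolding Y_def by measurable
  have p4: "(2 ^ k)\<^sup>2 = (4::real) ^ k" for k
    by (simp add: power2_eq_square power_mult_distrib[symmetric])
  have close: "4 ^ n * ennreal ((dist (X n \<omega>) (Y \<omega>))\<^sup>2) \<le> 4 * Z \<omega>" if w: "Z \<omega> \<noteq> \<infinity>" for n \<omega>
  proof -
    obtain z where z: "0 \<le> z" "Z \<omega> = ennreal z" using w by (cases "Z \<omega>" rule: ennreal_cases) auto
    have step: "dist (X k \<omega>) (X (Suc k) \<omega>) \<le> sqrt z / 2 ^ k" for k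
    proof -
      have "(\<Sum>j\<in>{k}. 4 ^ j * ennreal ((dist (X j \<omega>) (X (Suc j) \<omega>))\<^sup>2)) \<le> Z \<omega>"
        unfolding Z_def by (rule sum_le_suminf) auto
      then have "ennreal (4 ^ k * (dist (X k \<omega>) (X (Suc k) \<omega>))\<^sup>2) \<le> ennreal z"
        unfolding z(2) by (simp add: ennreal_mult ennreal_power flip: ennreal_numeral)
      then have "4 ^ k * (dist (X k \<omega>) (X (Suc k) \<omega>))\<^sup>2 \<le> z" using z(1) by simp
      also have "z = 4 ^ k * (sqrt z / 2 ^ k)\<^sup>2"
        using z(1) by (simp add: power_divide p4)
      finally have "(dist (X k \<omega>) (X (Suc k) \<omega>))\<^sup>2 \<le> (sqrt z / 2 ^ k)\<^sup>2" by simp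
      then show ?thesis by (rule power2_le_imp_le) (use z in simp)
    qed
    have "dist (X n \<omega>) (Y \<omega>) \<le> 2 * sqrt z / 2 ^ n"
      unfolding Y_def by (rule geometric_steps_limit[OF step])
    then have "(dist (X n \<omega>) (Y \<omega>))\<^sup>2 \<le> (2 * sqrt z / 2 ^ n)\<^sup>2" by (intro power_mono) auto
    then have "4 ^ n * (dist (X n \<omega>) (Y \<omega>))\<^sup>2 \<le> 4 ^ n * (2 * sqrt z / 2 ^ n)\<^sup>2" by simp
    also have "\<dots> = 4 * z"
      using z(1) by (simp add: power_divide power_mult_distrib p4)
    finally have "ennreal (4 ^ n * (dist (X n \<omega>) (Y \<omega>))\<^sup>2) \<le> ennreal (4 * z)" by (rule ennreal_leI)
    then show ?thesis
      unfolding z(2) using z(1) by (simp add: ennreal_mult ennreal_power flip: ennreal_numeral)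
  qed
  have "\<exists>g\<in>couplings (M n) (distr P borel Y). 4 ^ n * tcost g \<le> 4 * (\<integral>\<^sup>+\<omega>. Z \<omega> \<partial>P)" for n
  proof (rule bexI)
    show "distr P borel (\<lambda>\<omega>. (X n \<omega>, Y \<omega>)) \<in> couplings (M n) (distr P borel Y)"
      using joint_law_coupling(1)[OF P X Y] unfolding law .
    have "4 ^ n * tcost (distr P borel (\<lambda>\<omega>. (X n \<omega>, Y \<omega>))) = (\<integral>\<^sup>+\<omega>. 4 ^ n * ennreal ((dist (X n \<omega>) (Y \<omega>))\<^sup>2) \<partial>P)"
      unfolding joint_law_coupling(2)[OF P X Y] by (simp add: nn_integral_cmult)
    also have "\<dots> \<le> (\<integral>\<^sup>+\<omega>. 4 * Z \<omega> \<partial>P)"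
      by (rule nn_integral_mono_AE) (use AE close in \<open>auto elim!: eventually_mono\<close>)
    also have "\<dots> = 4 * (\<integral>\<^sup>+\<omega>. Z \<omega> \<partial>P)" by (simp add: nn_integral_cmult)
    finally show "4 ^ n * tcost (distr P borel (\<lambda>\<omega>. (X n \<omega>, Y \<omega>))) \<le> 4 * (\<integral>\<^sup>+\<omega>. Z \<omega> \<partial>P)" .
  qed
  moreover have "4 * (\<integral>\<^sup>+\<omega>. Z \<omega> \<partial>P) < \<infinity>" using Zfin by (simp add: ennreal_mult_less_top)
  ultimately show ?thesis using that by blast
qed

section \<open>The Wasserstein distance\<close>

lemma P2D:
  assumes "\<mu> \<in> P2 \<omega>0"
  shows "prob_space \<mu>" "sets \<mu> = sets borel" "W2cost \<mu> \<omega>0 < \<infinity>"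
  using assms by (auto simp: P2_def)

lemma W2cost_finite: "\<mu> \<in> P2 \<omega>0 \<Longrightarrow> \<nu> \<in> P2 \<omega>0 \<Longrightarrow> W2cost \<mu> \<nu> < \<infinity>"
  using W2cost_finite_trans[of \<mu> \<omega>0 \<nu>] P2D(3)[of \<mu> \<omega>0] P2D(3)[of \<nu> \<omega>0] W2cost_commute[of \<omega>0 \<nu>] by simp

lemma P2I: "\<mu> \<in> P2 \<omega>0 \<Longrightarrow> prob_space \<nu> \<Longrightarrow> sets \<nu> = sets borel \<Longrightarrow> W2cost \<mu> \<nu> < \<infinity> \<Longrightarrow> \<nu> \<in> P2 \<omega>0"
  using W2cost_finite_trans[of \<nu> \<mu> \<omega>0] P2D(3)[of \<mu> \<omega>0] W2cost_commute[of \<mu> \<nu>] by (simp add: P2_def)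

lemma base_in_P2: "prob_space \<omega>0 \<Longrightarrow> sets \<omega>0 = sets borel \<Longrightarrow> \<omega>0 \<in> P2 \<omega>0"
  by (simp add: P2_def W2cost_self)

lemma W2_nonneg: "0 \<le> W2 \<mu> \<nu>"
  by (simp add: W2_def)

lemma W2_commute: "W2 \<mu> \<nu> = W2 \<nu> \<mu>"
  by (simp add: W2_def W2cost_commute)

lemma W2_sq: "W2cost \<mu> \<nu> < \<infinity> \<Longrightarrow> ennreal ((W2 \<mu> \<nu>)\<^sup>2) = W2cost \<mu> \<nu>"
  by (simp add: W2_def)

lemma W2_sq_le:
  assumes "W2cost \<mu> \<nu> \<le> ennreal c" "0 \<le> c"
  shows "(W2 \<mu> \<nu>)\<^sup>2 \<le> c"
proof -
  have "W2cost \<mu> \<nu> < \<infinity>" using le_less_trans[OF assms(1)] by simp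
  then have "ennreal ((W2 \<mu> \<nu>)\<^sup>2) \<le> ennreal c" using W2_sq assms(1) by metis
  then show ?thesis using assms(2) by simp
qed

text \<open>The right-hand side of \<open>le\<close> is smallest at \<open>s = b / a\<close>, where
  it equals \<open>(a + b)^2\<close>; a shift by \<delta> avoids division by zero. With this the
  triangle inequality follows from Young's inequality integrated for each fixed
  \<open>s\<close>.\<close>

lemma minkowski_real:
  fixes a b c :: real
  assumes "0 \<le> a" "0 \<le> b" and le: "\<And>s. 0 < s \<Longrightarrow> c\<^sup>2 \<le> (1 + s) * a\<^sup>2 + (1 + 1 / s) * b\<^sup>2"
  shows "c \<le> a + b"
proof (rule field_le_epsilon)
  fix \<epsilon> :: real assume "0 < \<epsilon>"
  define \<delta> where "\<delta> = \<epsilon> / 2"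
  have \<delta>: "0 < \<delta>" using \<open>0 < \<epsilon>\<close> by (simp add: \<delta>_def)
  define A B where "A = a + \<delta>" and "B = b + \<delta>"
  have AB: "0 < A" "0 < B" "a\<^sup>2 \<le> A\<^sup>2" "b\<^sup>2 \<le> B\<^sup>2"
    using assms(1,2) \<delta> by (auto simp: A_def B_def intro: power_mono)
  have "c\<^sup>2 \<le> (1 + B / A) * a\<^sup>2 + (1 + 1 / (B / A)) * b\<^sup>2" using AB by (intro le) simp
  also have "\<dots> \<le> (1 + B / A) * A\<^sup>2 + (1 + 1 / (B / A)) * B\<^sup>2"
    using AB by (intro add_mono mult_left_mono) auto
  also have "\<dots> = (A + B)\<^sup>2" using AB by (simp add: field_simps power2_eq_square)
  finally have "c \<le> A + B" by (rule power2_le_imp_le) (use AB in simp)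
  then show "c \<le> a + b + \<epsilon>" by (simp add: A_def B_def \<delta>_def)
qed

lemma sq_dist_young:
  fixes x y z :: "'b::metric_space"
  assumes "0 < s"
  shows "(dist y z)\<^sup>2 \<le> (1 + s) * (dist x y)\<^sup>2 + (1 + 1 / s) * (dist x z)\<^sup>2"
proof -
  have "(dist y z)\<^sup>2 \<le> (dist x y + dist x z)\<^sup>2"
    by (intro power_mono dist_triangle3) auto
  also have "\<dots> \<le> (1 + s) * (dist x y)\<^sup>2 + (1 + 1 / s) * (dist x z)\<^sup>2"
  proof -
    have "0 \<le> (s * dist x y - dist x z)\<^sup>2 / s" using assms by simp
    also have "\<dots> = s * (dist x y)\<^sup>2 + (dist x z)\<^sup>2 / s - 2 * dist x y * dist x z"
      using assms by (simp add: power2_eq_square field_simps)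
    finally show ?thesis by (simp add: power2_eq_square algebra_simps)
  qed
  finally show ?thesis .
qed

text \<open>Expanding inner products gives an identity. It is the pointwise source of the convexity
  of the squared distance from the base along a generalized geodesic.\<close>

lemma sq_dist_segment:
  fixes x y z :: "'b::real_inner"
  shows "(dist x ((1 - \<alpha>) *\<^sub>R y + \<alpha> *\<^sub>R z))\<^sup>2 + \<alpha> * (1 - \<alpha>) * (dist y z)\<^sup>2
    = (1 - \<alpha>) * (dist x y)\<^sup>2 + \<alpha> * (dist x z)\<^sup>2"
proof -
  define u v where "u = x - y" and "v = x - z"
  have 1: "x - ((1 - \<alpha>) *\<^sub>R y + \<alpha> *\<^sub>R z) = (1 - \<alpha>) *\<^sub>R u + \<alpha> *\<^sub>R v"
    by (simp add: u_def v_def algebra_simps)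
  have 2: "y - z = v - u" by (simp add: u_def v_def)
  show ?thesis
    unfolding dist_norm 1 2 u_def[symmetric] v_def[symmetric] power2_norm_eq_inner
    by (simp add: inner_add_left inner_add_right inner_diff_left inner_diff_right inner_commute[of v u] algebra_simps)
qed

section \<open>Transport plans and generalized geodesics\<close>

context
  fixes w :: "('a::euclidean_space \<times> 'a \<times> 'a) measure" and \<omega> \<mu>0 \<mu>1 :: "'a measure"
  assumes w: "w \<in> transport_plans \<omega> \<mu>0 \<mu>1"
begin

lemma plan_prob: "prob_space w" and plan_sets: "sets w = sets borel"
  using w by (auto simp: transport_plans_def)

lemma plan_measurable [measurable]:
  "fst \<in> w \<rightarrow>\<^sub>M borel" "(\<lambda>p. fst (snd p)) \<in> w \<rightarrow>\<^sub>M borel" "(\<lambda>p. snd (snd p)) \<in> w \<rightarrow>\<^sub>M borel"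
  unfolding measurable_cong_sets[OF plan_sets refl] borel_prod[symmetric] by measurable

lemma plan_opt:
  "distr w borel (\<lambda>p. (fst p, fst (snd p))) \<in> opt_couplings \<omega> \<mu>0"
  "distr w borel (\<lambda>p. (fst p, snd (snd p))) \<in> opt_couplings \<omega> \<mu>1"
  using w by (auto simp: transport_plans_def case_prod_beta')

lemma plan_laws:
  "distr w borel fst = \<omega>" "distr w borel (\<lambda>p. fst (snd p)) = \<mu>0" "distr w borel (\<lambda>p. snd (snd p)) = \<mu>1"
proof -
  note m = plan_measurable
  have 1: "distr w borel (\<lambda>p. (fst p, fst (snd p))) \<in> couplings \<omega> \<mu>0"
    and 2: "distr w borel (\<lambda>p. (fst p, snd (snd p))) \<in> couplings \<omega> \<mu>1"
    using plan_opt by (auto simp: opt_couplings_def)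
  note 3 = joint_law_coupling(1)[OF plan_prob m(1) m(2)] and 4 = joint_law_coupling(1)[OF plan_prob m(1) m(3)]
  show "distr w borel fst = \<omega>" using couplingD(4)[OF 1] couplingD(4)[OF 3] by simp
  show "distr w borel (\<lambda>p. fst (snd p)) = \<mu>0" using couplingD(5)[OF 1] couplingD(5)[OF 3] by simp
  show "distr w borel (\<lambda>p. snd (snd p)) = \<mu>1" using couplingD(5)[OF 2] couplingD(5)[OF 4] by simp
qed

lemma plan_costs:
  "(\<integral>\<^sup>+p. ennreal ((dist (fst p) (fst (snd p)))\<^sup>2) \<partial>w) = W2cost \<omega> \<mu>0"
  "(\<integral>\<^sup>+p. ennreal ((dist (fst p) (snd (snd p)))\<^sup>2) \<partial>w) = W2cost \<omega> \<mu>1"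
  using plan_opt joint_law_coupling(2)[OF plan_prob plan_measurable(1) plan_measurable(2)]
    joint_law_coupling(2)[OF plan_prob plan_measurable(1) plan_measurable(3)]
  by (auto simp: opt_couplings_def)

text \<open>Young's inequality holds pointwise for each \<open>s\<close> and survives integration;
  the choice of \<open>s\<close> is postponed to real numbers. The first two components are
  optimally coupled, and so are the first and the third, so the integrals are squared
  distances.\<close>

lemma plan_cost_le:
  assumes fin: "W2cost \<omega> \<mu>0 < \<infinity>" "W2cost \<omega> \<mu>1 < \<infinity>" and s: "0 < s"
  shows "(\<integral>\<^sup>+p. ennreal ((dist (fst (snd p)) (snd (snd p)))\<^sup>2) \<partial>w)
    \<le> ennreal ((1 + s) * (W2 \<omega> \<mu>0)\<^sup>2 + (1 + 1 / s) * (W2 \<omega> \<mu>1)\<^sup>2)"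
proof -
  have "(\<integral>\<^sup>+p. ennreal ((dist (fst (snd p)) (snd (snd p)))\<^sup>2) \<partial>w)
    \<le> (\<integral>\<^sup>+p. ennreal (1 + s) * ennreal ((dist (fst p) (fst (snd p)))\<^sup>2) + ennreal (1 + 1 / s) * ennreal ((dist (fst p) (snd (snd p)))\<^sup>2) \<partial>w)"
  proof (rule nn_integral_mono)
    fix p :: "'a \<times> 'a \<times> 'a"
    have "ennreal ((dist (fst (snd p)) (snd (snd p)))\<^sup>2)
      \<le> ennreal ((1 + s) * (dist (fst p) (fst (snd p)))\<^sup>2 + (1 + 1 / s) * (dist (fst p) (snd (snd p)))\<^sup>2)"
      by (intro ennreal_leI sq_dist_young s)
    then show "ennreal ((dist (fst (snd p)) (snd (snd p)))\<^sup>2)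
      \<le> ennreal (1 + s) * ennreal ((dist (fst p) (fst (snd p)))\<^sup>2) + ennreal (1 + 1 / s) * ennreal ((dist (fst p) (snd (snd p)))\<^sup>2)"
      using s by (simp add: ennreal_plus ennreal_mult)
  qed
  also have "\<dots> = ennreal (1 + s) * W2cost \<omega> \<mu>0 + ennreal (1 + 1 / s) * W2cost \<omega> \<mu>1"
    by (simp add: nn_integral_add nn_integral_cmult plan_costs)
  also have "\<dots> = ennreal ((1 + s) * (W2 \<omega> \<mu>0)\<^sup>2 + (1 + 1 / s) * (W2 \<omega> \<mu>1)\<^sup>2)"
    unfolding W2_sq[OF fin(1), symmetric] W2_sq[OF fin(2), symmetric] using s by (simp add: ennreal_plus ennreal_mult)
  finally show ?thesis .
qed

lemma W2cost_le_plan: "W2cost \<mu>0 \<mu>1 \<le> (\<integral>\<^sup>+p. ennreal ((dist (fst (snd p)) (snd (snd p)))\<^sup>2) \<partial>w)"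
  using W2cost_le_tcost[OF joint_law_coupling(1)[OF plan_prob plan_measurable(2) plan_measurable(3)]]
  unfolding joint_law_coupling(2)[OF plan_prob plan_measurable(2) plan_measurable(3)] plan_laws .

lemma W2_triangle_plan:
  assumes fin: "W2cost \<omega> \<mu>0 < \<infinity>" "W2cost \<omega> \<mu>1 < \<infinity>"
  shows "W2 \<mu>0 \<mu>1 \<le> W2 \<omega> \<mu>0 + W2 \<omega> \<mu>1"
proof (rule minkowski_real[OF W2_nonneg W2_nonneg])
  fix s :: real assume s: "0 < s"
  show "(W2 \<mu>0 \<mu>1)\<^sup>2 \<le> (1 + s) * (W2 \<omega> \<mu>0)\<^sup>2 + (1 + 1 / s) * (W2 \<omega> \<mu>1)\<^sup>2"
    using order_trans[OF W2cost_le_plan plan_cost_le[OF fin s]] s by (intro W2_sq_le) auto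
qed

lemma W2plan_sq:
  assumes fin: "W2cost \<omega> \<mu>0 < \<infinity>" "W2cost \<omega> \<mu>1 < \<infinity>"
  shows "ennreal ((W2plan w)\<^sup>2) = (\<integral>\<^sup>+p. ennreal ((dist (fst (snd p)) (snd (snd p)))\<^sup>2) \<partial>w)"
proof -
  have "(\<integral>\<^sup>+p. ennreal ((dist (fst (snd p)) (snd (snd p)))\<^sup>2) \<partial>w) < \<infinity>"
    using le_less_trans[OF plan_cost_le[OF fin zero_less_one]] by simp
  then show ?thesis by (simp add: W2plan_def)
qed

lemma W2_le_W2plan:
  assumes fin: "W2cost \<omega> \<mu>0 < \<infinity>" "W2cost \<omega> \<mu>1 < \<infinity>"
  shows "W2 \<mu>0 \<mu>1 \<le> W2plan w"
proof (rule power2_le_imp_le)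
  show "(W2 \<mu>0 \<mu>1)\<^sup>2 \<le> (W2plan w)\<^sup>2"
    using W2cost_le_plan unfolding W2plan_sq[OF fin, symmetric] by (rule W2_sq_le) simp
  show "0 \<le> W2plan w" by (simp add: W2plan_def)
qed

text \<open>The plan itself couples the base with the interpolated measure. Integrating
  \<open>sq_dist_segment\<close> bounds the distance from above, while optimality of the two plan
  marginals makes the other terms exact.\<close>

lemma gen_geod_W2:
  assumes fin: "W2cost \<omega> \<mu>0 < \<infinity>" "W2cost \<omega> \<mu>1 < \<infinity>" and a: "0 \<le> \<alpha>" "\<alpha> \<le> 1"
  shows "prob_space (gen_geod w \<alpha>)" "sets (gen_geod w \<alpha>) = sets borel" "W2cost \<omega> (gen_geod w \<alpha>) < \<infinity>"
    "(W2 \<omega> (gen_geod w \<alpha>))\<^sup>2 \<le> (1 - \<alpha>) * (W2 \<omega> \<mu>0)\<^sup>2 + \<alpha> * (W2 \<omega> \<mu>1)\<^sup>2 - \<alpha> * (1 - \<alpha>) * (W2plan w)\<^sup>2"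
proof -
  interpret prob_space w by (rule plan_prob)
  define g where "g p = (1 - \<alpha>) *\<^sub>R fst (snd p) + \<alpha> *\<^sub>R snd (snd p)" for p :: "'a \<times> 'a \<times> 'a"
  have g[measurable]: "g \<in> w \<rightarrow>\<^sub>M borel" unfolding g_def by measurable
  have G: "gen_geod w \<alpha> = distr w borel g"
    by (simp add: gen_geod_def case_prod_beta' g_def[abs_def])
  show "prob_space (gen_geod w \<alpha>)" unfolding G by (rule prob_space_distr[OF g])
  show "sets (gen_geod w \<alpha>) = sets borel" by (simp add: G)
  let ?I = "\<integral>\<^sup>+p. ennreal ((dist (fst p) (g p))\<^sup>2) \<partial>w"
  define R where "R = (1 - \<alpha>) * (W2 \<omega> \<mu>0)\<^sup>2 + \<alpha> * (W2 \<omega> \<mu>1)\<^sup>2"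
  have R0: "0 \<le> R" using a by (simp add: R_def)
  have cost: "W2cost \<omega> (gen_geod w \<alpha>) \<le> ?I"
    using W2cost_le_tcost[OF joint_law_coupling(1)[OF plan_prob plan_measurable(1) g]]
    unfolding joint_law_coupling(2)[OF plan_prob plan_measurable(1) g] plan_laws G .
  \<comment> \<open>The subtracted term is kept on the left, so that the computation stays among
    nonnegative extended numbers.\<close>
  have "?I + ennreal (\<alpha> * (1 - \<alpha>) * (W2plan w)\<^sup>2)
      = (\<integral>\<^sup>+p. ennreal ((dist (fst p) (g p))\<^sup>2) + ennreal (\<alpha> * (1 - \<alpha>)) * ennreal ((dist (fst (snd p)) (snd (snd p)))\<^sup>2) \<partial>w)"
    using a by (simp add: nn_integral_add nn_integral_cmult W2plan_sq[OF fin, symmetric] ennreal_mult)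
  also have "\<dots> = (\<integral>\<^sup>+p. ennreal (1 - \<alpha>) * ennreal ((dist (fst p) (fst (snd p)))\<^sup>2) + ennreal \<alpha> * ennreal ((dist (fst p) (snd (snd p)))\<^sup>2) \<partial>w)"
  proof (rule nn_integral_cong)
    fix p :: "'a \<times> 'a \<times> 'a"
    have "ennreal ((dist (fst p) (g p))\<^sup>2 + \<alpha> * (1 - \<alpha>) * (dist (fst (snd p)) (snd (snd p)))\<^sup>2)
      = ennreal ((1 - \<alpha>) * (dist (fst p) (fst (snd p)))\<^sup>2 + \<alpha> * (dist (fst p) (snd (snd p)))\<^sup>2)"
      unfolding g_def sq_dist_segment ..
    then show "ennreal ((dist (fst p) (g p))\<^sup>2) + ennreal (\<alpha> * (1 - \<alpha>)) * ennreal ((dist (fst (snd p)) (snd (snd p)))\<^sup>2)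
      = ennreal (1 - \<alpha>) * ennreal ((dist (fst p) (fst (snd p)))\<^sup>2) + ennreal \<alpha> * ennreal ((dist (fst p) (snd (snd p)))\<^sup>2)"
      using a by (simp add: ennreal_plus ennreal_mult)
  qed
  also have "\<dots> = ennreal (1 - \<alpha>) * W2cost \<omega> \<mu>0 + ennreal \<alpha> * W2cost \<omega> \<mu>1"
    by (simp add: nn_integral_add nn_integral_cmult plan_costs)
  also have "\<dots> = ennreal R"
    unfolding W2_sq[OF fin(1), symmetric] W2_sq[OF fin(2), symmetric] R_def using a by (simp add: ennreal_plus ennreal_mult)
  finally have eq: "?I + ennreal (\<alpha> * (1 - \<alpha>) * (W2plan w)\<^sup>2) = ennreal R" .
  then have "?I \<le> ennreal R" by (metis le_iff_add)
  then have cR: "W2cost \<omega> (gen_geod w \<alpha>) \<le> ennreal R" using cost by (rule order_trans[rotated])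
  then show f: "W2cost \<omega> (gen_geod w \<alpha>) < \<infinity>" using le_less_trans by fastforce
  have "ennreal ((W2 \<omega> (gen_geod w \<alpha>))\<^sup>2 + \<alpha> * (1 - \<alpha>) * (W2plan w)\<^sup>2) \<le> ennreal R"
    using add_right_mono[OF cost, of "ennreal (\<alpha> * (1 - \<alpha>) * (W2plan w)\<^sup>2)"] a
    unfolding eq W2_sq[OF f, symmetric] by (simp add: ennreal_plus)
  then have "(W2 \<omega> (gen_geod w \<alpha>))\<^sup>2 + \<alpha> * (1 - \<alpha>) * (W2plan w)\<^sup>2 \<le> R" using R0 by simp
  then show "(W2 \<omega> (gen_geod w \<alpha>))\<^sup>2 \<le> (1 - \<alpha>) * (W2 \<omega> \<mu>0)\<^sup>2 + \<alpha> * (W2 \<omega> \<mu>1)\<^sup>2 - \<alpha> * (1 - \<alpha>) * (W2plan w)\<^sup>2"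
    by (simp add: R_def)
qed

end

text \<open>The chain of couplings starts at \<open>\<omega>0\<close>, so that the limit has finite cost from \<open>\<omega>0\<close>.\<close>

lemma P2_complete:
  fixes \<omega>0 :: "'a::euclidean_space measure"
  assumes w0: "\<omega>0 \<in> P2 \<omega>0"
    and tri: "\<And>x y z. x \<in> P2 \<omega>0 \<Longrightarrow> y \<in> P2 \<omega>0 \<Longrightarrow> z \<in> P2 \<omega>0 \<Longrightarrow> W2 x z \<le> W2 x y + W2 y z"
    and s: "\<And>n. s n \<in> P2 \<omega>0"
    and cau: "\<And>\<epsilon>. 0 < \<epsilon> \<Longrightarrow> \<exists>N. \<forall>m\<ge>N. \<forall>n\<ge>N. W2 (s m) (s n) < \<epsilon>"
  shows "\<exists>x\<in>P2 \<omega>0. (\<lambda>n. W2 (s n) x) \<longlonglongrightarrow> 0"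
proof -
  have "\<exists>N. \<forall>m\<ge>N. \<forall>n\<ge>N. W2 (s m) (s n) < (1/4) ^ k" for k by (rule cau) simp
  then obtain N where N: "\<And>k m n. m \<ge> N k \<Longrightarrow> n \<ge> N k \<Longrightarrow> W2 (s m) (s n) < (1/4) ^ k" by metis
  \<comment> \<open>Both \<open>r k\<close> and \<open>r (Suc k)\<close> exceed \<open>N k\<close>,
    so consecutive terms of the subsequence have distance below \<open>(1/4) ^ k\<close>; the
    summand \<open>k\<close> makes the indices unbounded.\<close>
  define r where "r k = (\<Sum>i\<le>k. N i) + k" for k
  have r: "N k \<le> r k" "N k \<le> r (Suc k)" "k \<le> r k" for k
  proof -
    have "N k \<le> (\<Sum>i\<le>k. N i)" by (rule member_le_sum) auto
    then show "N k \<le> r k" "N k \<le> r (Suc k)" "k \<le> r k" by (auto simp: r_def)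
  qed
  define M where "M n = (case n of 0 \<Rightarrow> \<omega>0 | Suc k \<Rightarrow> s (r k))" for n :: nat
  have M: "M n \<in> P2 \<omega>0" for n using w0 s by (auto simp: M_def split: nat.split)
  \<comment> \<open>The first coupling, out of \<omega>0, has merely finite cost. The later costs
    are below \<open>(1/16) ^ (n - 1)\<close> and leave a geometric series of ratio 1/4 after
    weighting by \<open>4 ^ n\<close>.\<close>
  have "\<exists>\<gamma>. \<gamma> \<in> couplings (M n) (M (Suc n)) \<and> tcost \<gamma> < (if n = 0 then \<infinity> else ennreal ((1/16) ^ (n - 1)))" for n
  proof (cases n)
    case 0
    obtain \<gamma> where "\<gamma> \<in> couplings (M 0) (M (Suc 0))" "tcost \<gamma> < \<infinity>"
      by (rule W2cost_lessE[OF W2cost_finite[OF M[of 0] M[of "Suc 0"]]])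
    then show ?thesis using 0 by auto
  next
    case (Suc k)
    have "W2 (M n) (M (Suc n)) < (1/4) ^ k" using N[OF r(1) r(2), of k] Suc by (simp add: M_def)
    then have "(W2 (M n) (M (Suc n)))\<^sup>2 < ((1/4) ^ k)\<^sup>2" using W2_nonneg by (intro power_strict_mono) auto
    also have "((1/4::real) ^ k)\<^sup>2 = (1/16) ^ k" by (simp add: power2_eq_square power_mult_distrib[symmetric])
    finally have "W2cost (M n) (M (Suc n)) < ennreal ((1/16) ^ k)"
      unfolding W2_sq[OF W2cost_finite[OF M M], symmetric] by (simp add: ennreal_less_iff)
    then obtain \<gamma> where "\<gamma> \<in> couplings (M n) (M (Suc n))" "tcost \<gamma> < ennreal ((1/16) ^ k)"
      by (rule W2cost_lessE)
    then show ?thesis using Suc by auto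
  qed
  then obtain \<gamma> where \<gamma>: "\<And>n. \<gamma> n \<in> couplings (M n) (M (Suc n))"
    and \<gamma>c: "\<And>n. tcost (\<gamma> n) < (if n = 0 then \<infinity> else ennreal ((1/16) ^ (n - 1)))" by metis
  have "(\<Sum>k. 4 ^ k * tcost (\<gamma> k)) = (\<Sum>k. 4 ^ (k + 1) * tcost (\<gamma> (k + 1))) + (\<Sum>k<1. 4 ^ k * tcost (\<gamma> k))"
    by (rule suminf_offset) simp
  also have "\<dots> < \<infinity>"
  proof -
    have "(\<Sum>k. 4 ^ (k + 1) * tcost (\<gamma> (k + 1))) \<le> (\<Sum>k. ennreal (4 * (1/4) ^ k))"
    proof (rule suminf_le)
      fix k
      have "4 ^ (k + 1) * tcost (\<gamma> (k + 1)) \<le> 4 ^ (k + 1) * ennreal ((1/16) ^ k)"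
        using \<gamma>c[of "k + 1"] by (intro mult_left_mono) auto
      also have "\<dots> = ennreal (4 ^ (k + 1) * (1/16) ^ k)"
      proof -
        have "(4::ennreal) ^ (k + 1) = ennreal (4 ^ (k + 1))"
          by (simp only: ennreal_power[symmetric] zero_le_numeral ennreal_numeral)
        then show ?thesis by (simp only: ennreal_mult[OF zero_le_power zero_le_power] zero_le_numeral zero_le_divide_1_iff)
      qed
      also have "4 ^ (k + 1) * (1/16::real) ^ k = 4 * (1/4) ^ k"
        using power_mult_distrib[of 4 "1/16::real" k] by simp
      finally show "4 ^ (k + 1) * tcost (\<gamma> (k + 1)) \<le> ennreal (4 * (1/4) ^ k)" .
    qed auto
    also have "\<dots> < \<infinity>"
    proof -
      have "summable (\<lambda>k. 4 * (1/4::real) ^ k)" by (intro summable_mult summable_geometric) simp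
      then show ?thesis by (simp add: suminf_ennreal2)
    qed
    finally show ?thesis using \<gamma>c[of 0] by simp
  qed
  finally have fin: "(\<Sum>k. 4 ^ k * tcost (\<gamma> k)) < \<infinity>" .
  obtain \<nu> and C :: ennreal where C: "C < \<infinity>" and g: "\<And>n. \<exists>g\<in>couplings (M n) \<nu>. 4 ^ n * tcost g \<le> C"
    using chain_limit[OF \<gamma> fin] by blast
  obtain c where c: "0 \<le> c" "C = ennreal c" using C by (cases C rule: ennreal_cases) auto
  have cost: "W2cost (M n) \<nu> \<le> ennreal (c / 4 ^ n)" for n
  proof -
    obtain h where h: "h \<in> couplings (M n) \<nu>" "4 ^ n * tcost h \<le> C" using g by blast
    have "ennreal (1 / 4 ^ n) * (4 ^ n * tcost h) \<le> ennreal (1 / 4 ^ n) * ennreal c"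
      using h(2) c by (intro mult_left_mono) auto
    moreover have "ennreal (1 / 4 ^ n) * 4 ^ n = 1"
    proof -
      have "(4::ennreal) ^ n = ennreal (4 ^ n)" by (simp add: ennreal_power flip: ennreal_numeral)
      then show ?thesis by (simp flip: ennreal_mult)
    qed
    ultimately have "tcost h \<le> ennreal (c / 4 ^ n)"
      using c by (simp add: mult.assoc[symmetric] flip: ennreal_mult)
    then show ?thesis using W2cost_le_tcost[OF h(1)] by (rule order_trans[rotated])
  qed
  obtain h where h: "h \<in> couplings (M 0) \<nu>" using g[of 0] by blast
  have \<nu>: "\<nu> \<in> P2 \<omega>0"
    using P2I[OF M[of 0] couplingD(10,11)[OF h]] le_less_trans[OF cost[of 0]] by simp
  have W: "(W2 (s (r k)) \<nu>)\<^sup>2 \<le> c / 4 ^ Suc k" for k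
    using W2_sq_le[OF cost[of "Suc k"]] c(1) by (simp add: M_def)
  \<comment> \<open>So far only a subsequence converges; the Cauchy property and the triangle
    inequality extend this to the whole sequence.\<close>
  have "(\<lambda>n. W2 (s n) \<nu>) \<longlonglongrightarrow> 0"
  proof (rule LIMSEQ_I)
    fix \<epsilon> :: real assume \<epsilon>: "0 < \<epsilon>"
    obtain N1 where N1: "\<And>m n. m \<ge> N1 \<Longrightarrow> n \<ge> N1 \<Longrightarrow> W2 (s m) (s n) < \<epsilon> / 2"
      using cau[OF half_gt_zero[OF \<epsilon>]] by blast
    have "(\<lambda>k. c / 4 ^ k) \<longlonglongrightarrow> 0" by (rule LIMSEQ_divide_realpow_zero) simp
    then have "eventually (\<lambda>k. c / 4 ^ k < (\<epsilon> / 2)\<^sup>2) sequentially"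
      using \<epsilon> by (intro order_tendstoD(2)) auto
    then obtain N2 where N2: "\<And>k. k \<ge> N2 \<Longrightarrow> c / 4 ^ k < (\<epsilon> / 2)\<^sup>2"
      unfolding eventually_sequentially by blast
    define k where "k = max N1 N2"
    have "(W2 (s (r k)) \<nu>)\<^sup>2 < (\<epsilon> / 2)\<^sup>2"
      using W[of k] N2[of "Suc k"] by (simp only: k_def) linarith
    then have 1: "W2 (s (r k)) \<nu> < \<epsilon> / 2"
      by (rule power2_less_imp_less) (use \<epsilon> in simp)
    have "W2 (s n) \<nu> < \<epsilon>" if "n \<ge> N1" for n
    proof -
      have "W2 (s n) (s (r k)) < \<epsilon> / 2"
        using N1[OF that, of "r k"] r(3)[of k] by (simp add: k_def)
      then show ?thesis using tri[OF s[of n] s[of "r k"] \<nu>] 1 by linarith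
    qed
    then show "\<exists>no. \<forall>n\<ge>no. norm (W2 (s n) \<nu> - 0) < \<epsilon>"
      by (intro exI[of _ N1]) (simp add: abs_of_nonneg[OF W2_nonneg])
  qed
  then show ?thesis using \<nu> by blast
qed

section \<open>The gradient flow\<close>

context
  fixes \<omega>0 :: "'a::euclidean_space measure" and E :: "'a measure \<Rightarrow> ereal" and lam :: real
  assumes prob: "prob_space \<omega>0" and sets: "sets \<omega>0 = sets borel"
    and not_MInf: "\<forall>\<nu>\<in>P2 \<omega>0. E \<nu> \<noteq> -\<infinity>"
    and proper: "proper_fun \<omega>0 E" and coer: "coercive \<omega>0 E" and lsc: "lsc_W2 \<omega>0 E"
    and conv: "convex_gen_geod \<omega>0 E lam"
begin

lemma domE_real: "\<mu> \<in> domE \<omega>0 E \<Longrightarrow> E \<mu> = ereal (real_of_ereal (E \<mu>))"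
  using not_MInf by (cases "E \<mu>") (auto simp: domE_def)

lemma domE_I: "\<mu> \<in> P2 \<omega>0 \<Longrightarrow> E \<mu> \<le> ereal c \<Longrightarrow> \<mu> \<in> domE \<omega>0 E \<and> real_of_ereal (E \<mu>) \<le> c"
  using not_MInf by (cases "E \<mu>") (auto simp: domE_def)

lemma domE_P2: "\<mu> \<in> domE \<omega>0 E \<Longrightarrow> \<mu> \<in> P2 \<omega>0"
  by (simp add: domE_def)

lemma exists_plan: "\<mu>0 \<in> P2 \<omega>0 \<Longrightarrow> \<mu>1 \<in> P2 \<omega>0 \<Longrightarrow> \<omega> \<in> P2 \<omega>0 \<Longrightarrow>
    \<exists>w\<in>transport_plans \<omega> \<mu>0 \<mu>1. \<forall>\<alpha>\<in>{0..1}.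
        E (gen_geod w \<alpha>) \<le> ereal (1 - \<alpha>) * E \<mu>0 + ereal \<alpha> * E \<mu>1
                              - ereal (\<alpha> * (1 - \<alpha>) * (lam / 2) * (W2plan w)\<^sup>2)"
  using conv unfolding convex_gen_geod_def by blast

text \<open>The plans provided by the convexity hypothesis make a general gluing lemma unnecessary here.\<close>

lemma W2_triangle:
  assumes "x \<in> P2 \<omega>0" "y \<in> P2 \<omega>0" "z \<in> P2 \<omega>0"
  shows "W2 x z \<le> W2 x y + W2 y z"
proof -
  obtain w where w: "w \<in> transport_plans y x z" using exists_plan[OF assms(1,3,2)] by blast
  show ?thesis
    using W2_triangle_plan[OF w W2cost_finite[OF assms(2,1)] W2cost_finite[OF assms(2,3)]] W2_commute[of x y] by simp
qed

text \<open>For given base and endpoints the convexity hypothesis supplies one plan for all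
  \<alpha>; its \<open>W2plan\<close> is the \<open>W\<close> of the abstract setting, and the
  interpolated measures are the points \<open>z\<close>.\<close>

lemma W2_gen_convex_functional:
  "gen_convex_functional (P2 \<omega>0) W2 (domE \<omega>0 E) (\<lambda>\<mu>. real_of_ereal (E \<mu>)) lam"
proof (unfold_locales)
  show "0 \<le> W2 x y" for x y :: "'a measure" by (rule W2_nonneg)
  show "W2 x x = 0" if "x \<in> P2 \<omega>0" for x
    using W2cost_self[OF P2D(1,2)[OF that]] by (simp add: W2_def)
  show "W2 x y = W2 y x" for x y :: "'a measure" by (rule W2_commute)
  show "W2 x z \<le> W2 x y + W2 y z" if "x \<in> P2 \<omega>0" "y \<in> P2 \<omega>0" "z \<in> P2 \<omega>0" for x y z
    by (rule W2_triangle[OF that])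
  show "domE \<omega>0 E \<subseteq> P2 \<omega>0" by (auto simp: domE_def)
  show "domE \<omega>0 E \<noteq> {}" using proper by (simp add: proper_fun_def)
  show "\<exists>x\<in>P2 \<omega>0. (\<lambda>n. W2 (s n) x) \<longlonglongrightarrow> 0"
    if "\<And>n. s n \<in> P2 \<omega>0" "\<And>\<epsilon>. 0 < \<epsilon> \<Longrightarrow> \<exists>N. \<forall>m\<ge>N. \<forall>n\<ge>N. W2 (s m) (s n) < \<epsilon>" for s
    by (rule P2_complete[OF base_in_P2[OF prob sets] W2_triangle that])
  show "x \<in> domE \<omega>0 E \<and> real_of_ereal (E x) \<le> c"
    if s: "\<And>n. s n \<in> domE \<omega>0 E" "\<And>n. real_of_ereal (E (s n)) \<le> c" and x: "x \<in> P2 \<omega>0" "(\<lambda>n. W2 (s n) x) \<longlonglongrightarrow> 0" for s x c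
  proof (rule domE_I[OF x(1)])
    have "E (s n) \<le> ereal c" for n
      using s(2)[of n] by (subst domE_real[OF s(1)]) simp
    then have "liminf (\<lambda>n. E (s n)) \<le> liminf (\<lambda>n::nat. ereal c)"
      by (intro Liminf_mono always_eventually) auto
    also have "\<dots> = ereal c" by (simp add: Liminf_const)
    finally have "liminf (\<lambda>n. E (s n)) \<le> ereal c" .
    moreover have "E x \<le> liminf (\<lambda>n. E (s n))"
      using lsc x s(1) domE_P2 unfolding lsc_W2_def by blast
    ultimately show "E x \<le> ereal c" by (rule order_trans[rotated])
  qed
  show "\<exists>u\<in>P2 \<omega>0. \<exists>b\<ge>0. \<exists>C. \<forall>v\<in>domE \<omega>0 E. - C - b * (W2 u v)\<^sup>2 \<le> real_of_ereal (E v)"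
  proof -
    obtain \<tau>0 u0 where t: "\<tau>0 > 0" and u0: "u0 \<in> P2 \<omega>0"
      and inf: "-\<infinity> < (INF v\<in>P2 \<omega>0. ereal ((W2 u0 v)\<^sup>2 / (2 * \<tau>0)) + E v)"
      using coer unfolding coercive_def by blast
    obtain k where k: "ereal k < (INF v\<in>P2 \<omega>0. ereal ((W2 u0 v)\<^sup>2 / (2 * \<tau>0)) + E v)"
      using ereal_dense2[OF inf] by blast
    have "k - (1 / (2 * \<tau>0)) * (W2 u0 v)\<^sup>2 \<le> real_of_ereal (E v)" if v: "v \<in> domE \<omega>0 E" for v
    proof -
      have "ereal k \<le> ereal ((W2 u0 v)\<^sup>2 / (2 * \<tau>0)) + E v"
        using less_le_trans[OF k INF_lower[OF domE_P2[OF v]]] by simp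
      then show ?thesis by (subst (asm) domE_real[OF v]) simp
    qed
    then show ?thesis
      using u0 t by (intro bexI[OF _ u0] exI[of _ "1 / (2 * \<tau>0)"] conjI exI[of _ "- k"]) auto
  qed
  show "\<exists>W\<ge>W2 x y. \<forall>\<alpha>\<in>{0..1}. \<exists>z\<in>domE \<omega>0 E.
        real_of_ereal (E z) \<le> (1 - \<alpha>) * real_of_ereal (E x) + \<alpha> * real_of_ereal (E y) - \<alpha> * (1 - \<alpha>) * (lam / 2) * W\<^sup>2 \<and>
        (W2 w z)\<^sup>2 \<le> (1 - \<alpha>) * (W2 w x)\<^sup>2 + \<alpha> * (W2 w y)\<^sup>2 - \<alpha> * (1 - \<alpha>) * W\<^sup>2"
    if w: "w \<in> P2 \<omega>0" and x: "x \<in> domE \<omega>0 E" and y: "y \<in> domE \<omega>0 E" for w x y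
  proof -
    obtain p where p: "p \<in> transport_plans w x y" and Ep: "\<And>\<alpha>. \<alpha> \<in> {0..1} \<Longrightarrow>
        E (gen_geod p \<alpha>) \<le> ereal (1 - \<alpha>) * E x + ereal \<alpha> * E y - ereal (\<alpha> * (1 - \<alpha>) * (lam / 2) * (W2plan p)\<^sup>2)"
      using exists_plan[OF domE_P2[OF x] domE_P2[OF y] w] by blast
    note fin = W2cost_finite[OF w domE_P2[OF x]] W2cost_finite[OF w domE_P2[OF y]]
    show ?thesis
    proof (intro exI[of _ "W2plan p"] conjI ballI)
      show "W2 x y \<le> W2plan p" by (rule W2_le_W2plan[OF p fin])
      fix \<alpha> :: real assume a: "\<alpha> \<in> {0..1}"
      then have a01: "0 \<le> \<alpha>" "\<alpha> \<le> 1" by auto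
      note G = gen_geod_W2[OF p fin a01]
      have "E (gen_geod p \<alpha>) \<le> ereal ((1 - \<alpha>) * real_of_ereal (E x) + \<alpha> * real_of_ereal (E y) - \<alpha> * (1 - \<alpha>) * (lam / 2) * (W2plan p)\<^sup>2)"
        using Ep[OF a] by (subst (asm) domE_real[OF x], subst (asm) domE_real[OF y]) simp
      from domE_I[OF P2I[OF w G(1-3)] this] G(4)
      show "\<exists>z\<in>domE \<omega>0 E.
        real_of_ereal (E z) \<le> (1 - \<alpha>) * real_of_ereal (E x) + \<alpha> * real_of_ereal (E y) - \<alpha> * (1 - \<alpha>) * (lam / 2) * (W2plan p)\<^sup>2 \<and>
        (W2 w z)\<^sup>2 \<le> (1 - \<alpha>) * (W2 w x)\<^sup>2 + \<alpha> * (W2 w y)\<^sup>2 - \<alpha> * (1 - \<alpha>) * (W2plan p)\<^sup>2"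
        by (intro bexI[of _ "gen_geod p \<alpha>"]) auto
    qed
  qed
qed

interpretation G: gen_convex_functional "P2 \<omega>0" W2 "domE \<omega>0 E" "\<lambda>\<mu>. real_of_ereal (E \<mu>)" lam
  by (rule W2_gen_convex_functional)

text \<open>\<open>Jres\<close> chooses among minimizers over all of \<open>P2 \<omega>0\<close>.
  The penalized energy is infinite outside the domain, so a minimizer over the domain is one over
  the whole space and, conversely, every choice lies in the domain.\<close>

lemma W2_minimizing_movement:
  "minimizing_movement (P2 \<omega>0) W2 (domE \<omega>0 E) (\<lambda>\<mu>. real_of_ereal (E \<mu>)) lam (Jres \<omega>0 E)"
proof (unfold_locales)
  show "Jres \<omega>0 E 0 x = x" for x by (simp add: Jres_def)
  fix \<tau> x assume t: "0 < \<tau>" "2 * neg_part lam * \<tau> < 1" and x: "x \<in> P2 \<omega>0"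
  define \<Phi> where "\<Phi> \<nu> = ereal ((W2 x \<nu>)\<^sup>2 / (2 * \<tau>)) + E \<nu>" for \<nu>
  have \<Phi>: "\<Phi> \<nu> = ereal ((W2 x \<nu>)\<^sup>2 / (2 * \<tau>) + real_of_ereal (E \<nu>))" if "\<nu> \<in> domE \<omega>0 E" for \<nu>
    unfolding \<Phi>_def by (subst domE_real[OF that]) simp
  have \<Phi>_inf: "\<Phi> \<nu> = \<infinity>" if "\<nu> \<in> P2 \<omega>0" "\<nu> \<notin> domE \<omega>0 E" for \<nu>
    using that by (auto simp: \<Phi>_def domE_def)
  obtain z where z: "G.is_min \<tau> x z" using G.exists_min[OF x t] by blast
  define Q where "Q \<nu> \<longleftrightarrow> \<nu> \<in> P2 \<omega>0 \<and> (\<forall>\<nu>'\<in>P2 \<omega>0. \<Phi> \<nu> \<le> \<Phi> \<nu>')" for \<nu>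
  have zD: "z \<in> domE \<omega>0 E" and zmin: "\<And>y. y \<in> domE \<omega>0 E \<Longrightarrow> \<Phi> z \<le> \<Phi> y"
    using z by (auto simp: G.is_min_def \<Phi>)
  have "Q z"
    unfolding Q_def using domE_P2[OF zD] zmin \<Phi>_inf by (metis ereal_less_eq(1))
  then have "Q (SOME \<nu>. Q \<nu>)" by (rule someI)
  moreover have "Jres \<omega>0 E \<tau> x = (SOME \<nu>. Q \<nu>)" using t by (simp add: Jres_def Q_def \<Phi>_def)
  ultimately have QJ: "Q (Jres \<omega>0 E \<tau> x)" by simp
  let ?J = "Jres \<omega>0 E \<tau> x"
  have "\<Phi> ?J \<le> \<Phi> z" using QJ domE_P2[OF zD] by (auto simp: Q_def)
  then have JD: "?J \<in> domE \<omega>0 E"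
    using \<Phi>_inf[of ?J] QJ \<Phi>[OF zD] unfolding Q_def by (metis ereal_infty_less_eq(1) PInfty_neq_ereal(1))
  have "\<Phi> ?J \<le> \<Phi> y" if "y \<in> domE \<omega>0 E" for y
    using QJ domE_P2[OF that] by (auto simp: Q_def)
  then show "G.is_min \<tau> x ?J"
    unfolding G.is_min_def using JD by (simp add: \<Phi>)
qed

interpretation J: minimizing_movement "P2 \<omega>0" W2 "domE \<omega>0 E" "\<lambda>\<mu>. real_of_ereal (E \<mu>)" lam "Jres \<omega>0 E"
  by (rule W2_minimizing_movement)

text \<open>The slope is an infimum over radii, so each larger number bounds the difference
  quotients on some punctured ball. This is the local condition that convexity turns into a global
  one.\<close>

lemma slope_le_metric_slope:
  assumes mu: "\<mu> \<in> dom_slope \<omega>0 E"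
  shows "G.slope_le (real_of_ereal (slope \<omega>0 E \<mu>)) \<mu>"
proof -
  define S where "S = real_of_ereal (slope \<omega>0 E \<mu>)"
  have D: "\<mu> \<in> domE \<omega>0 E" and fin: "slope \<omega>0 E \<mu> < \<infinity>"
    using mu by (auto simp: dom_slope_def)
  have pos: "0 \<le> slope \<omega>0 E \<mu>" unfolding slope_def by (rule INF_greatest) simp
  have S: "slope \<omega>0 E \<mu> = ereal S" "0 \<le> S"
    using fin pos by (cases "slope \<omega>0 E \<mu>"; simp add: S_def)+
  have "G.slope_le S \<mu>"
  proof (rule G.slope_le_of_local[OF S(2) D])
    fix S' assume "S < S'"
    then have "slope \<omega>0 E \<mu> < ereal S'" using S by simp
    then obtain r where r: "0 < r" and sup: "max 0 (SUP \<nu>\<in>{\<nu>\<in>P2 \<omega>0. 0 < W2 \<mu> \<nu> \<and> W2 \<mu> \<nu> < r}.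
        max 0 (E \<mu> - E \<nu>) / ereal (W2 \<mu> \<nu>)) < ereal S'"
      unfolding slope_def INF_less_iff by auto
    have "real_of_ereal (E \<mu>) - real_of_ereal (E z) \<le> S' * W2 \<mu> z"
      if z: "z \<in> domE \<omega>0 E" "0 < W2 \<mu> z" "W2 \<mu> z < r" for z
    proof -
      have "max 0 (E \<mu> - E z) / ereal (W2 \<mu> z) \<le> (SUP \<nu>\<in>{\<nu>\<in>P2 \<omega>0. 0 < W2 \<mu> \<nu> \<and> W2 \<mu> \<nu> < r}.
        max 0 (E \<mu> - E \<nu>) / ereal (W2 \<mu> \<nu>))"
        using z domE_P2[OF z(1)] by (intro SUP_upper) auto
      also have "\<dots> \<le> ereal S'"
        using order.strict_trans1[OF max.cobounded2 sup] by (rule less_imp_le)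
      finally have "max 0 (E \<mu> - E z) / ereal (W2 \<mu> z) \<le> ereal S'" .
      then have "max 0 (real_of_ereal (E \<mu>) - real_of_ereal (E z)) / W2 \<mu> z \<le> S'"
        by (subst (asm) domE_real[OF D], subst (asm) domE_real[OF z(1)]) (use z(2) in \<open>simp add: max_def split: if_splits\<close>)
      then show ?thesis using z(2) by (simp add: divide_le_eq)
    qed
    then show "\<exists>r>0. \<forall>z\<in>domE \<omega>0 E. 0 < W2 \<mu> z \<longrightarrow> W2 \<mu> z < r \<longrightarrow>
        real_of_ereal (E \<mu>) - real_of_ereal (E z) \<le> S' * W2 \<mu> z"
      using r by blast
  qed
  then show ?thesis by (simp add: S_def)
qed

lemma limit_curve_gradient_flow:
  assumes mu: "\<mu> \<in> J.D_closure" and u: "J.limit_curve \<mu> u"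
  shows "gradient_flow \<omega>0 E lam u \<mu>"
  unfolding gradient_flow_def
proof (intro conjI ballI allI impI)
  show "u t \<in> P2 \<omega>0" if "0 < t" for t using J.limit_curveD(2)[OF u] that by simp
  show "((\<lambda>t. W2 (u t) \<mu>) \<longlongrightarrow> 0) (at_right 0)"
    by (rule J.limit_curve_tendsto_0[OF J.D_closure_X[OF mu] u])
  show "loc_abs_cont u"
    unfolding loc_abs_cont_def
  proof (intro allI impI)
    fix a b :: real assume "0 < a \<and> a \<le> b"
    then obtain K where K: "0 \<le> K" "\<And>s t. a \<le> s \<Longrightarrow> s \<le> t \<Longrightarrow> t \<le> b \<Longrightarrow> W2 (u s) (u t) \<le> K * (t - s)"
      using J.limit_curve_lipschitz[OF mu u, of a b] by blast
    show "\<exists>m. m integrable_on {a..b} \<and> (\<forall>s t. a \<le> s \<and> s \<le> t \<and> t \<le> b \<longrightarrow> W2 (u s) (u t) \<le> integral {s..t} m)"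
      \<comment> \<open>A Lipschitz bound is absolute continuity with the constant density
        \<open>K\<close>.\<close>
      using K(2) by (intro exI[of _ "\<lambda>_. K"]) (auto simp: mult.commute)
  qed
  fix \<omega> assume w: "\<omega> \<in> domE \<omega>0 E"
  have "AE t in lborel. 0 < t \<longrightarrow> (\<exists>D. ((\<lambda>s. (W2 (u s) \<omega>)\<^sup>2) has_real_derivative D) (at t))"
    by (rule locally_lipschitz_AE_differentiable)
      (rule J.limit_curve_sq_dist_lipschitz[OF mu u domE_P2[OF w]])
  then show "AE t in lborel. t > 0 \<longrightarrow> (\<exists>D. ((\<lambda>s. (W2 (u s) \<omega>)\<^sup>2) has_real_derivative D) (at t) \<and>
             ereal (D / 2 + lam / 2 * (W2 (u t) \<omega>)\<^sup>2) \<le> E \<omega> - E (u t))"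
  proof eventually_elim
    case (elim t)
    show ?case
    proof
      assume t: "0 < t"
      with elim obtain D where D: "((\<lambda>s. (W2 (u s) \<omega>)\<^sup>2) has_real_derivative D) (at t)" by blast
      note evi = J.limit_curve_evi_deriv[OF mu u w t]
      have "ereal (D / 2 + lam / 2 * (W2 (u t) \<omega>)\<^sup>2) \<le> ereal (real_of_ereal (E \<omega>) - real_of_ereal (E (u t)))"
        using evi(2)[OF D] by simp
      also have "\<dots> = E \<omega> - E (u t)"
        by (subst (2) domE_real[OF w], subst (2) domE_real[OF evi(1)]) simp
      finally show "\<exists>D. ((\<lambda>s. (W2 (u s) \<omega>)\<^sup>2) has_real_derivative D) (at t) \<and>
             ereal (D / 2 + lam / 2 * (W2 (u t) \<omega>)\<^sup>2) \<le> E \<omega> - E (u t)"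
        using D by blast
    qed
  qed
qed

end

theorem theorem2p7:
  fixes \<omega>0 :: "'a::euclidean_space measure"
    and E :: "'a measure \<Rightarrow> ereal"
    and lam :: real
    and \<mu> :: "'a measure"
  assumes "prob_space \<omega>0" and "sets \<omega>0 = sets borel"
    and "\<forall>\<nu>\<in>P2 \<omega>0. E \<nu> \<noteq> -\<infinity>"
    and "proper_fun \<omega>0 E" and "coercive \<omega>0 E" and "lsc_W2 \<omega>0 E"
    and "convex_gen_geod \<omega>0 E lam"
    and "\<mu> \<in> domE_closure \<omega>0 E"
  shows "\<exists>u. (\<forall>t\<ge>0. u t \<in> P2 \<omega>0) \<and>
    (\<forall>t\<ge>0. (\<lambda>n. W2 ((Jres \<omega>0 E (t / real n) ^^ n) \<mu>) (u t)) \<longlonglongrightarrow> 0) \<and>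
    (\<forall>T\<ge>0. \<forall>\<epsilon>>0. \<exists>N. \<forall>n\<ge>N. \<forall>t\<in>{0..T}.
        W2 ((Jres \<omega>0 E (t / real n) ^^ n) \<mu>) (u t) < \<epsilon>) \<and>
    gradient_flow \<omega>0 E lam u \<mu> \<and>
    (\<mu> \<in> dom_slope \<omega>0 E \<longrightarrow>
      (\<forall>t\<ge>0. \<forall>n::nat. real n > 2 * neg_part lam * t \<longrightarrow>
         W2 ((Jres \<omega>0 E (t / real n) ^^ n) \<mu>) (u t)
           \<le> sqrt 3 * (t / sqrt (real n)) * exp (3 * neg_part lam * t)
              * real_of_ereal (slope \<omega>0 E \<mu>)))"
proof -
  interpret J: minimizing_movement "P2 \<omega>0" W2 "domE \<omega>0 E" "\<lambda>\<mu>. real_of_ereal (E \<mu>)" lam "Jres \<omega>0 E"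
    by (rule W2_minimizing_movement[OF assms(1-7)])
  have D_closure: "\<mu> \<in> J.D_closure" using assms(8) by (auto simp: J.D_closure_def domE_closure_def)
  note muX = J.D_closure_X[OF D_closure]
  obtain u where u: "J.limit_curve \<mu> u" using J.limit_curve_exists[OF D_closure] by blast
  note unif = J.limit_curve_uniform[OF muX u]
  show ?thesis
  proof (intro exI[of _ u] conjI allI impI)
    show "u t \<in> P2 \<omega>0" if "0 \<le> t" for t by (rule J.limit_curveD(2)[OF u that])
    show "gradient_flow \<omega>0 E lam u \<mu>" by (rule limit_curve_gradient_flow[OF assms(1-7) D_closure u])
    show "\<exists>N. \<forall>n\<ge>N. \<forall>t\<in>{0..T}. W2 ((Jres \<omega>0 E (t / real n) ^^ n) \<mu>) (u t) < \<epsilon>"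
      if "0 \<le> T" "0 < \<epsilon>" for T \<epsilon> by (rule unif[OF that])
    show "(\<lambda>n. W2 ((Jres \<omega>0 E (t / real n) ^^ n) \<mu>) (u t)) \<longlonglongrightarrow> 0" if t: "0 \<le> t" for t
    proof (rule LIMSEQ_I)
      fix \<epsilon> :: real assume "0 < \<epsilon>"
      then obtain N where N: "\<forall>n\<ge>N. \<forall>s\<in>{0..t}. W2 ((Jres \<omega>0 E (s / real n) ^^ n) \<mu>) (u s) < \<epsilon>"
        using unif[OF t] by blast
      show "\<exists>N. \<forall>n\<ge>N. norm (W2 ((Jres \<omega>0 E (t / real n) ^^ n) \<mu>) (u t) - 0) < \<epsilon>"
        using N t by (intro exI[of _ N]) (simp add: abs_of_nonneg[OF W2_nonneg])
    qed
    fix t :: real and n :: nat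
    assume slope: "\<mu> \<in> dom_slope \<omega>0 E" and t: "0 \<le> t" and n: "2 * neg_part lam * t < real n"
    define S where "S = real_of_ereal (slope \<omega>0 E \<mu>)"
    have slope_le: "J.slope_le S \<mu>" unfolding S_def by (rule slope_le_metric_slope[OF assms(1-7) slope])
    then have S: "0 \<le> S" by (simp add: J.slope_le_def)
    define A where "A = t / sqrt (real n) * exp (3 * neg_part lam * t) * S"
    have "W2 ((Jres \<omega>0 E (t / real n) ^^ n) \<mu>) (u t) \<le> A"
      unfolding A_def by (rule J.limit_curve_error[OF u slope_le t n])
    \<comment> \<open>The estimate obtained has constant 1 in place of the square root of 3;
      \<open>A\<close> is nonnegative.\<close>
    also have "A \<le> sqrt 3 * A"
    proof -
      have "0 \<le> A" unfolding A_def using t S by simp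
      moreover have "1 \<le> sqrt 3" by simp
      ultimately show ?thesis using mult_right_mono[of 1 "sqrt 3" A] by simp
    qed
    finally show "W2 ((Jres \<omega>0 E (t / real n) ^^ n) \<mu>) (u t)
           \<le> sqrt 3 * (t / sqrt (real n)) * exp (3 * neg_part lam * t) * real_of_ereal (slope \<omega>0 E \<mu>)"
      by (simp add: A_def S_def mult.assoc)
  qed
qed

end
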